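(* Let $B>0$, let $F:\Omega\to K_{kc}^B(\mathbb{R}^d)$ be a set valued random variable and let $X$ be a random element of $\mathcal{X}\subset\mathbb{R}^p$ defined on the same probability space. Then: (i) The Fréchet mean $\mathbb{E}_\oplus[F]$ and the conditional Fréchet mean $\mathbb{E}_\oplus[F|X]$ with respect to the metric $d_{kc}$ uniquely exist. (ii) $\mathbb{E}_\oplus[F]=\mathbb{E}[F]$, where $\mathbb{E}[F]$ is the Aumann mean of $F$. (iii) $\mathbb{E}_\oplus[F|X]=\mathbb{E}[F|X]$, where $\mathbb{E}[F|X]$ is the conditional Aumann mean of $F$ given $X$, and $\mathbb{E}_\oplus[F]=\mathbb{E}_\oplus\big[\mathbb{E}_\oplus[F|X]\big]$.
   Context: $(\Omega,\mathcal{A},\mu)$ is a probability space. $K_{kc}(\mathbb{R}^d)$ is the collection of nonempty compact convex subsets of $\mathbb{R}^d$, and for $B>0$, $K_{kc}^B(\mathbb{R}^d)=\{F\in K_{kc}(\mathbb{R}^d):\sup_{f\in F}\|f\|\le B\}$. A set valued random variable (SVRV) is a random element taking values in a space of closed subsets of $\mathbb{R}^d$. Support function: $s(p,F)=\sup_{f\in F}\langle p,f\rangle$ for $p\in\mathbb{S}^{d-1}=\{x\in\mathbb{R}^d:\|x\|=1\}$. The metric $d_{kc}$ on $K_{kc}(\mathbb{R}^d)$ is $d_{kc}(F,G)=\left(\int_{\mathbb{S}^{d-1}}\{s(p,F)-s(p,G)\}^2\,dp\right)^{1/2}$, where $dp$ is the surface measure on $\mathbb{S}^{d-1}$ (counting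 measure on $\{-1,1\}$ when $d=1$). Aumann mean: let $\mathcal{S}^1(F)$ be the set of measurable selections $f$ of $F$ (random vectors $f$ with $f\in F$) such that $\mathbb{E}\|f\|<\infty$. Then $\mathbb{E}[F]=\{\mathbb{E}[f]:f\in\mathcal{S}^1(F)\}$, and the conditional Aumann mean is $\mathbb{E}[F|X]=\{\mathbb{E}[f|X]:f\in\mathcal{S}^1(F)\}$, understood as the $\sigma(X)$-measurable random set whose $\sigma(X)$-measurable integrable selections are given by these conditional expectations. Fréchet means: $\mathbb{E}_\oplus[F]\in\mathrm{argmin}_{\nu\in K_{kc}^B(\mathbb{R}^d)}\mathbb{E}[d_{kc}^2(\nu,F)]$ and $\mathbb{E}_\oplus[F|X]\in\mathrm{argmin}_{\nu\in K_{kc}^B(\mathbb{R}^d)}\mathbb{E}[d_{kc}^2(\nu,F)|X]$. The object $\mathbb{E}_\oplus[\mathbb{E}_\oplus[F|X]]$ is the Fréchet mean of the random set $\mathbb{E}_\oplus[F|X]$. Statements about conditional objects are understood almost surely. *)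

theory Defs
  imports "HOL-Probability.Probability"
begin

definition Kkc :: "'e::euclidean_space set set" where
  "Kkc = {F. F \<noteq> {} \<and> compact F \<and> convex F}"

definition Kkc_bdd :: "real \<Rightarrow> 'e::euclidean_space set set" where
  "Kkc_bdd B = {F \<in> Kkc. (SUP f\<in>F. norm f) \<le> B}"

definition support_fun :: "'e::euclidean_space \<Rightarrow> 'e set \<Rightarrow> real" where
  "support_fun p F = (SUP f\<in>F. p \<bullet> f)"

text \<open>
  Surface measure of a set \<open>A\<close> of directions, in polar coordinates: \<open>d\<close> times the Lebesgue
  measure of the part of the cone over \<open>A\<close> in the unit ball. Total mass is \<open>d\<close> times the volume
  of the unit ball. For \<open>d = 1\<close> this is counting measure on \<open>{-1, 1}\<close>.
\<close>

definition surface_measure :: "'e::euclidean_space measure" where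
  "surface_measure =
     scale_measure (of_nat DIM('e))
       (distr (restrict_space lborel (cball 0 1 - {0})) (restrict_space borel (sphere 0 1)) sgn)"

definition d_kc :: "'e::euclidean_space set \<Rightarrow> 'e set \<Rightarrow> real" where
  "d_kc F G = sqrt (\<integral>p. (support_fun p F - support_fun p G)\<^sup>2 \<partial>surface_measure)"

text \<open>
  Effros sigma-algebra on a family \<open>\<C>\<close> of nonempty closed sets. In Euclidean space it is the Borel
  sigma-algebra of the Fell topology, and on nonempty compact convex sets also that of the
  Hausdorff metric and of \<^const>\<open>d_kc\<close>. A set valued random variable with values in \<open>\<C>\<close> is a
  measurable map into this space.
\<close>

definition set_space :: "'e::euclidean_space set set \<Rightarrow> 'e set measure" where
  "set_space \<C> = sigma \<C> ((\<lambda>U. {F \<in> \<C>. F \<inter> U \<noteq> {}}) ` {U. open U})"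

definition closed_sets :: "'e::euclidean_space set set" where
  "closed_sets = {F. F \<noteq> {} \<and> closed F}"

definition selections :: "'a measure \<Rightarrow> ('a \<Rightarrow> 'e::euclidean_space set) \<Rightarrow> ('a \<Rightarrow> 'e) set" where
  "selections M F = {f. integrable M f \<and> (AE \<omega> in M. f \<omega> \<in> F \<omega>)}"

definition aumann_mean :: "'a measure \<Rightarrow> ('a \<Rightarrow> 'e::euclidean_space set) \<Rightarrow> 'e set" where
  "aumann_mean M F = {(\<integral>\<omega>. f \<omega> \<partial>M) | f. f \<in> selections M F}"

definition is_frechet_mean ::
  "'a measure \<Rightarrow> real \<Rightarrow> ('a \<Rightarrow> 'e::euclidean_space set) \<Rightarrow> 'e set \<Rightarrow> bool" where
  "is_frechet_mean M B F N \<longleftrightarrow>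
     is_arg_min (\<lambda>\<nu>. \<integral>\<omega>. (d_kc \<nu> (F \<omega>))\<^sup>2 \<partial>M) (\<lambda>\<nu>. \<nu> \<in> Kkc_bdd B) N"

text \<open>
  The conditional notions take a sub-sigma-algebra \<open>G\<close> of \<open>M\<close>, given as a measure space of which
  only the measurable sets matter; expectations and null sets always refer to \<open>M\<close>.
\<close>

definition vec_cond_exp ::
  "'a measure \<Rightarrow> 'a measure \<Rightarrow> ('a \<Rightarrow> 'e::euclidean_space) \<Rightarrow> 'a \<Rightarrow> 'e" where
  "vec_cond_exp M G f \<omega> = (\<Sum>b\<in>Basis. real_cond_exp M G (\<lambda>\<omega>. f \<omega> \<bullet> b) \<omega> *\<^sub>R b)"

text \<open>
  The \<open>G\<close>-measurable random closed set whose \<open>G\<close>-measurable integrable selections are exactly the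
  versions of the conditional expectations of the integrable selections of \<open>F\<close>.
\<close>

definition is_cond_aumann_mean ::
  "'a measure \<Rightarrow> 'a measure \<Rightarrow> ('a \<Rightarrow> 'e::euclidean_space set) \<Rightarrow> ('a \<Rightarrow> 'e set) \<Rightarrow> bool" where
  "is_cond_aumann_mean M G F N \<longleftrightarrow>
     N \<in> G \<rightarrow>\<^sub>M set_space closed_sets \<and>
     (\<forall>g \<in> borel_measurable G.
        g \<in> selections M N \<longleftrightarrow> (\<exists>f \<in> selections M F. AE \<omega> in M. g \<omega> = vec_cond_exp M G f \<omega>))"

text \<open>
  \<open>D\<close> is the random objective function sending \<open>\<nu>\<close> to the conditional expectation of the squared
  distance of \<open>\<nu>\<close> and \<open>F\<close>. For each \<open>\<nu>\<close> this is determined only up to a null set depending on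
  \<open>\<nu>\<close>, and minimising over the uncountable family of all \<open>\<nu>\<close> is meaningless for arbitrary
  versions. Requiring the version to be continuous in \<open>\<nu>\<close> fixes it up to one common null set,
  because the family of sets is separable.
\<close>

definition is_cond_frechet_objective ::
  "'a measure \<Rightarrow> 'a measure \<Rightarrow> real \<Rightarrow> ('a \<Rightarrow> 'e::euclidean_space set)
    \<Rightarrow> ('e set \<Rightarrow> 'a \<Rightarrow> real) \<Rightarrow> bool" where
  "is_cond_frechet_objective M G B F D \<longleftrightarrow>
     (\<forall>\<nu> \<in> Kkc_bdd B. D \<nu> \<in> borel_measurable G \<and>
        (AE \<omega> in M. D \<nu> \<omega> = real_cond_exp M G (\<lambda>\<omega>. (d_kc \<nu> (F \<omega>))\<^sup>2) \<omega>)) \<and>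
     (\<forall>\<omega> \<in> space M. \<forall>\<nu> \<in> Kkc_bdd B. \<forall>\<epsilon>>0. \<exists>\<delta>>0. \<forall>\<nu>' \<in> Kkc_bdd B.
        d_kc \<nu>' \<nu> < \<delta> \<longrightarrow> \<bar>D \<nu>' \<omega> - D \<nu> \<omega>\<bar> < \<epsilon>)"

definition is_cond_frechet_mean ::
  "'a measure \<Rightarrow> 'a measure \<Rightarrow> real \<Rightarrow> ('a \<Rightarrow> 'e::euclidean_space set)
    \<Rightarrow> ('a \<Rightarrow> 'e set) \<Rightarrow> bool" where
  "is_cond_frechet_mean M G B F N \<longleftrightarrow>
     N \<in> G \<rightarrow>\<^sub>M set_space (Kkc_bdd B) \<and>
     (\<exists>D. is_cond_frechet_objective M G B F D \<and>
        (AE \<omega> in M. is_arg_min (\<lambda>\<nu>. D \<nu> \<omega>) (\<lambda>\<nu>. \<nu> \<in> Kkc_bdd B) (N \<omega>)))"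

end

theory Submission
  imports Defs
begin

text \<open>
  Everything is read off support functions. A compact convex set is determined by its support
  function, the metric is an \<open>L\<^sup>2\<close> distance of support functions over the sphere, and the random set
  \<open>N\<close> that solves all the problems at once is the one with
  \<open>support_fun p (N \<omega>) = E[support_fun p (F \<omega>) | G]\<close> for each direction \<open>p\<close>
  (\<open>is_cond_support_mean\<close>). It exists (\<open>cond_support_mean_exists\<close>): take the closed convex hull of
  the conditional expectations of countably many measurable selections of \<open>F\<close> that together nearly
  attain the support function in every direction. Such selections come from the selection theorem
  of Kuratowski and Ryll-Nardzewski.

  \<open>N\<close> is the conditional Frechet mean because of the bias-variance decomposition
  \<open>E[d(\<nu>, F)\<^sup>2 | G] = d(\<nu>, N)\<^sup>2 + E[d(N, F)\<^sup>2 | G]\<close>, which is the usual one for real random variables in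
  each direction, integrated over the sphere by Fubini (\<open>set_integral_d_kc_decomposition\<close>). The
  right-hand side is a continuous version of the conditional objective, minimal exactly at
  \<open>\<nu> = N\<close>. Any other continuous version agrees with it off one null set because the family of sets
  is separable (\<open>Kkc_bdd_separable\<close>), which gives almost sure uniqueness.

  \<open>N\<close> is the conditional Aumann mean because its selections are the conditional expectations of the
  selections of \<open>F\<close>. One direction compares support functions. For the other
  (\<open>selection_of_mean_is_cond_exp\<close>), let \<open>g\<close> be a \<open>G\<close>-measurable selection of \<open>N\<close>. A descent argument
  shows that conditional expectations of selections of \<open>F\<close> come arbitrarily close to \<open>g\<close> in mean
  square. The selections achieving a given accuracy form a convex bounded set, and the parallelogram
  identity extracts from these decreasing sets a convergent sequence, whose limit has conditional
  expectation \<open>g\<close>. A random closed set is determined by its integrable selections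
  (\<open>cond_aumann_mean_AE_unique\<close>).

  The unconditional statements are the case of the trivial sigma-algebra, where \<open>N\<close> is constant, and
  \<open>E[E[F | X]] = E[F]\<close> is the tower property applied to support functions
  (\<open>cond_support_mean_tower\<close>).
\<close>

section \<open>Support functions of compact convex sets\<close>

lemma dense_sequence_exists:
  obtains z :: "nat \<Rightarrow> 'e::euclidean_space" where "\<And>x e. e > 0 \<Longrightarrow> \<exists>k. dist (z k) x < e"
proof -
  obtain D :: "'e set" where D: "countable D" "\<And>U. open U \<Longrightarrow> U \<noteq> {} \<Longrightarrow> \<exists>d\<in>D. d \<in> U"
    by (rule countable_dense_setE) blast
  have "D \<noteq> {}"
    using D(2)[of UNIV] by auto
  show thesis
  proof (rule that[of "from_nat_into D"])
    fix x :: 'e and e :: real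
    assume "e > 0"
    then obtain d where "d \<in> D" "d \<in> ball x e"
      using D(2)[of "ball x e"] by force
    moreover obtain k where "from_nat_into D k = d"
      using from_nat_into_surj[OF D(1) \<open>d \<in> D\<close>] by blast
    ultimately show "\<exists>k. dist (from_nat_into D k) x < e"
      by (auto simp: dist_commute intro!: exI[of _ k])
  qed
qed

lemma dense_sequence_closed_cover:
  fixes z :: "nat \<Rightarrow> 'e::euclidean_space"
  assumes z: "\<And>x e. e > 0 \<Longrightarrow> \<exists>k. dist (z k) x < e" and "closed S" and "\<And>k. z k \<in> S"
  shows "x \<in> S"
proof -
  have "x \<in> closure S"
    using z assms(3) by (fastforce simp: closure_approachable)
  with \<open>closed S\<close> show ?thesis
    by simp
qed

lemma Kkc_bdd_iff:
  "K \<in> Kkc_bdd B \<longleftrightarrow> K \<noteq> {} \<and> compact K \<and> convex K \<and> K \<subseteq> cball 0 B"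
proof (cases "K \<noteq> {} \<and> compact K")
  case True
  then have "bdd_above (norm ` K)"
    by (auto intro!: bounded_imp_bdd_above compact_imp_bounded compact_continuous_image continuous_intros)
  then show ?thesis
    using True by (auto simp: Kkc_bdd_def Kkc_def cSUP_le_iff)
qed (auto simp: Kkc_bdd_def Kkc_def)

lemma norm_le_if_mem_Kkc_bdd: "K \<in> Kkc_bdd B \<Longrightarrow> x \<in> K \<Longrightarrow> norm x \<le> B"
  by (auto simp: Kkc_bdd_iff subset_iff)

lemma Kkc_bdd_subset_closed_sets: "Kkc_bdd B \<subseteq> closed_sets"
  by (auto simp: Kkc_bdd_iff closed_sets_def compact_imp_closed)

lemma bdd_above_inner_image: "compact K \<Longrightarrow> bdd_above ((\<bullet>) p ` K)"
  by (intro bounded_imp_bdd_above compact_imp_bounded compact_continuous_image continuous_intros)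

lemma inner_le_support_fun: "compact K \<Longrightarrow> x \<in> K \<Longrightarrow> p \<bullet> x \<le> support_fun p K"
  unfolding support_fun_def by (rule cSUP_upper[OF _ bdd_above_inner_image])

lemma support_fun_le:
  "K \<noteq> {} \<Longrightarrow> (\<And>x. x \<in> K \<Longrightarrow> p \<bullet> x \<le> c) \<Longrightarrow> support_fun p K \<le> c"
  unfolding support_fun_def by (rule cSUP_least)

lemma support_fun_attained:
  assumes "K \<noteq> {}" "compact K"
  obtains x where "x \<in> K" "support_fun p K = p \<bullet> x"
proof -
  obtain x where x: "x \<in> K" "\<And>y. y \<in> K \<Longrightarrow> p \<bullet> y \<le> p \<bullet> x"
    using continuous_attains_sup[OF assms(2,1), of "\<lambda>x. p \<bullet> x"]
    by (auto simp: continuous_on_inner)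
  then have "support_fun p K = p \<bullet> x"
    using assms by (intro antisym support_fun_le inner_le_support_fun) auto
  with x that show thesis by blast
qed

lemma support_fun_Lipschitz:
  assumes K: "K \<in> Kkc_bdd B"
  shows "\<bar>support_fun p K - support_fun q K\<bar> \<le> B * norm (p - q)"
proof -
  have *: "support_fun a K \<le> support_fun b K + B * norm (a - b)" for a b
  proof (rule support_fun_le)
    fix x assume x: "x \<in> K"
    have "a \<bullet> x = b \<bullet> x + (a - b) \<bullet> x"
      by (simp add: inner_diff_left)
    also have "(a - b) \<bullet> x \<le> norm (a - b) * norm x"
      by (rule norm_cauchy_schwarz)
    also have "\<dots> \<le> norm (a - b) * B"
      using K x by (intro mult_left_mono) (auto simp: Kkc_bdd_iff)
    also have "b \<bullet> x \<le> support_fun b K"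
      using K x by (auto simp: Kkc_bdd_iff intro: inner_le_support_fun)
    finally show "a \<bullet> x \<le> support_fun b K + B * norm (a - b)"
      by (simp add: mult.commute)
  qed (use K in \<open>auto simp: Kkc_bdd_iff\<close>)
  show ?thesis
    using *[of p q] *[of q p] by (auto simp: norm_minus_commute)
qed

lemma support_fun_zero: "K \<noteq> {} \<Longrightarrow> support_fun 0 K = 0"
  by (simp add: support_fun_def)

lemma support_fun_bound:
  assumes K: "K \<in> Kkc_bdd B"
  shows "\<bar>support_fun p K\<bar> \<le> B * norm p"
  using support_fun_Lipschitz[OF K, of p 0] K by (simp add: support_fun_zero Kkc_bdd_iff)

lemma continuous_on_support_fun [continuous_intros]:
  assumes K: "K \<in> Kkc_bdd B" and f: "continuous_on S f"
  shows "continuous_on S (\<lambda>x. support_fun (f x) K)"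
proof -
  have "\<bar>B\<bar>-lipschitz_on UNIV (\<lambda>p. support_fun p K)"
  proof (rule lipschitz_onI)
    fix p q :: 'a
    have "\<bar>support_fun p K - support_fun q K\<bar> \<le> B * norm (p - q)"
      by (rule support_fun_Lipschitz[OF K])
    also have "\<dots> \<le> \<bar>B\<bar> * norm (p - q)"
      by (intro mult_right_mono) auto
    finally show "dist (support_fun p K) (support_fun q K) \<le> \<bar>B\<bar> * dist p q"
      by (simp add: dist_norm)
  qed simp
  then have "continuous_on UNIV (\<lambda>p. support_fun p K)"
    by (rule lipschitz_on_continuous_on)
  then show ?thesis
    by (rule continuous_on_compose2[OF _ f]) auto
qed

text \<open>
  Duality between distances and support functions: the distance of \<open>x\<close> to a compact convex set
  is attained by a supporting half space, whose normal is \<open>x\<close> minus the closest point. By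
  continuity in the normal it suffices to test countably many directions, which is what makes
  almost sure statements about support functions usable.
\<close>

lemma meets_cball_iff_support_fun:
  fixes K :: "'e::euclidean_space set"
  assumes z: "\<And>x e. e > 0 \<Longrightarrow> \<exists>k::nat. dist (z k :: 'e) x < e" and K: "K \<in> Kkc_bdd B" and r: "r \<ge> 0"
  shows "K \<inter> cball x r \<noteq> {} \<longleftrightarrow> (\<forall>k. z k \<bullet> x - support_fun (z k) K \<le> r * norm (z k))"
proof
  assume "K \<inter> cball x r \<noteq> {}"
  then obtain y where y: "y \<in> K" "dist x y \<le> r"
    by auto
  show "\<forall>k. z k \<bullet> x - support_fun (z k) K \<le> r * norm (z k)"
  proof
    fix k
    have "z k \<bullet> y \<le> support_fun (z k) K"
      using K y by (auto simp: Kkc_bdd_iff intro: inner_le_support_fun)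
    moreover have "z k \<bullet> (x - y) \<le> norm (z k) * norm (x - y)"
      by (rule norm_cauchy_schwarz)
    moreover have "\<dots> \<le> norm (z k) * r"
      using y by (intro mult_left_mono) (auto simp: dist_norm)
    ultimately show "z k \<bullet> x - support_fun (z k) K \<le> r * norm (z k)"
      by (simp add: inner_diff_right mult.commute)
  qed
next
  assume le: "\<forall>k. z k \<bullet> x - support_fun (z k) K \<le> r * norm (z k)"
  have "closed {p. p \<bullet> x - support_fun p K \<le> r * norm p}"
    by (intro closed_Collect_le continuous_intros continuous_on_support_fun[OF K])
  then have le': "p \<bullet> x - support_fun p K \<le> r * norm p" for p
    using dense_sequence_closed_cover[OF z, of "{p. p \<bullet> x - support_fun p K \<le> r * norm p}" p] le by auto
  define c where "c = closest_point K x"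
  have K': "K \<noteq> {}" "closed K" "convex K"
    using K by (auto simp: Kkc_bdd_iff compact_imp_closed)
  have c: "c \<in> K"
    unfolding c_def using K' by (intro closest_point_in_set) auto
  have "support_fun (x - c) K \<le> (x - c) \<bullet> c"
    using closest_point_dot[OF K'(3,2), of _ x] K'
    by (intro support_fun_le) (auto simp: c_def inner_diff_right)
  then have "(x - c) \<bullet> (x - c) \<le> r * norm (x - c)"
    using le'[of "x - c"] by (simp add: inner_diff_right)
  then have "norm (x - c) * norm (x - c) \<le> r * norm (x - c)"
    by (simp add: power2_norm_eq_inner[symmetric] power2_eq_square)
  then have "norm (x - c) \<le> r"
    using r by (cases "x = c") auto
  with c show "K \<inter> cball x r \<noteq> {}"
    by (auto simp: dist_norm)
qed

lemma mem_iff_support_fun: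
  fixes K :: "'e::euclidean_space set"
  assumes z: "\<And>x e. e > 0 \<Longrightarrow> \<exists>k::nat. dist (z k :: 'e) x < e" and K: "K \<in> Kkc_bdd B"
  shows "x \<in> K \<longleftrightarrow> (\<forall>k. z k \<bullet> x \<le> support_fun (z k) K)"
  using meets_cball_iff_support_fun[OF z K, of 0 x] by auto

text \<open>Cauchy-Schwarz and its converse, as the duality above for the set \<open>{0}\<close>.\<close>

lemma mem_cball_iff_inner:
  fixes x :: "'e::euclidean_space"
  assumes z: "\<And>x e. e > 0 \<Longrightarrow> \<exists>k::nat. dist (z k :: 'e) x < e" and "B \<ge> 0"
  shows "x \<in> cball 0 B \<longleftrightarrow> (\<forall>k. z k \<bullet> x \<le> B * norm (z k))"
proof -
  have "{0::'e} \<in> Kkc_bdd 0"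
    by (auto simp: Kkc_bdd_iff)
  then have "{0} \<inter> cball x B \<noteq> {} \<longleftrightarrow> (\<forall>k. z k \<bullet> x - support_fun (z k) {0} \<le> B * norm (z k))"
    using assms by (intro meets_cball_iff_support_fun)
  then show ?thesis
    by (simp add: support_fun_def)
qed

text \<open>Positive homogeneity extends equality from the sphere to all directions.\<close>

lemma Kkc_bdd_eqI:
  assumes K: "K \<in> Kkc_bdd B" "L \<in> Kkc_bdd B" and eq: "\<And>p. norm p = 1 \<Longrightarrow> support_fun p K = support_fun p L"
  shows "K = L"
proof -
  have homogeneous: "support_fun p N = norm p * support_fun (sgn p) N" if N: "N \<in> Kkc_bdd B" for p and N :: "'a set"
  proof (cases "p = 0")
    case False
    have "support_fun p N = (SUP x\<in>N. norm p * (sgn p \<bullet> x))"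
      unfolding support_fun_def
      using False by (intro arg_cong[where f = Sup] image_cong)
        (simp_all add: support_fun_def sgn_div_norm)
    also have "\<dots> = norm p * (SUP x\<in>N. sgn p \<bullet> x)"
    proof -
      obtain x where x: "x \<in> N" "support_fun (sgn p) N = sgn p \<bullet> x"
        by (rule support_fun_attained[of N "sgn p"]) (use N in \<open>auto simp: Kkc_bdd_iff\<close>)
      then have "(SUP x\<in>N. norm p * (sgn p \<bullet> x)) = norm p * (sgn p \<bullet> x)"
        using N inner_le_support_fun[of N _ "sgn p"]
        by (intro cSup_eq_maximum) (auto simp: Kkc_bdd_iff intro!: mult_left_mono)
      with x show ?thesis
        by (simp add: support_fun_def)
    qed
    finally show ?thesis
      by (simp add: support_fun_def)
  qed (use N in \<open>simp add: support_fun_zero Kkc_bdd_iff\<close>)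
  have "support_fun p K = support_fun p L" for p
    using homogeneous[of K p] homogeneous[of L p] K eq[of "sgn p"] by (cases "p = 0") (auto simp: norm_sgn)
  moreover obtain z :: "nat \<Rightarrow> 'a" where z: "\<And>x e. e > 0 \<Longrightarrow> \<exists>k. dist (z k) x < e"
    by (rule dense_sequence_exists) blast
  ultimately show ?thesis
    using mem_iff_support_fun[OF z K(1)] mem_iff_support_fun[OF z K(2)] by auto
qed

lemma Kkc_bdd_closed_hull:
  assumes "range x \<subseteq> cball 0 B"
  shows "closure (convex hull range x) \<in> Kkc_bdd B"
proof -
  have "closure (convex hull range x) \<subseteq> cball 0 B"
    using assms by (intro closure_minimal hull_minimal) auto
  moreover have "bounded (convex hull range x)"
    using assms by (intro bounded_convex_hull bounded_subset[OF bounded_cball])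
  ultimately show ?thesis
    by (auto simp: Kkc_bdd_iff compact_closure convex_closure)
qed

lemma support_fun_closed_hull:
  assumes "range x \<subseteq> cball 0 B"
  shows "support_fun p (closure (convex hull range x)) = (SUP i. p \<bullet> x i)"
proof (rule antisym)
  let ?H = "closure (convex hull range x)"
  have H: "?H \<noteq> {}" "compact ?H" "range x \<subseteq> ?H"
    using Kkc_bdd_closed_hull[OF assms] hull_subset[of "range x" convex] closure_subset
    by (auto simp: Kkc_bdd_iff)
  have "bdd_above (range (\<lambda>i. p \<bullet> x i))"
    using H(3) by (intro bdd_above_mono[OF bdd_above_inner_image[OF H(2), of p]]) auto
  then have "range x \<subseteq> {y. p \<bullet> y \<le> (SUP i. p \<bullet> x i)}"
    by (auto intro: cSUP_upper)
  then have "?H \<subseteq> {y. p \<bullet> y \<le> (SUP i. p \<bullet> x i)}"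
    by (intro closure_minimal hull_minimal closed_halfspace_le convex_halfspace_le)
  with H(1) show "support_fun p ?H \<le> (SUP i. p \<bullet> x i)"
    by (intro support_fun_le) auto
  show "(SUP i. p \<bullet> x i) \<le> support_fun p ?H"
    using H by (intro cSUP_least inner_le_support_fun) auto
qed

section \<open>Random closed sets and their measurable selections\<close>

lemma measurable_set_space_iff:
  "N \<in> G \<rightarrow>\<^sub>M set_space C \<longleftrightarrow>
     (\<forall>\<omega>\<in>space G. N \<omega> \<in> C) \<and> (\<forall>U. open U \<longrightarrow> {\<omega>\<in>space G. N \<omega> \<inter> U \<noteq> {}} \<in> sets G)"
proof (intro iffI conjI ballI allI impI)
  assume N: "N \<in> G \<rightarrow>\<^sub>M set_space C"
  have space: "space (set_space C) = C"
    by (auto simp: set_space_def space_measure_of_conv)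
  then show NC: "N \<omega> \<in> C" if "\<omega> \<in> space G" for \<omega>
    using measurable_space[OF N that] by simp
  fix U :: "'b set" assume "open U"
  then have "{K \<in> C. K \<inter> U \<noteq> {}} \<in> sets (set_space C)"
    unfolding set_space_def by (subst sets_measure_of) (auto intro!: sigma_sets.Basic)
  from measurable_sets[OF N this] show "{\<omega>\<in>space G. N \<omega> \<inter> U \<noteq> {}} \<in> sets G"
    by (rule back_subst[where P = "\<lambda>A. A \<in> sets G"]) (use NC in auto)
next
  assume N: "(\<forall>\<omega>\<in>space G. N \<omega> \<in> C) \<and> (\<forall>U. open U \<longrightarrow> {\<omega>\<in>space G. N \<omega> \<inter> U \<noteq> {}} \<in> sets G)"
  show "N \<in> G \<rightarrow>\<^sub>M set_space C"
    unfolding set_space_def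
  proof (rule measurable_measure_of)
    fix Y assume "Y \<in> (\<lambda>U. {F \<in> C. F \<inter> U \<noteq> {}}) ` {U. open U}"
    then obtain U where U: "open U" "Y = {F \<in> C. F \<inter> U \<noteq> {}}"
      by auto
    then have "N -` Y \<inter> space G = {\<omega>\<in>space G. N \<omega> \<inter> U \<noteq> {}}"
      using N by auto
    then show "N -` Y \<inter> space G \<in> sets G"
      using N U by simp
  qed (use N in auto)
qed

lemma measurable_set_space_mono:
  "N \<in> G \<rightarrow>\<^sub>M set_space C \<Longrightarrow> C \<subseteq> C' \<Longrightarrow> N \<in> G \<rightarrow>\<^sub>M set_space C'"
  by (auto simp: measurable_set_space_iff)

lemma measurable_set_space_subalgebra:
  assumes "subalgebra M G" "N \<in> G \<rightarrow>\<^sub>M set_space C"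
  shows "N \<in> M \<rightarrow>\<^sub>M set_space C"
  using assms by (auto simp: measurable_set_space_iff subalgebra_def)

text \<open>
  The selection theorem of Kuratowski and Ryll-Nardzewski for Euclidean space. Points of a
  dense sequence approximate the set to within \<open>2\<^sup>-\<^sup>n\<close>; always taking the first admissible index
  near the previous one gives a measurable sequence that converges into the closed set.
\<close>

lemma measurable_selection_exists:
  fixes N :: "'a \<Rightarrow> 'e::euclidean_space set"
  assumes "N \<in> G \<rightarrow>\<^sub>M set_space closed_sets"
  obtains f where "f \<in> borel_measurable G" "\<And>\<omega>. \<omega> \<in> space G \<Longrightarrow> f \<omega> \<in> N \<omega>"
proof -
  have N: "N \<omega> \<noteq> {}" "closed (N \<omega>)" if "\<omega> \<in> space G" for \<omega>
    using assms that by (auto simp: measurable_set_space_iff closed_sets_def)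
  have meas: "Measurable.pred G (\<lambda>\<omega>. N \<omega> \<inter> U \<noteq> {})" if "open U" for U
    using assms that by (auto simp: measurable_set_space_iff pred_def)
  obtain z :: "nat \<Rightarrow> 'e" where z: "\<And>x e. e > 0 \<Longrightarrow> \<exists>k. dist (z k) x < e"
    by (rule dense_sequence_exists) blast
  define i :: "nat \<Rightarrow> 'a \<Rightarrow> nat" where
    "i = rec_nat (\<lambda>\<omega>. LEAST k. N \<omega> \<inter> ball (z k) 1 \<noteq> {})
       (\<lambda>n j \<omega>. LEAST k. N \<omega> \<inter> (ball (z (j \<omega>)) (1/2^n) \<inter> ball (z k) (1/2^Suc n)) \<noteq> {})"
  have i0: "i 0 = (\<lambda>\<omega>. LEAST k. N \<omega> \<inter> ball (z k) 1 \<noteq> {})"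
    by (simp add: i_def)
  have iSuc: "i (Suc n) = (\<lambda>\<omega>. LEAST k. N \<omega> \<inter> (ball (z (i n \<omega>)) (1/2^n) \<inter> ball (z k) (1/2^Suc n)) \<noteq> {})" for n
    by (simp add: i_def)
  have i_meas: "i n \<in> G \<rightarrow>\<^sub>M count_space UNIV" for n
  proof (induction n)
    case 0
    show ?case
      unfolding i0 by (intro measurable_Least meas) auto
  next
    case (Suc n)
    have "Measurable.pred G (\<lambda>\<omega>. N \<omega> \<inter> (ball (z (i n \<omega>)) (1/2^n) \<inter> ball (z k) (1/2^Suc n)) \<noteq> {})" for k
      by (rule measurable_compose_countable[OF _ Suc.IH,
            where f = "\<lambda>j \<omega>. N \<omega> \<inter> (ball (z j) (1/2^n) \<inter> ball (z k) (1/2^Suc n)) \<noteq> {}"])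
        (rule meas, auto)
    then show ?case
      unfolding iSuc by (rule measurable_Least)
  qed
  define a where "a n \<omega> = z (i n \<omega>)" for n \<omega>
  have a_meas: "a n \<in> borel_measurable G" for n
    unfolding a_def by (rule measurable_compose[OF i_meas]) simp
  have step: "\<exists>k. N \<omega> \<inter> (U \<inter> ball (z k) r) \<noteq> {}" if hit: "N \<omega> \<inter> U \<noteq> {}" and "r > 0" for \<omega> U r
  proof -
    obtain y where "y \<in> N \<omega>" "y \<in> U"
      using hit by auto
    moreover obtain k where "dist (z k) y < r"
      using z \<open>r > 0\<close> by blast
    ultimately have "y \<in> N \<omega> \<inter> (U \<inter> ball (z k) r)"
      by simp
    then show ?thesis
      by blast
  qed
  have hit: "N \<omega> \<inter> ball (a n \<omega>) (1/2^n) \<noteq> {}" if \<omega>: "\<omega> \<in> space G" for n \<omega>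
  proof (induction n)
    case 0
    have "\<exists>k. N \<omega> \<inter> ball (z k) 1 \<noteq> {}"
      using step[of \<omega> UNIV 1] N(1)[OF \<omega>] by simp
    then show ?case
      unfolding a_def i0 by simp (rule LeastI_ex)
  next
    case (Suc n)
    from step[OF this, of "1/2^Suc n"] have "\<exists>k. N \<omega> \<inter> (ball (z (i n \<omega>)) (1/2^n) \<inter> ball (z k) (1/2^Suc n)) \<noteq> {}"
      by (simp add: a_def)
    from LeastI_ex[OF this] show ?case
      unfolding a_def iSuc by auto
  qed
  have close: "norm (a (Suc n) \<omega> - a n \<omega>) \<le> 2 * (1/2)^n" if \<omega>: "\<omega> \<in> space G" for n \<omega>
  proof -
    from step[OF hit[OF \<omega>, of n], of "1/2^Suc n"] have "\<exists>k. N \<omega> \<inter> (ball (z (i n \<omega>)) (1/2^n) \<inter> ball (z k) (1/2^Suc n)) \<noteq> {}"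
      by (simp add: a_def)
    from LeastI_ex[OF this]
    obtain y where y: "dist (a n \<omega>) y < 1/2^n" "dist (a (Suc n) \<omega>) y < 1/2^Suc n"
      unfolding a_def iSuc by auto
    have "norm (a (Suc n) \<omega> - a n \<omega>) \<le> dist (a (Suc n) \<omega>) y + dist (a n \<omega>) y"
      by (metis dist_norm dist_triangle2)
    also have "\<dots> \<le> 2 * (1/2)^n"
      using y by (simp add: power_divide field_simps)
    finally show ?thesis .
  qed
  define f where "f \<omega> = lim (\<lambda>n. a n \<omega>)" for \<omega>
  have lim: "(\<lambda>n. a n \<omega>) \<longlonglongrightarrow> f \<omega>" if \<omega>: "\<omega> \<in> space G" for \<omega>
  proof -
    have "summable (\<lambda>n. a (Suc n) \<omega> - a n \<omega>)"
      by (rule summable_comparison_test[OF _ summable_mult[OF summable_geometric[of "1/2 :: real"]]])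
        (use close[OF \<omega>] in auto)
    then have "convergent (\<lambda>n. a 0 \<omega> + (\<Sum>k<n. a (Suc k) \<omega> - a k \<omega>))"
      by (intro convergent_add convergent_const) (simp add: summable_iff_convergent)
    also have "(\<lambda>n. a 0 \<omega> + (\<Sum>k<n. a (Suc k) \<omega> - a k \<omega>)) = (\<lambda>n. a n \<omega>)"
      by (simp add: sum_lessThan_telescope[of "\<lambda>n. a n \<omega>"])
    finally show ?thesis
      by (simp add: f_def convergent_LIMSEQ_iff)
  qed
  show thesis
  proof
    show "f \<in> borel_measurable G"
      by (rule borel_measurable_LIMSEQ_metric[OF a_meas lim])
    fix \<omega> assume \<omega>: "\<omega> \<in> space G"
    have "\<forall>n. \<exists>x. x \<in> N \<omega> \<and> dist (a n \<omega>) x < 1/2^n"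
      using hit[OF \<omega>] by fastforce
    then obtain y where y: "\<And>n. y n \<in> N \<omega>" "\<And>n. dist (a n \<omega>) (y n) < 1/2^n"
      by metis
    have "(\<lambda>n. (1/2)^n :: real) \<longlonglongrightarrow> 0"
      by (rule LIMSEQ_realpow_zero) auto
    then have "(\<lambda>n. dist (a n \<omega>) (y n)) \<longlonglongrightarrow> 0"
      by (rule Lim_null_comparison[rotated]) (use y(2) in \<open>auto simp: power_divide less_imp_le\<close>)
    then have "(\<lambda>n. a n \<omega> - y n) \<longlonglongrightarrow> 0"
      by (simp add: dist_norm tendsto_norm_zero_iff)
    from tendsto_diff[OF lim[OF \<omega>] this] have "y \<longlonglongrightarrow> f \<omega>"
      by simp
    with N(2)[OF \<omega>] y(1) show "f \<omega> \<in> N \<omega>"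
      using closed_sequentially by blast
  qed
qed

text \<open>
  Castaing representation: select from the part of the random set in each ball of a countable
  base, whenever the set meets this ball.
\<close>

lemma dense_selections_exist:
  fixes N :: "'a \<Rightarrow> 'e::euclidean_space set"
  assumes N: "N \<in> G \<rightarrow>\<^sub>M set_space closed_sets"
  obtains c :: "nat \<Rightarrow> 'a \<Rightarrow> 'e" where "\<And>k. c k \<in> borel_measurable G"
    "\<And>k \<omega>. \<omega> \<in> space G \<Longrightarrow> c k \<omega> \<in> N \<omega>"
    "\<And>\<omega> x e. \<omega> \<in> space G \<Longrightarrow> x \<in> N \<omega> \<Longrightarrow> e > 0 \<Longrightarrow> \<exists>k. dist (c k \<omega>) x < e"
proof -
  obtain z :: "nat \<Rightarrow> 'e" where z: "\<And>x e. e > 0 \<Longrightarrow> \<exists>k. dist (z k) x < e"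
    by (rule dense_sequence_exists) blast
  have N': "N \<omega> \<noteq> {}" "closed (N \<omega>)" if "\<omega> \<in> space G" for \<omega>
    using N that by (auto simp: measurable_set_space_iff closed_sets_def)
  have meas: "{\<omega>\<in>space G. N \<omega> \<inter> U \<noteq> {}} \<in> sets G" if "open U" for U
    using N that by (auto simp: measurable_set_space_iff)
  define L where "L p \<omega> = (let V = ball (z (fst p)) (1 / real (Suc (snd p)))
      in if N \<omega> \<inter> V \<noteq> {} then closure (N \<omega> \<inter> V) else N \<omega>)" for p :: "nat \<times> nat" and \<omega>
  have "\<exists>f. f \<in> borel_measurable G \<and> (\<forall>\<omega>\<in>space G. f \<omega> \<in> L p \<omega>)" for p
  proof -
    define V where "V = ball (z (fst p)) (1 / real (Suc (snd p)))"
    have L: "L p \<omega> = (if N \<omega> \<inter> V \<noteq> {} then closure (N \<omega> \<inter> V) else N \<omega>)" for \<omega>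
      by (simp add: L_def V_def Let_def)
    have "L p \<in> G \<rightarrow>\<^sub>M set_space closed_sets"
      unfolding measurable_set_space_iff
    proof (intro conjI ballI allI impI)
      show "L p \<omega> \<in> closed_sets" if "\<omega> \<in> space G" for \<omega>
        using N'[OF that] by (auto simp: L closed_sets_def)
      fix U :: "'e set" assume U: "open U"
      have "open V"
        by (simp add: V_def)
      have "{\<omega>\<in>space G. L p \<omega> \<inter> U \<noteq> {}} =
          {\<omega>\<in>space G. N \<omega> \<inter> (V \<inter> U) \<noteq> {}} \<union> ({\<omega>\<in>space G. N \<omega> \<inter> U \<noteq> {}} - {\<omega>\<in>space G. N \<omega> \<inter> V \<noteq> {}})"
        using open_Int_closure_eq_empty[OF U] by (auto simp: L Int_ac split: if_splits)
      also have "\<dots> \<in> sets G"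
        using U \<open>open V\<close> by (intro sets.Un sets.Diff meas open_Int)
      finally show "{\<omega>\<in>space G. L p \<omega> \<inter> U \<noteq> {}} \<in> sets G" .
    qed
    then show ?thesis
      by (rule measurable_selection_exists) blast
  qed
  then obtain f where f: "\<And>p. f p \<in> borel_measurable G" "\<And>p \<omega>. \<omega> \<in> space G \<Longrightarrow> f p \<omega> \<in> L p \<omega>"
    by metis
  have sub: "L p \<omega> \<subseteq> N \<omega>" if "\<omega> \<in> space G" for p \<omega>
    using N'[OF that] closure_minimal[OF Int_lower1] by (auto simp: L_def Let_def)
  show thesis
  proof (rule that[of "\<lambda>k. f (prod_decode k)"])
    fix \<omega> x and e :: real
    assume \<omega>: "\<omega> \<in> space G" and x: "x \<in> N \<omega>" and e: "e > 0"
    obtain m where m: "1 / real (Suc m) < e / 2"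
      using nat_approx_posE[of "e/2"] e by auto
    obtain j where j: "dist (z j) x < 1 / real (Suc m)"
      using z[of "1 / real (Suc m)" x] by auto
    let ?V = "ball (z j) (1 / real (Suc m))"
    have "f (j, m) \<omega> \<in> closure (N \<omega> \<inter> ?V)"
      using f(2)[OF \<omega>, of "(j, m)"] x j by (auto simp: L_def Let_def split: if_splits)
    also have "\<dots> \<subseteq> cball (z j) (1 / real (Suc m))"
      by (intro closure_minimal) auto
    finally have "dist (f (j, m) \<omega>) x < e"
      using j m dist_triangle[of "f (j, m) \<omega>" x "z j"] by (simp add: dist_commute)
    then show "\<exists>k. dist (f (prod_decode k) \<omega>) x < e"
      by (metis prod_encode_inverse)
  next
    fix k \<omega> assume "\<omega> \<in> space G"
    then show "f (prod_decode k) \<omega> \<in> N \<omega>"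
      using f(2) sub by blast
  qed (rule f)
qed

lemma support_fun_dense_sequence:
  fixes c :: "nat \<Rightarrow> 'e::euclidean_space"
  assumes K: "compact K" and c: "\<And>k. c k \<in> K" and dense: "\<And>x e. x \<in> K \<Longrightarrow> e > 0 \<Longrightarrow> \<exists>k. dist (c k) x < e"
  shows "support_fun p K = (SUP k. p \<bullet> c k)" and "bdd_above (range (\<lambda>k. p \<bullet> c k))"
proof -
  show bdd: "bdd_above (range (\<lambda>k. p \<bullet> c k))"
    using c by (intro bdd_above_mono[OF bdd_above_inner_image[OF K, of p]]) auto
  have "K \<subseteq> closure (range c)"
    using dense by (fastforce simp: closure_approachable)
  also have "\<dots> \<subseteq> {x. p \<bullet> x \<le> (SUP k. p \<bullet> c k)}"
    using bdd by (intro closure_minimal closed_halfspace_le) (auto intro: cSUP_upper)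
  finally show "support_fun p K = (SUP k. p \<bullet> c k)"
    using c K by (intro antisym support_fun_le cSUP_least) (auto intro: inner_le_support_fun)
qed

lemma measurable_support_fun:
  fixes F :: "'a \<Rightarrow> 'e::euclidean_space set"
  assumes F: "F \<in> M \<rightarrow>\<^sub>M set_space (Kkc_bdd B)" and q [measurable]: "q \<in> borel_measurable M"
  shows "(\<lambda>\<omega>. support_fun (q \<omega>) (F \<omega>)) \<in> borel_measurable M"
proof -
  obtain c :: "nat \<Rightarrow> 'a \<Rightarrow> 'e" where c [measurable]: "\<And>k. c k \<in> borel_measurable M"
    and c': "\<And>k \<omega>. \<omega> \<in> space M \<Longrightarrow> c k \<omega> \<in> F \<omega>"
      "\<And>\<omega> x e. \<omega> \<in> space M \<Longrightarrow> x \<in> F \<omega> \<Longrightarrow> e > 0 \<Longrightarrow> \<exists>k. dist (c k \<omega>) x < e"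
    by (rule dense_selections_exist[OF measurable_set_space_mono[OF F Kkc_bdd_subset_closed_sets]]) blast
  have K: "compact (F \<omega>)" if "\<omega> \<in> space M" for \<omega>
    using F that by (auto simp: measurable_set_space_iff Kkc_bdd_iff)
  have "(\<lambda>\<omega>. SUP k. q \<omega> \<bullet> c k \<omega>) \<in> borel_measurable M"
    by (rule borel_measurable_cSUP) (use support_fun_dense_sequence(2)[OF K c'] in auto)
  then show ?thesis
    using support_fun_dense_sequence(1)[OF K c'] by (subst measurable_cong) auto
qed

text \<open>
  The first almost maximal member of a dense sequence of selections is a measurable choice, even
  when the direction is random.
\<close>

lemma almost_maximal_selection_exists:
  fixes F :: "'a \<Rightarrow> 'e::euclidean_space set"
  assumes F: "F \<in> M \<rightarrow>\<^sub>M set_space (Kkc_bdd B)" and q [measurable]: "q \<in> borel_measurable M" and "\<delta> > 0"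
  obtains f where "f \<in> borel_measurable M" "\<And>\<omega>. \<omega> \<in> space M \<Longrightarrow> f \<omega> \<in> F \<omega>"
    "\<And>\<omega>. \<omega> \<in> space M \<Longrightarrow> support_fun (q \<omega>) (F \<omega>) - \<delta> \<le> q \<omega> \<bullet> f \<omega>"
proof -
  obtain c :: "nat \<Rightarrow> 'a \<Rightarrow> 'e" where c [measurable]: "\<And>k. c k \<in> borel_measurable M"
    and c': "\<And>k \<omega>. \<omega> \<in> space M \<Longrightarrow> c k \<omega> \<in> F \<omega>"
      "\<And>\<omega> x e. \<omega> \<in> space M \<Longrightarrow> x \<in> F \<omega> \<Longrightarrow> e > 0 \<Longrightarrow> \<exists>k. dist (c k \<omega>) x < e"
    by (rule dense_selections_exist[OF measurable_set_space_mono[OF F Kkc_bdd_subset_closed_sets]]) blast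
  note [measurable] = measurable_support_fun[OF F q]
  have K: "compact (F \<omega>)" if "\<omega> \<in> space M" for \<omega>
    using F that by (auto simp: measurable_set_space_iff Kkc_bdd_iff)
  define i where "i \<omega> = (LEAST k. support_fun (q \<omega>) (F \<omega>) - \<delta> \<le> q \<omega> \<bullet> c k \<omega>)" for \<omega>
  have [measurable]: "i \<in> M \<rightarrow>\<^sub>M count_space UNIV"
    unfolding i_def by measurable
  have ex: "\<exists>k. support_fun (q \<omega>) (F \<omega>) - \<delta> \<le> q \<omega> \<bullet> c k \<omega>" if \<omega>: "\<omega> \<in> space M" for \<omega>
  proof -
    note * = support_fun_dense_sequence[OF K[OF \<omega>] c'(1)[OF \<omega>] c'(2)[OF \<omega>], of "q \<omega>"]
    have "support_fun (q \<omega>) (F \<omega>) - \<delta> < (SUP k. q \<omega> \<bullet> c k \<omega>)"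
      using * \<open>\<delta> > 0\<close> by simp
    then show ?thesis
      using *(2) by (subst (asm) less_cSUP_iff) (auto intro: less_imp_le)
  qed
  show thesis
  proof (rule that[of "\<lambda>\<omega>. c (i \<omega>) \<omega>"])
    show "(\<lambda>\<omega>. c (i \<omega>) \<omega>) \<in> borel_measurable M"
      by measurable
    fix \<omega> assume \<omega>: "\<omega> \<in> space M"
    show "c (i \<omega>) \<omega> \<in> F \<omega>"
      using c' \<omega> by simp
    show "support_fun (q \<omega>) (F \<omega>) - \<delta> \<le> q \<omega> \<bullet> c (i \<omega>) \<omega>"
      unfolding i_def by (rule LeastI_ex[OF ex[OF \<omega>]])
  qed
qed

text \<open>
  An open set is a countable union of closed balls, and meeting a closed ball is a countable
  conjunction of inequalities between support functions.
\<close>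

lemma measurable_set_space_if_support_fun:
  fixes N :: "'a \<Rightarrow> 'e::euclidean_space set"
  assumes N: "\<And>\<omega>. \<omega> \<in> space G \<Longrightarrow> N \<omega> \<in> Kkc_bdd B"
    and meas [measurable]: "\<And>p. (\<lambda>\<omega>. support_fun p (N \<omega>)) \<in> borel_measurable G"
  shows "N \<in> G \<rightarrow>\<^sub>M set_space (Kkc_bdd B)"
  unfolding measurable_set_space_iff
proof (intro conjI ballI allI impI N)
  fix U :: "'e set" assume U: "open U"
  obtain z :: "nat \<Rightarrow> 'e" where z: "\<And>x e. e > 0 \<Longrightarrow> \<exists>k. dist (z k) x < e"
    by (rule dense_sequence_exists) blast
  define I where "I = {(j, m). cball (z j) (1 / real (Suc m)) \<subseteq> U}"
  have cover: "\<exists>(j, m)\<in>I. x \<in> cball (z j) (1 / real (Suc m))" if "x \<in> U" for x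
  proof -
    obtain e where e: "e > 0" "ball x e \<subseteq> U"
      using openE[OF U \<open>x \<in> U\<close>] by blast
    obtain m where m: "1 / real (Suc m) < e / 2"
      using nat_approx_posE[of "e/2"] e by auto
    obtain j where j: "dist (z j) x < 1 / real (Suc m)"
      using z[of "1 / real (Suc m)" x] by auto
    have "cball (z j) (1 / real (Suc m)) \<subseteq> ball x e"
    proof
      fix y assume "y \<in> cball (z j) (1 / real (Suc m))"
      then have "dist x y < e"
        using j m dist_triangle[of x y "z j"] by (auto simp: dist_commute)
      then show "y \<in> ball x e"
        by simp
    qed
    then have "(j, m) \<in> I"
      using e by (auto simp: I_def)
    with j show ?thesis
      by (auto intro!: bexI[of _ "(j, m)"])
  qed
  have "{\<omega>\<in>space G. N \<omega> \<inter> U \<noteq> {}} =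
      (\<Union>(j, m)\<in>I. {\<omega>\<in>space G. N \<omega> \<inter> cball (z j) (1 / real (Suc m)) \<noteq> {}})"
    using cover by (fastforce simp: I_def)
  also have "\<dots> = (\<Union>(j, m)\<in>I. {\<omega>\<in>space G. \<forall>k. z k \<bullet> z j - support_fun (z k) (N \<omega>) \<le> 1 / real (Suc m) * norm (z k)})"
  proof (intro SUP_cong refl, clarify)
    fix j m
    have "0 \<le> 1 / real (Suc m)"
      by simp
    then show "{\<omega>\<in>space G. N \<omega> \<inter> cball (z j) (1 / real (Suc m)) \<noteq> {}} =
        {\<omega>\<in>space G. \<forall>k. z k \<bullet> z j - support_fun (z k) (N \<omega>) \<le> 1 / real (Suc m) * norm (z k)}"
      using meets_cball_iff_support_fun[OF z N] by blast
  qed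
  also have "\<dots> \<in> sets G"
    by (intro sets.countable_UN') auto
  finally show "{\<omega>\<in>space G. N \<omega> \<inter> U \<noteq> {}} \<in> sets G" .
qed

section \<open>Conditional expectations of random vectors and random convex sets\<close>

context finite_measure_subalgebra
begin

lemma vec_cond_exp_inner_Basis:
  "b \<in> Basis \<Longrightarrow> vec_cond_exp M F f \<omega> \<bullet> b = real_cond_exp M F (\<lambda>\<omega>. f \<omega> \<bullet> b) \<omega>"
  by (simp add: vec_cond_exp_def)

lemma borel_measurable_vec_cond_exp [measurable]:
  "vec_cond_exp M F f \<in> borel_measurable F" "vec_cond_exp M F f \<in> borel_measurable M"
proof -
  have "(\<lambda>\<omega>. vec_cond_exp M F f \<omega>) \<in> borel_measurable F"
    unfolding vec_cond_exp_def by measurable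
  then show "vec_cond_exp M F f \<in> borel_measurable F"
    by simp
  then show "vec_cond_exp M F f \<in> borel_measurable M"
    by (rule measurable_from_subalg[OF subalg])
qed

lemma integrable_vec_cond_exp: "integrable M f \<Longrightarrow> integrable M (vec_cond_exp M F f)"
  unfolding vec_cond_exp_def
  by (intro Bochner_Integration.integrable_sum integrable_scaleR_left real_cond_exp_int(1)) auto

lemma AE_inner_vec_cond_exp:
  assumes f: "integrable M f"
  shows "AE \<omega> in M. p \<bullet> vec_cond_exp M F f \<omega> = real_cond_exp M F (\<lambda>\<omega>. p \<bullet> f \<omega>) \<omega>"
proof -
  have "AE \<omega> in M. \<forall>b\<in>Basis. real_cond_exp M F (\<lambda>\<omega>. (p \<bullet> b) * (f \<omega> \<bullet> b)) \<omega> = (p \<bullet> b) * real_cond_exp M F (\<lambda>\<omega>. f \<omega> \<bullet> b) \<omega>"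
    using f by (intro AE_finite_allI real_cond_exp_cmult) auto
  moreover have "AE \<omega> in M. real_cond_exp M F (\<lambda>\<omega>. \<Sum>b\<in>Basis. (p \<bullet> b) * (f \<omega> \<bullet> b)) \<omega> =
      (\<Sum>b\<in>Basis. real_cond_exp M F (\<lambda>\<omega>. (p \<bullet> b) * (f \<omega> \<bullet> b)) \<omega>)"
    using f by (intro real_cond_exp_sum) auto
  ultimately show ?thesis
  proof eventually_elim
    case (elim \<omega>)
    have "p \<bullet> vec_cond_exp M F f \<omega> = (\<Sum>b\<in>Basis. (p \<bullet> b) * real_cond_exp M F (\<lambda>\<omega>. f \<omega> \<bullet> b) \<omega>)"
      by (subst euclidean_inner) (simp add: vec_cond_exp_inner_Basis)
    also have "\<dots> = real_cond_exp M F (\<lambda>\<omega>. \<Sum>b\<in>Basis. (p \<bullet> b) * (f \<omega> \<bullet> b)) \<omega>"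
      using elim by simp
    finally show ?case
      by (subst euclidean_inner)
  qed
qed

lemma AE_vec_cond_exp_lincomb:
  assumes f: "integrable M f" and h: "integrable M h"
  shows "AE \<omega> in M. vec_cond_exp M F (\<lambda>\<omega>. a *\<^sub>R f \<omega> + c *\<^sub>R h \<omega>) \<omega> =
    a *\<^sub>R vec_cond_exp M F f \<omega> + c *\<^sub>R vec_cond_exp M F h \<omega>"
proof -
  have "AE \<omega> in M. \<forall>b\<in>Basis. vec_cond_exp M F (\<lambda>\<omega>. a *\<^sub>R f \<omega> + c *\<^sub>R h \<omega>) \<omega> \<bullet> b =
    (a *\<^sub>R vec_cond_exp M F f \<omega> + c *\<^sub>R vec_cond_exp M F h \<omega>) \<bullet> b"
  proof (intro AE_finite_allI)
    fix b :: 'b assume b: "b \<in> Basis"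
    have int: "integrable M (\<lambda>\<omega>. f \<omega> \<bullet> b)" "integrable M (\<lambda>\<omega>. h \<omega> \<bullet> b)"
      using f h by auto
    from int have int': "integrable M (\<lambda>\<omega>. a * (f \<omega> \<bullet> b))" "integrable M (\<lambda>\<omega>. c * (h \<omega> \<bullet> b))"
      by auto
    show "AE \<omega> in M. vec_cond_exp M F (\<lambda>\<omega>. a *\<^sub>R f \<omega> + c *\<^sub>R h \<omega>) \<omega> \<bullet> b =
      (a *\<^sub>R vec_cond_exp M F f \<omega> + c *\<^sub>R vec_cond_exp M F h \<omega>) \<bullet> b"
      using real_cond_exp_add[OF int'] real_cond_exp_cmult[OF int(1), of a] real_cond_exp_cmult[OF int(2), of c]
      by eventually_elim (simp add: b vec_cond_exp_inner_Basis inner_add_left)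
  qed auto
  then show ?thesis
    by eventually_elim (rule euclidean_eqI, blast)
qed

lemma AE_eq_vec_cond_expI:
  fixes f g :: "'a \<Rightarrow> 'e::euclidean_space"
  assumes f: "integrable M f" and g: "integrable M g" "g \<in> borel_measurable F"
    and eq: "\<And>A. A \<in> sets F \<Longrightarrow> (\<integral>\<omega>\<in>A. f \<omega> \<partial>M) = (\<integral>\<omega>\<in>A. g \<omega> \<partial>M)"
  shows "AE \<omega> in M. g \<omega> = vec_cond_exp M F f \<omega>"
proof -
  have "AE \<omega> in M. \<forall>b\<in>Basis. real_cond_exp M F (\<lambda>\<omega>. f \<omega> \<bullet> b) \<omega> = g \<omega> \<bullet> b"
  proof (intro AE_finite_allI real_cond_exp_charact)
    fix b :: 'e and A assume A: "A \<in> sets F"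
    then have A': "A \<in> sets M"
      using subalg by (auto simp: subalgebra_def)
    have *: "(\<integral>\<omega>\<in>A. h \<omega> \<bullet> b \<partial>M) = (\<integral>\<omega>\<in>A. h \<omega> \<partial>M) \<bullet> b" if "integrable M h" for h :: "'a \<Rightarrow> 'e"
      using integral_inner_left[of b M "\<lambda>\<omega>. indicator A \<omega> *\<^sub>R h \<omega>"] integrable_mult_indicator[OF A' that]
      by (simp add: set_lebesgue_integral_def)
    show "(\<integral>\<omega>\<in>A. f \<omega> \<bullet> b \<partial>M) = (\<integral>\<omega>\<in>A. g \<omega> \<bullet> b \<partial>M)"
      using eq[OF A] by (simp add: * f g)
  qed (use f g in auto)
  then show ?thesis
    by eventually_elim (rule euclidean_eqI, simp add: vec_cond_exp_inner_Basis)
qed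

lemma integral_inner_vec_cond_exp:
  fixes f q :: "'a \<Rightarrow> 'e::euclidean_space"
  assumes f: "integrable M f" and q [measurable]: "q \<in> borel_measurable F" and C: "AE \<omega> in M. norm (q \<omega>) \<le> C"
  shows "integrable M (\<lambda>\<omega>. q \<omega> \<bullet> vec_cond_exp M F f \<omega>)"
    and "(\<integral>\<omega>. q \<omega> \<bullet> vec_cond_exp M F f \<omega> \<partial>M) = (\<integral>\<omega>. q \<omega> \<bullet> f \<omega> \<partial>M)"
proof -
  have [measurable]: "q \<in> borel_measurable M" "f \<in> borel_measurable M"
    using f by (auto intro: measurable_from_subalg[OF subalg])
  have int: "integrable M (\<lambda>\<omega>. (q \<omega> \<bullet> b) * (f \<omega> \<bullet> b))" if b: "b \<in> Basis" for b
  proof (rule Bochner_Integration.integrable_bound)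
    show "integrable M (\<lambda>\<omega>. C * norm (f \<omega>))"
      using f by auto
    show "AE \<omega> in M. norm ((q \<omega> \<bullet> b) * (f \<omega> \<bullet> b)) \<le> norm (C * norm (f \<omega>))"
      using C
    proof eventually_elim
      case (elim \<omega>)
      have "\<bar>q \<omega> \<bullet> b\<bar> * \<bar>f \<omega> \<bullet> b\<bar> \<le> C * norm (f \<omega>)"
        using elim by (intro mult_mono) (auto simp: b Basis_le_norm intro: order_trans[OF Basis_le_norm[OF b]] order_trans[OF norm_ge_zero])
      also have "\<dots> \<le> \<bar>C\<bar> * norm (f \<omega>)"
        by (intro mult_right_mono) auto
      finally show ?case
        by (simp add: abs_mult)
    qed
  qed measurable
  have int': "integrable M (\<lambda>\<omega>. (q \<omega> \<bullet> b) * real_cond_exp M F (\<lambda>\<omega>. f \<omega> \<bullet> b) \<omega>)"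
     "(\<integral>\<omega>. (q \<omega> \<bullet> b) * real_cond_exp M F (\<lambda>\<omega>. f \<omega> \<bullet> b) \<omega> \<partial>M) = (\<integral>\<omega>. (q \<omega> \<bullet> b) * (f \<omega> \<bullet> b) \<partial>M)" if "b \<in> Basis" for b
    by (rule real_cond_exp_intg[OF int[OF that]]; measurable)+
  have *: "q \<omega> \<bullet> vec_cond_exp M F f \<omega> = (\<Sum>b\<in>Basis. (q \<omega> \<bullet> b) * real_cond_exp M F (\<lambda>\<omega>. f \<omega> \<bullet> b) \<omega>)" for \<omega>
    by (subst euclidean_inner) (simp add: vec_cond_exp_inner_Basis)
  show "integrable M (\<lambda>\<omega>. q \<omega> \<bullet> vec_cond_exp M F f \<omega>)"
    unfolding * by (intro Bochner_Integration.integrable_sum int')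
  show "(\<integral>\<omega>. q \<omega> \<bullet> vec_cond_exp M F f \<omega> \<partial>M) = (\<integral>\<omega>. q \<omega> \<bullet> f \<omega> \<partial>M)"
    unfolding * euclidean_inner[of "q _" "f _"]
    by (subst (1 2) Bochner_Integration.integral_sum) (simp_all add: int int')
qed

end

text \<open>
  A random convex set whose support function is, in each fixed direction, the conditional
  expectation of the support function of \<open>F\<close>. Both the conditional Frechet mean and the
  conditional Aumann mean are characterised by this property.
\<close>

definition is_cond_support_mean ::
  "'a measure \<Rightarrow> 'a measure \<Rightarrow> real \<Rightarrow> ('a \<Rightarrow> 'e::euclidean_space set) \<Rightarrow> ('a \<Rightarrow> 'e set) \<Rightarrow> bool" where
  "is_cond_support_mean M G B F N \<longleftrightarrow> N \<in> G \<rightarrow>\<^sub>M set_space (Kkc_bdd B) \<and>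
     (\<forall>p. AE \<omega> in M. support_fun p (N \<omega>) = real_cond_exp M G (\<lambda>\<omega>. support_fun p (F \<omega>)) \<omega>)"

locale random_convex_set = prob_space M + finite_measure_subalgebra M G
  for M G :: "'a measure" +
  fixes F :: "'a \<Rightarrow> 'e::euclidean_space set" and B :: real
  assumes B_pos: "B > 0" and F: "F \<in> M \<rightarrow>\<^sub>M set_space (Kkc_bdd B)"
begin

lemma F_Kkc_bdd: "\<omega> \<in> space M \<Longrightarrow> F \<omega> \<in> Kkc_bdd B"
  using F by (simp add: measurable_set_space_iff)

lemma space_G: "space G = space M"
  using subalg by (simp add: subalgebra_def)

lemma sets_G: "A \<in> sets G \<Longrightarrow> A \<in> sets M"
  using subalg by (auto simp: subalgebra_def)

lemma measurable_F_support [measurable]: "(\<lambda>\<omega>. support_fun p (F \<omega>)) \<in> borel_measurable M"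
  by (rule measurable_support_fun[OF F]) simp

lemma integrable_support_fun:
  assumes N: "N \<in> M \<rightarrow>\<^sub>M set_space (Kkc_bdd B)" and q [measurable]: "q \<in> borel_measurable M"
    and C: "AE \<omega> in M. norm (q \<omega>) \<le> C"
  shows "integrable M (\<lambda>\<omega>. support_fun (q \<omega>) (N \<omega>))"
proof (rule integrable_const_bound)
  show "AE \<omega> in M. norm (support_fun (q \<omega>) (N \<omega>)) \<le> B * C"
    using C AE_space
  proof eventually_elim
    case (elim \<omega>)
    then have "\<bar>support_fun (q \<omega>) (N \<omega>)\<bar> \<le> B * norm (q \<omega>)"
      using N by (intro support_fun_bound) (simp add: measurable_set_space_iff)
    also have "\<dots> \<le> B * C"
      using elim B_pos by (intro mult_left_mono) auto
    finally show ?case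
      by simp
  qed
qed (rule measurable_support_fun[OF N q])

lemma integrable_F_support: "integrable M (\<lambda>\<omega>. support_fun p (F \<omega>))"
  by (rule integrable_support_fun[OF F, where C = "norm p"]) auto

lemma selection_bounded:
  assumes "AE \<omega> in M. f \<omega> \<in> F \<omega>"
  shows "AE \<omega> in M. norm (f \<omega>) \<le> B"
  using assms AE_space by eventually_elim (rule norm_le_if_mem_Kkc_bdd[OF F_Kkc_bdd])

lemma selections_iff: "f \<in> selections M F \<longleftrightarrow> f \<in> borel_measurable M \<and> (AE \<omega> in M. f \<omega> \<in> F \<omega>)"
  using selection_bounded[of f] integrable_const_bound[of f B] by (auto simp: selections_def)

lemma selectionsD:
  assumes "f \<in> selections M F"
  shows "integrable M f" "f \<in> borel_measurable M" "AE \<omega> in M. f \<omega> \<in> F \<omega>" "AE \<omega> in M. norm (f \<omega>) \<le> B"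
  using assms selection_bounded[of f] by (auto simp: selections_def)

lemma selection_family_exists:
  obtains f :: "nat \<Rightarrow> 'a \<Rightarrow> 'e" where "\<And>i. f i \<in> borel_measurable M" "\<And>i \<omega>. \<omega> \<in> space M \<Longrightarrow> f i \<omega> \<in> F \<omega>"
    "\<And>p \<epsilon>. \<epsilon> > 0 \<Longrightarrow> \<exists>i. \<forall>\<omega>\<in>space M. support_fun p (F \<omega>) - \<epsilon> \<le> p \<bullet> f i \<omega>"
proof -
  obtain z :: "nat \<Rightarrow> 'e" where z: "\<And>x e. e > 0 \<Longrightarrow> \<exists>k. dist (z k) x < e"
    by (rule dense_sequence_exists) blast
  have "\<exists>f. f \<in> borel_measurable M \<and> (\<forall>\<omega>\<in>space M. f \<omega> \<in> F \<omega> \<and>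
      support_fun (z (fst j)) (F \<omega>) - 1 / real (Suc (snd j)) \<le> z (fst j) \<bullet> f \<omega>)" for j
    by (rule almost_maximal_selection_exists[OF F, of "\<lambda>_. z (fst j)" "1 / real (Suc (snd j))"]) auto
  then obtain f where f: "\<And>j. f j \<in> borel_measurable M" "\<And>j \<omega>. \<omega> \<in> space M \<Longrightarrow> f j \<omega> \<in> F \<omega>"
    "\<And>j \<omega>. \<omega> \<in> space M \<Longrightarrow> support_fun (z (fst j)) (F \<omega>) - 1 / real (Suc (snd j)) \<le> z (fst j) \<bullet> f j \<omega>"
    by metis
  show thesis
  proof (rule that[of "\<lambda>i. f (prod_decode i)"])
    fix p :: 'e and \<epsilon> :: real
    assume \<epsilon>: "\<epsilon> > 0"
    obtain m where m: "1 / real (Suc m) < \<epsilon> / 2"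
      using nat_approx_posE[of "\<epsilon>/2"] \<epsilon> by auto
    obtain k where k: "dist (z k) p < \<epsilon> / (4 * B)"
      using z[of "\<epsilon> / (4 * B)" p] \<epsilon> B_pos by auto
    have Bk: "B * norm (p - z k) \<le> \<epsilon> / 4"
      using k B_pos by (simp add: dist_norm norm_minus_commute field_simps)
    have "support_fun p (F \<omega>) - \<epsilon> \<le> p \<bullet> f (k, m) \<omega>" if \<omega>: "\<omega> \<in> space M" for \<omega>
    proof -
      have "\<bar>support_fun p (F \<omega>) - support_fun (z k) (F \<omega>)\<bar> \<le> B * norm (p - z k)"
        by (rule support_fun_Lipschitz[OF F_Kkc_bdd[OF \<omega>]])
      moreover have "\<bar>(p - z k) \<bullet> f (k, m) \<omega>\<bar> \<le> norm (p - z k) * B"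
        by (intro order_trans[OF Cauchy_Schwarz_ineq2] mult_left_mono
              norm_le_if_mem_Kkc_bdd[OF F_Kkc_bdd[OF \<omega>] f(2)[OF \<omega>]]) auto
      ultimately show ?thesis
        using f(3)[OF \<omega>, of "(k, m)"] Bk m by (simp add: inner_diff_left mult.commute)
    qed
    then show "\<exists>i. \<forall>\<omega>\<in>space M. support_fun p (F \<omega>) - \<epsilon> \<le> p \<bullet> f (prod_decode i) \<omega>"
      by (metis prod_encode_inverse)
  qed (use f in auto)
qed

text \<open>
  The set is the closed convex hull of the conditional expectations of a countable family of
  selections that nearly maximises every direction. In direction \<open>p\<close> every member of the family lies below the conditional
  expectation of \<open>support_fun p (F \<omega>)\<close>, and members that nearly maximise \<open>p\<close> come close to it.
\<close>

lemma cond_support_mean_exists: "\<exists>N. is_cond_support_mean M G B F N"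
proof -
  obtain f :: "nat \<Rightarrow> 'a \<Rightarrow> 'e" where f [measurable]: "\<And>i. f i \<in> borel_measurable M"
    and fF: "\<And>i \<omega>. \<omega> \<in> space M \<Longrightarrow> f i \<omega> \<in> F \<omega>"
    and fmax: "\<And>p \<epsilon>. \<epsilon> > 0 \<Longrightarrow> \<exists>i. \<forall>\<omega>\<in>space M. support_fun p (F \<omega>) - \<epsilon> \<le> p \<bullet> f i \<omega>"
    by (rule selection_family_exists) blast
  obtain z :: "nat \<Rightarrow> 'e" where z: "\<And>x e. e > 0 \<Longrightarrow> \<exists>k. dist (z k) x < e"
    by (rule dense_sequence_exists) blast
  have f_int: "integrable M (f i)" for i
    using selections_iff[of "f i"] fF by (auto simp: selections_def)
  have f_norm: "norm (f i \<omega>) \<le> B" if "\<omega> \<in> space M" for i \<omega>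
    by (rule norm_le_if_mem_Kkc_bdd[OF F_Kkc_bdd[OF that] fF[OF that]])
  \<comment> \<open>Conditional expectations are bounded by \<open>B\<close> only almost surely; the exceptional values are
     set to \<open>0\<close>.\<close>
  define n where "n i \<omega> = (if norm (vec_cond_exp M G (f i) \<omega>) \<le> B then vec_cond_exp M G (f i) \<omega> else 0)" for i \<omega>
  have n [measurable]: "n i \<in> borel_measurable G" for i
    unfolding n_def by measurable
  have n_bound: "range (\<lambda>i. n i \<omega>) \<subseteq> cball 0 B" for \<omega>
    using B_pos by (auto simp: n_def)
  have n_eq: "AE \<omega> in M. n i \<omega> = vec_cond_exp M G (f i) \<omega>" for i
  proof -
    have "AE \<omega> in M. \<forall>k. z k \<bullet> vec_cond_exp M G (f i) \<omega> \<le> B * norm (z k)"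
      unfolding AE_all_countable
    proof
      fix k
      have "AE \<omega> in M. real_cond_exp M G (\<lambda>\<omega>. z k \<bullet> f i \<omega>) \<omega> \<le> B * norm (z k)"
      proof (rule real_cond_exp_le_c)
        show "AE \<omega> in M. z k \<bullet> f i \<omega> \<le> B * norm (z k)"
        proof (rule AE_I2)
          fix \<omega> assume "\<omega> \<in> space M"
          from f_norm[OF this, of i] have "norm (z k) * norm (f i \<omega>) \<le> norm (z k) * B"
            by (intro mult_left_mono) auto
          then show "z k \<bullet> f i \<omega> \<le> B * norm (z k)"
            using norm_cauchy_schwarz[of "z k" "f i \<omega>"] by (simp add: mult.commute)
        qed
      qed (use f_int in auto)
      with AE_inner_vec_cond_exp[OF f_int, of "z k" i]
      show "AE \<omega> in M. z k \<bullet> vec_cond_exp M G (f i) \<omega> \<le> B * norm (z k)"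
        by eventually_elim simp
    qed
    then show ?thesis
    proof eventually_elim
      case (elim \<omega>)
      then have "vec_cond_exp M G (f i) \<omega> \<in> cball 0 B"
        using mem_cball_iff_inner[OF z] B_pos by simp
      then show ?case
        by (simp add: n_def)
    qed
  qed
  define N where "N \<omega> = closure (convex hull range (\<lambda>i. n i \<omega>))" for \<omega>
  have N_Kkc: "N \<omega> \<in> Kkc_bdd B" for \<omega>
    unfolding N_def by (rule Kkc_bdd_closed_hull[OF n_bound])
  have supp: "support_fun p (N \<omega>) = (SUP i. p \<bullet> n i \<omega>)" for p \<omega>
    unfolding N_def by (rule support_fun_closed_hull[OF n_bound])
  have bdd: "bdd_above (range (\<lambda>i. p \<bullet> n i \<omega>))" for p \<omega>
    using n_bound[of \<omega>] by (intro bdd_above_mono[OF bdd_above_inner_image[OF compact_cball, of p 0 B]]) blast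
  have "N \<in> G \<rightarrow>\<^sub>M set_space (Kkc_bdd B)"
    unfolding supp using bdd
    by (intro measurable_set_space_if_support_fun N_Kkc, unfold supp, intro borel_measurable_cSUP) auto
  moreover have "AE \<omega> in M. support_fun p (N \<omega>) = real_cond_exp M G (\<lambda>\<omega>. support_fun p (F \<omega>)) \<omega>" for p
  proof -
    let ?E = "real_cond_exp M G (\<lambda>\<omega>. support_fun p (F \<omega>))"
    have upper: "AE \<omega> in M. p \<bullet> n i \<omega> \<le> ?E \<omega>" for i
    proof -
      have "AE \<omega> in M. real_cond_exp M G (\<lambda>\<omega>. p \<bullet> f i \<omega>) \<omega> \<le> ?E \<omega>"
      proof (rule real_cond_exp_mono)
        show "AE \<omega> in M. p \<bullet> f i \<omega> \<le> support_fun p (F \<omega>)"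
          using fF F_Kkc_bdd by (intro AE_I2 inner_le_support_fun) (auto simp: Kkc_bdd_iff)
      qed (use f_int integrable_F_support in auto)
      with AE_inner_vec_cond_exp[OF f_int, of p i] n_eq[of i] show ?thesis
        by eventually_elim simp
    qed
    have lower: "AE \<omega> in M. \<exists>i. ?E \<omega> - 1 / real (Suc m) \<le> p \<bullet> n i \<omega>" for m
    proof -
      obtain i where i: "\<And>\<omega>. \<omega> \<in> space M \<Longrightarrow> support_fun p (F \<omega>) - 1 / real (Suc m) \<le> p \<bullet> f i \<omega>"
        using fmax[of "1 / real (Suc m)" p] by auto
      have "AE \<omega> in M. ?E \<omega> \<le> real_cond_exp M G (\<lambda>\<omega>. p \<bullet> f i \<omega> + 1 / real (Suc m)) \<omega>"
        using f_int[of i] integrable_F_support i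
        by (intro real_cond_exp_mono) (auto simp: algebra_simps)
      moreover have "AE \<omega> in M. real_cond_exp M G (\<lambda>\<omega>. p \<bullet> f i \<omega> + 1 / real (Suc m)) \<omega> =
          real_cond_exp M G (\<lambda>\<omega>. p \<bullet> f i \<omega>) \<omega> + real_cond_exp M G (\<lambda>_. 1 / real (Suc m)) \<omega>"
        using f_int[of i] by (intro real_cond_exp_add) auto
      moreover have "AE \<omega> in M. real_cond_exp M G (\<lambda>_. 1 / real (Suc m)) \<omega> = 1 / real (Suc m)"
        by (intro real_cond_exp_F_meas) auto
      ultimately show ?thesis
        using AE_inner_vec_cond_exp[OF f_int, of p i] n_eq[of i]
        by eventually_elim (auto intro!: exI[of _ i])
    qed
    have "AE \<omega> in M. (\<forall>i. p \<bullet> n i \<omega> \<le> ?E \<omega>) \<and> (\<forall>m. \<exists>i. ?E \<omega> - 1 / real (Suc m) \<le> p \<bullet> n i \<omega>)"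
      using upper lower by (intro AE_conjI) (simp_all add: AE_all_countable)
    then show ?thesis
    proof eventually_elim
      case (elim \<omega>)
      have "?E \<omega> \<le> (SUP i. p \<bullet> n i \<omega>)"
      proof (rule field_le_epsilon)
        fix e :: real assume "e > 0"
        then obtain m where m: "1 / real (Suc m) < e"
          using nat_approx_posE by blast
        obtain i where "?E \<omega> - 1 / real (Suc m) \<le> p \<bullet> n i \<omega>"
          using elim by blast
        with cSUP_upper[OF UNIV_I bdd[of p \<omega>], of i] m show "?E \<omega> \<le> (SUP i. p \<bullet> n i \<omega>) + e"
          by simp
      qed
      then show ?case
        unfolding supp using elim by (intro antisym cSUP_least) auto
    qed
  qed
  ultimately show ?thesis
    by (auto simp: is_cond_support_mean_def)
qed

end

section \<open>Conditional expectations of selections\<close>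

text \<open>
  The mean absolute value is controlled by the mean square through \<open>2ab \<le> a\<^sup>2 + b\<^sup>2\<close>; the parameter
  \<open>\<eta>\<close> is left free, and taking it of the order of the root mean square recovers the
  Cauchy-Schwarz bound.
\<close>

lemma (in finite_measure) integral_abs_le_integral_square:
  fixes x :: "'a \<Rightarrow> real"
  assumes x [measurable]: "x \<in> borel_measurable M" and sq: "integrable M (\<lambda>\<omega>. (x \<omega>)\<^sup>2)" and \<eta>: "\<eta> > 0"
  shows "(\<integral>\<omega>. \<bar>x \<omega>\<bar> \<partial>M) \<le> ((\<integral>\<omega>. (x \<omega>)\<^sup>2 \<partial>M) / \<eta> + \<eta> * measure M (space M)) / 2"
proof -
  have *: "\<bar>x \<omega>\<bar> \<le> ((x \<omega>)\<^sup>2 / \<eta> + \<eta>) / 2" for \<omega>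
  proof -
    have "0 \<le> (\<bar>x \<omega>\<bar> - \<eta>)\<^sup>2"
      by simp
    then have "2 * \<bar>x \<omega>\<bar> * \<eta> \<le> (x \<omega>)\<^sup>2 + \<eta>\<^sup>2"
      by (simp add: power2_diff)
    then show ?thesis
      using \<eta> by (simp add: field_simps power2_eq_square)
  qed
  have int: "integrable M (\<lambda>\<omega>. ((x \<omega>)\<^sup>2 / \<eta> + \<eta>) / 2)"
    using sq by auto
  have "(\<integral>\<omega>. \<bar>x \<omega>\<bar> \<partial>M) \<le> (\<integral>\<omega>. ((x \<omega>)\<^sup>2 / \<eta> + \<eta>) / 2 \<partial>M)"
    using * \<eta> by (intro integral_mono Bochner_Integration.integrable_bound[OF int]) auto
  also have "\<dots> = ((\<integral>\<omega>. (x \<omega>)\<^sup>2 \<partial>M) / \<eta> + \<eta> * measure M (space M)) / 2"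
    using sq by (simp add: mult.commute)
  finally show ?thesis .
qed

text \<open>
  An elementary form of weak compactness in \<open>L\<^sup>2\<close>: elements of almost minimal norm in a decreasing
  sequence of midpoint convex sets form a Cauchy sequence, by the parallelogram identity.
\<close>

lemma (in prob_space) nested_convex_AE_limit:
  fixes T :: "nat \<Rightarrow> ('a \<Rightarrow> 'e::euclidean_space) set"
  assumes dec: "\<And>n. T (Suc n) \<subseteq> T n" and ne: "\<And>n. T n \<noteq> {}"
    and meas: "\<And>n f. f \<in> T n \<Longrightarrow> f \<in> borel_measurable M"
    and bound: "\<And>n f. f \<in> T n \<Longrightarrow> AE \<omega> in M. norm (f \<omega>) \<le> B"
    and mid: "\<And>n f h. f \<in> T n \<Longrightarrow> h \<in> T n \<Longrightarrow> (\<lambda>\<omega>. (1/2) *\<^sub>R f \<omega> + (1/2) *\<^sub>R h \<omega>) \<in> T n"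
  obtains f h where "\<And>n. f n \<in> T n" "h \<in> borel_measurable M" "AE \<omega> in M. (\<lambda>n. f n \<omega>) \<longlonglongrightarrow> h \<omega>"
proof -
  define e where "e f = (\<integral>\<omega>. (norm (f \<omega>))\<^sup>2 \<partial>M)" for f :: "'a \<Rightarrow> 'e"
  have e_nonneg: "0 \<le> e f" for f
    by (simp add: e_def)
  have sq_int: "integrable M (\<lambda>\<omega>. (norm (f \<omega>))\<^sup>2)"
    if "f \<in> borel_measurable M" "AE \<omega> in M. norm (f \<omega>) \<le> C" for f :: "'a \<Rightarrow> 'e" and C
  proof (rule integrable_const_bound)
    show "AE \<omega> in M. norm ((norm (f \<omega>))\<^sup>2) \<le> C\<^sup>2"
      using that(2) by eventually_elim (auto intro: power_mono)
  qed (use that in measurable)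
  have e_le: "e f \<le> B\<^sup>2" if f: "f \<in> T n" for f n
  proof -
    have "e f \<le> (\<integral>\<omega>. B\<^sup>2 \<partial>M)"
      unfolding e_def
    proof (rule integral_mono_AE)
      show "AE \<omega> in M. (norm (f \<omega>))\<^sup>2 \<le> B\<^sup>2"
        using bound[OF f] by eventually_elim (auto intro: power_mono)
    qed (use sq_int[OF meas[OF f] bound[OF f]] in auto)
    then show ?thesis
      by (simp add: prob_space)
  qed
  define m where "m n = (INF f\<in>T n. e f)" for n
  have bdd: "bdd_below (e ` T n)" for n
    using e_nonneg by (intro bdd_belowI[of _ 0]) auto
  have m_le: "m n \<le> e f" if "f \<in> T n" for f n
    unfolding m_def using bdd that by (rule cINF_lower)
  have T_mono: "T k \<subseteq> T n" if "n \<le> k" for n k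
    using lift_Suc_antimono_le[of T, OF dec that] .
  have m_mono: "m n \<le> m k" if "n \<le> k" for n k
    unfolding m_def using T_mono[OF that] bdd ne by (intro cINF_superset_mono) auto
  have m_bound: "m n \<le> B\<^sup>2" for n
    using ne[of n] m_le e_le order_trans by blast
  obtain L where L: "m \<longlonglongrightarrow> L" "\<And>n. m n \<le> L"
    using incseq_convergent[of m "B\<^sup>2"] m_mono m_bound by (auto simp: incseq_def)
  have "\<exists>f\<in>T n. e f < m n + 1 / real (Suc n)" for n
    using cInf_lessD[of "e ` T n" "m n + 1 / real (Suc n)"] ne[of n] by (auto simp: m_def)
  then obtain f where f: "\<And>n. f n \<in> T n" "\<And>n. e (f n) < m n + 1 / real (Suc n)"
    by metis
  have f_sq: "integrable M (\<lambda>\<omega>. (norm (f n \<omega>))\<^sup>2)" for n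
    by (rule sq_int[OF meas bound]) (rule f)+
  have f_meas [measurable]: "f n \<in> borel_measurable M" for n
    by (rule meas[OF f(1)])
  have diff_sq: "integrable M (\<lambda>\<omega>. (norm (f n \<omega> - f k \<omega>))\<^sup>2)" for n k
  proof (rule sq_int)
    show "AE \<omega> in M. norm (f n \<omega> - f k \<omega>) \<le> B + B"
      using bound[OF f(1)[of n]] bound[OF f(1)[of k]]
      by eventually_elim (rule order_trans[OF norm_triangle_ineq4], simp)
  qed measurable
  define \<alpha> where "\<alpha> n = 2 * (L - m n) + 4 / real (Suc n)" for n
  have dist_le: "(\<integral>\<omega>. (norm (f n \<omega> - f k \<omega>))\<^sup>2 \<partial>M) \<le> \<alpha> n" if "n \<le> k" for n k
  proof -
    let ?h = "\<lambda>\<omega>. (1/2) *\<^sub>R f n \<omega> + (1/2) *\<^sub>R f k \<omega>"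
    have h: "?h \<in> T n"
      using f T_mono[OF that] by (intro mid) auto
    have parallelogram: "(norm (f n \<omega> - f k \<omega>))\<^sup>2 + 4 * (norm (?h \<omega>))\<^sup>2 = 2 * (norm (f n \<omega>))\<^sup>2 + 2 * (norm (f k \<omega>))\<^sup>2" for \<omega>
      unfolding power2_norm_eq_inner by (simp add: inner_diff inner_add inner_commute algebra_simps)
    have "(\<integral>\<omega>. (norm (f n \<omega> - f k \<omega>))\<^sup>2 \<partial>M) + 4 * e ?h =
        (\<integral>\<omega>. (norm (f n \<omega> - f k \<omega>))\<^sup>2 + 4 * (norm (?h \<omega>))\<^sup>2 \<partial>M)"
      unfolding e_def using diff_sq sq_int[OF meas[OF h] bound[OF h]] by simp
    also have "\<dots> = (\<integral>\<omega>. 2 * (norm (f n \<omega>))\<^sup>2 + 2 * (norm (f k \<omega>))\<^sup>2 \<partial>M)"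
      by (simp only: parallelogram)
    also have "\<dots> = 2 * e (f n) + 2 * e (f k)"
      unfolding e_def using f_sq by simp
    finally have "(\<integral>\<omega>. (norm (f n \<omega> - f k \<omega>))\<^sup>2 \<partial>M) = 2 * e (f n) + 2 * e (f k) - 4 * e ?h"
      by simp
    moreover have "1 / real (Suc k) \<le> 1 / real (Suc n)"
      using that by (intro divide_left_mono) auto
    ultimately show ?thesis
      using f(2)[of n] f(2)[of k] m_le[OF h] L(2)[of k] by (simp add: \<alpha>_def)
  qed
  have "(\<lambda>n. 2 * (L - m n) + 4 * (1 / real (Suc n))) \<longlonglongrightarrow> 2 * (L - L) + 4 * 0"
    by (intro tendsto_intros L LIMSEQ_inverse_real_of_nat[unfolded inverse_eq_divide])
  then have \<alpha>: "\<alpha> \<longlonglongrightarrow> 0"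
    by (simp add: \<alpha>_def[abs_def])
  have f_int: "integrable M (f n)" for n
    using bound[OF f(1)] by (rule integrable_const_bound) measurable
  have "\<exists>N. \<forall>i\<ge>N. \<forall>j\<ge>N. (\<integral>\<omega>. norm (f i \<omega> - f j \<omega>) \<partial>M) < c" if c: "c > 0" for c
  proof -
    have "eventually (\<lambda>n. \<alpha> n < c\<^sup>2) sequentially"
      using c by (intro order_tendstoD(2)[OF \<alpha>]) simp
    then obtain N where N: "\<And>n. n \<ge> N \<Longrightarrow> \<alpha> n < c\<^sup>2"
      by (auto simp: eventually_sequentially)
    have "(\<integral>\<omega>. norm (f i \<omega> - f j \<omega>) \<partial>M) < c" if ij: "i \<ge> N" "j \<ge> N" for i j
    proof -
      have "(\<integral>\<omega>. (norm (f i \<omega> - f j \<omega>))\<^sup>2 \<partial>M) < c\<^sup>2"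
      proof (cases "i \<le> j")
        case True
        then show ?thesis
          using dist_le[OF True] N[OF ij(1)] by simp
      next
        case False
        then have "(\<integral>\<omega>. (norm (f j \<omega> - f i \<omega>))\<^sup>2 \<partial>M) < c\<^sup>2"
          using dist_le[of j i] N[OF ij(2)] by simp
        then show ?thesis
          by (simp add: norm_minus_commute)
      qed
      then have "(\<integral>\<omega>. (norm (f i \<omega> - f j \<omega>))\<^sup>2 \<partial>M) / c < c"
        using c by (simp add: power2_eq_square pos_divide_less_eq)
      moreover have "(\<integral>\<omega>. \<bar>norm (f i \<omega> - f j \<omega>)\<bar> \<partial>M) \<le>
          ((\<integral>\<omega>. (norm (f i \<omega> - f j \<omega>))\<^sup>2 \<partial>M) / c + c * measure M (space M)) / 2"
        using diff_sq c by (intro integral_abs_le_integral_square) auto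
      ultimately show ?thesis
        by (simp add: prob_space)
    qed
    then show ?thesis
      by blast
  qed
  then obtain r where r: "strict_mono r" "AE \<omega> in M. Cauchy (\<lambda>n. f (r n) \<omega>)"
    by (rule cauchy_L1_AE_cauchy_subseq[of M f, OF f_int]) blast+
  show thesis
  proof (rule that[of "\<lambda>n. f (r n)" "\<lambda>\<omega>. lim (\<lambda>n. f (r n) \<omega>)"])
    show "f (r n) \<in> T n" for n
      using f(1)[of "r n"] T_mono[OF seq_suble[OF r(1)]] by auto
    show "(\<lambda>\<omega>. lim (\<lambda>n. f (r n) \<omega>)) \<in> borel_measurable M"
      by measurable
    show "AE \<omega> in M. (\<lambda>n. f (r n) \<omega>) \<longlonglongrightarrow> lim (\<lambda>n. f (r n) \<omega>)"
      using r(2) by eventually_elim (simp add: Cauchy_convergent_iff convergent_LIMSEQ_iff)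
  qed
qed

context finite_measure_subalgebra
begin

lemma set_integral_vec_cond_exp:
  fixes f :: "'a \<Rightarrow> 'e::euclidean_space"
  assumes f: "integrable M f" and A: "A \<in> sets F"
  shows "(\<integral>\<omega>\<in>A. vec_cond_exp M F f \<omega> \<partial>M) = (\<integral>\<omega>\<in>A. f \<omega> \<partial>M)"
proof (rule euclidean_eqI)
  fix b :: 'e assume b: "b \<in> Basis"
  have A': "A \<in> sets M"
    using A subalg by (auto simp: subalgebra_def)
  have *: "(\<integral>\<omega>\<in>A. h \<omega> \<partial>M) \<bullet> b = (\<integral>\<omega>\<in>A. h \<omega> \<bullet> b \<partial>M)" if "integrable M h" for h :: "'a \<Rightarrow> 'e"
    using integral_inner_left[of b M "\<lambda>\<omega>. indicator A \<omega> *\<^sub>R h \<omega>"] integrable_mult_indicator[OF A' that]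
    by (simp add: set_lebesgue_integral_def)
  show "(\<integral>\<omega>\<in>A. vec_cond_exp M F f \<omega> \<partial>M) \<bullet> b = (\<integral>\<omega>\<in>A. f \<omega> \<partial>M) \<bullet> b"
    using real_cond_exp_intA[of "\<lambda>\<omega>. f \<omega> \<bullet> b" A] f A
    by (simp add: * integrable_vec_cond_exp vec_cond_exp_inner_Basis[OF b])
qed

end

lemma (in random_convex_set) selections_convex:
  assumes f: "f \<in> selections M F" and h: "h \<in> selections M F" and ac: "a \<ge> 0" "c \<ge> 0" "a + c = 1"
  shows "(\<lambda>\<omega>. a *\<^sub>R f \<omega> + c *\<^sub>R h \<omega>) \<in> selections M F"
proof -
  have "AE \<omega> in M. a *\<^sub>R f \<omega> + c *\<^sub>R h \<omega> \<in> F \<omega>"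
    using selectionsD(3)[OF f] selectionsD(3)[OF h] AE_space
    by eventually_elim (use F_Kkc_bdd ac in \<open>auto simp: Kkc_bdd_iff convex_def\<close>)
  then show ?thesis
    using selectionsD(2)[OF f] selectionsD(2)[OF h] by (simp add: selections_iff)
qed

lemma (in random_convex_set) selections_nonempty: "selections M F \<noteq> {}"
proof -
  obtain f where "f \<in> borel_measurable M" "\<And>\<omega>. \<omega> \<in> space M \<Longrightarrow> f \<omega> \<in> F \<omega>"
    using measurable_selection_exists[OF measurable_set_space_mono[OF F Kkc_bdd_subset_closed_sets]] by blast
  then show ?thesis
    using selections_iff[of f] by auto
qed

locale random_convex_set_mean = random_convex_set +
  fixes N
  assumes mean: "is_cond_support_mean M G B F N"
begin

lemma N_G: "N \<in> G \<rightarrow>\<^sub>M set_space (Kkc_bdd B)"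
  using mean by (simp add: is_cond_support_mean_def)

lemma N_M: "N \<in> M \<rightarrow>\<^sub>M set_space (Kkc_bdd B)"
  by (rule measurable_set_space_subalgebra[OF subalg N_G])

lemma N_Kkc_bdd: "\<omega> \<in> space M \<Longrightarrow> N \<omega> \<in> Kkc_bdd B"
  using N_M by (simp add: measurable_set_space_iff)

lemma support_N: "AE \<omega> in M. support_fun p (N \<omega>) = real_cond_exp M G (\<lambda>\<omega>. support_fun p (F \<omega>)) \<omega>"
  using mean by (simp add: is_cond_support_mean_def)

lemma measurable_N_support [measurable]: "(\<lambda>\<omega>. support_fun p (N \<omega>)) \<in> borel_measurable G"
  by (rule measurable_support_fun[OF N_G]) simp

lemma cond_exp_selection_in_mean:
  assumes f: "f \<in> selections M F"
  shows "AE \<omega> in M. vec_cond_exp M G f \<omega> \<in> N \<omega>"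
proof -
  obtain z :: "nat \<Rightarrow> 'b" where z: "\<And>x e. e > 0 \<Longrightarrow> \<exists>k. dist (z k) x < e"
    by (rule dense_sequence_exists) blast
  have "AE \<omega> in M. z k \<bullet> vec_cond_exp M G f \<omega> \<le> support_fun (z k) (N \<omega>)" for k
  proof -
    have "AE \<omega> in M. real_cond_exp M G (\<lambda>\<omega>. z k \<bullet> f \<omega>) \<omega> \<le> real_cond_exp M G (\<lambda>\<omega>. support_fun (z k) (F \<omega>)) \<omega>"
    proof (rule real_cond_exp_mono)
      show "AE \<omega> in M. z k \<bullet> f \<omega> \<le> support_fun (z k) (F \<omega>)"
        using selectionsD(3)[OF f] AE_space
        by eventually_elim (use F_Kkc_bdd in \<open>auto simp: Kkc_bdd_iff intro: inner_le_support_fun\<close>)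
    qed (use selectionsD(1)[OF f] integrable_F_support in auto)
    with AE_inner_vec_cond_exp[OF selectionsD(1)[OF f], of "z k"] support_N[of "z k"]
    show ?thesis
      by eventually_elim simp
  qed
  then have "AE \<omega> in M. \<forall>k. z k \<bullet> vec_cond_exp M G f \<omega> \<le> support_fun (z k) (N \<omega>)"
    by (simp add: AE_all_countable)
  then show ?thesis
    using AE_space by eventually_elim (use mem_iff_support_fun[OF z N_Kkc_bdd] in auto)
qed

lemma cond_exp_selection_bounded:
  assumes f: "f \<in> selections M F"
  shows "AE \<omega> in M. norm (vec_cond_exp M G f \<omega>) \<le> B"
  using cond_exp_selection_in_mean[OF f] AE_space
  by eventually_elim (rule norm_le_if_mem_Kkc_bdd[OF N_Kkc_bdd])

text \<open>
  The direction may itself be random as long as it is known given \<open>G\<close>: a simple direction splits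
  the space into finitely many events of \<open>G\<close> on which it is constant.
\<close>

lemma integral_support_fun_eq:
  assumes q: "q \<in> borel_measurable G" and C: "AE \<omega> in M. norm (q \<omega>) \<le> C"
  shows "(\<integral>\<omega>. support_fun (q \<omega>) (F \<omega>) \<partial>M) = (\<integral>\<omega>. support_fun (q \<omega>) (N \<omega>) \<partial>M)"
proof -
  have simple: "(\<integral>\<omega>. support_fun (s \<omega>) (F \<omega>) \<partial>M) = (\<integral>\<omega>. support_fun (s \<omega>) (N \<omega>) \<partial>M)"
    if s: "simple_function G s" for s
  proof -
    have fin: "finite (s ` space M)"
      using s by (simp add: simple_function_def space_G)
    define A where "A y = s -` {y} \<inter> space M" for y
    have A: "A y \<in> sets G" if "y \<in> s ` space M" for y
      using s that by (auto simp: simple_function_def space_G A_def)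
    have split: "support_fun (s \<omega>) (K \<omega>) = (\<Sum>y\<in>s ` space M. indicator (A y) \<omega> * support_fun y (K \<omega>))"
      if "\<omega> \<in> space M" for \<omega> and K :: "'a \<Rightarrow> 'b set"
    proof -
      have "(\<Sum>y\<in>s ` space M. indicator (A y) \<omega> * support_fun y (K \<omega>)) =
          (\<Sum>y\<in>s ` space M. if y = s \<omega> then support_fun y (K \<omega>) else 0)"
        using that by (intro sum.cong) (auto simp: A_def)
      then show ?thesis
        using that fin by simp
    qed
    have int: "integrable M (\<lambda>\<omega>. indicator (A y) \<omega> * support_fun y (F \<omega>))"
      "integrable M (\<lambda>\<omega>. indicator (A y) \<omega> * support_fun y (N \<omega>))" if "y \<in> s ` space M" for y
      using integrable_mult_indicator[OF sets_G[OF A[OF that]] integrable_F_support[of y]]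
        integrable_mult_indicator[OF sets_G[OF A[OF that]] integrable_support_fun[OF N_M, of "\<lambda>_. y" "norm y"]]
      by auto
    have eq: "(\<integral>\<omega>. indicator (A y) \<omega> * support_fun y (F \<omega>) \<partial>M) = (\<integral>\<omega>. indicator (A y) \<omega> * support_fun y (N \<omega>) \<partial>M)"
      if "y \<in> s ` space M" for y
    proof -
      have [measurable]: "A y \<in> sets G" "A y \<in> sets M"
        using A[OF that] sets_G by auto
      have [measurable]: "(\<lambda>\<omega>. support_fun y (N \<omega>)) \<in> borel_measurable M"
        by (rule measurable_support_fun[OF N_M]) simp
      have "(\<integral>\<omega>. indicator (A y) \<omega> * support_fun y (F \<omega>) \<partial>M) =
          (\<integral>\<omega>. indicator (A y) \<omega> * real_cond_exp M G (\<lambda>\<omega>. support_fun y (F \<omega>)) \<omega> \<partial>M)"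
        by (rule real_cond_exp_intg(2)[symmetric]) (use int[OF that] in auto)
      also have "\<dots> = (\<integral>\<omega>. indicator (A y) \<omega> * support_fun y (N \<omega>) \<partial>M)"
        by (rule integral_cong_AE) (use support_N[of y] in \<open>auto elim!: eventually_mono\<close>)
      finally show ?thesis .
    qed
    have "(\<integral>\<omega>. support_fun (s \<omega>) (F \<omega>) \<partial>M) = (\<integral>\<omega>. (\<Sum>y\<in>s ` space M. indicator (A y) \<omega> * support_fun y (F \<omega>)) \<partial>M)"
      by (intro Bochner_Integration.integral_cong refl split)
    also have "\<dots> = (\<Sum>y\<in>s ` space M. \<integral>\<omega>. indicator (A y) \<omega> * support_fun y (F \<omega>) \<partial>M)"
      by (intro Bochner_Integration.integral_sum int)
    also have "\<dots> = (\<Sum>y\<in>s ` space M. \<integral>\<omega>. indicator (A y) \<omega> * support_fun y (N \<omega>) \<partial>M)"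
      by (intro sum.cong refl eq)
    also have "\<dots> = (\<integral>\<omega>. (\<Sum>y\<in>s ` space M. indicator (A y) \<omega> * support_fun y (N \<omega>)) \<partial>M)"
      by (intro Bochner_Integration.integral_sum[symmetric] int)
    also have "\<dots> = (\<integral>\<omega>. support_fun (s \<omega>) (N \<omega>) \<partial>M)"
      by (intro Bochner_Integration.integral_cong refl split[symmetric])
    finally show ?thesis .
  qed
  obtain s where s: "\<And>i. simple_function G (s i)" "\<And>\<omega>. \<omega> \<in> space M \<Longrightarrow> (\<lambda>i. s i \<omega>) \<longlonglongrightarrow> q \<omega>"
    "\<And>i \<omega>. \<omega> \<in> space M \<Longrightarrow> norm (s i \<omega>) \<le> 2 * norm (q \<omega>)"
    using borel_measurable_implies_sequence_metric[OF q, of 0] by (simp add: space_G) blast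
  have [measurable]: "q \<in> borel_measurable M" "s i \<in> borel_measurable M" for i
    using q borel_measurable_simple_function[OF s(1)] by (auto intro: measurable_from_subalg[OF subalg])
  have lim: "(\<lambda>i. \<integral>\<omega>. support_fun (s i \<omega>) (K \<omega>) \<partial>M) \<longlonglongrightarrow> (\<integral>\<omega>. support_fun (q \<omega>) (K \<omega>) \<partial>M)"
    if K: "K \<in> M \<rightarrow>\<^sub>M set_space (Kkc_bdd B)" for K
  proof (rule integral_dominated_convergence)
    have K': "K \<omega> \<in> Kkc_bdd B" if "\<omega> \<in> space M" for \<omega>
      using K that by (simp add: measurable_set_space_iff)
    show "AE \<omega> in M. (\<lambda>i. support_fun (s i \<omega>) (K \<omega>)) \<longlonglongrightarrow> support_fun (q \<omega>) (K \<omega>)"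
    proof (rule AE_I2)
      fix \<omega> assume \<omega>: "\<omega> \<in> space M"
      have "continuous_on UNIV (\<lambda>p. support_fun p (K \<omega>))"
        by (rule continuous_on_support_fun[OF K'[OF \<omega>] continuous_on_id])
      from continuous_on_tendsto_compose[OF this s(2)[OF \<omega>]]
      show "(\<lambda>i. support_fun (s i \<omega>) (K \<omega>)) \<longlonglongrightarrow> support_fun (q \<omega>) (K \<omega>)"
        by simp
    qed
    show "AE \<omega> in M. norm (support_fun (s i \<omega>) (K \<omega>)) \<le> B * (2 * C)" for i
      using C AE_space
    proof eventually_elim
      case (elim \<omega>)
      have "\<bar>support_fun (s i \<omega>) (K \<omega>)\<bar> \<le> B * norm (s i \<omega>)"
        using elim by (intro support_fun_bound K')
      also have "\<dots> \<le> B * (2 * C)"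
        using elim s(3)[of \<omega> i] B_pos by (intro mult_left_mono) auto
      finally show ?case
        by simp
    qed
    show "(\<lambda>\<omega>. support_fun (q \<omega>) (K \<omega>)) \<in> borel_measurable M" "(\<lambda>\<omega>. support_fun (s i \<omega>) (K \<omega>)) \<in> borel_measurable M" for i
      by (intro measurable_support_fun[OF K]; measurable)+
  qed auto
  from lim[OF F] have "(\<lambda>i. \<integral>\<omega>. support_fun (s i \<omega>) (N \<omega>) \<partial>M) \<longlonglongrightarrow> (\<integral>\<omega>. support_fun (q \<omega>) (F \<omega>) \<partial>M)"
    by (simp add: simple[OF s(1)])
  from LIMSEQ_unique[OF this lim[OF N_M]] show ?thesis .
qed

end

section \<open>The conditional Aumann mean\<close>

context random_convex_set_mean
begin

text \<open>
  Conditional expectations of selections are dense, in mean square, among the \<open>G\<close>-measurable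
  selections \<open>g\<close> of \<open>N\<close>. If \<open>q\<close> is the error of an approximation, moving it slightly towards the
  conditional expectation of a selection of \<open>F\<close> that nearly maximises the direction \<open>q\<close> decreases
  the mean square error by a definite fraction, because \<open>g\<close> lies below the support function of
  \<open>N\<close> in direction \<open>q\<close>.
\<close>

lemma cond_exp_selections_dense:
  assumes g [measurable]: "g \<in> borel_measurable G" and gN: "AE \<omega> in M. g \<omega> \<in> N \<omega>" and \<epsilon>: "\<epsilon> > 0"
  shows "\<exists>f\<in>selections M F. (\<integral>\<omega>. (norm (vec_cond_exp M G f \<omega> - g \<omega>))\<^sup>2 \<partial>M) \<le> \<epsilon>"
proof (rule ccontr)
  define J where "J f = (\<integral>\<omega>. (norm (vec_cond_exp M G f \<omega> - g \<omega>))\<^sup>2 \<partial>M)" for f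
  assume "\<not> ?thesis"
  then have J_gr: "J f > \<epsilon>" if "f \<in> selections M F" for f
    using that by (auto simp: J_def not_le)
  define j where "j = (INF f\<in>selections M F. J f)"
  have j_le: "j \<le> J f" if "f \<in> selections M F" for f
    unfolding j_def using that by (intro cINF_lower bdd_belowI[of _ 0]) (auto simp: J_def)
  have "\<epsilon> \<le> j"
    unfolding j_def using selections_nonempty J_gr by (intro cINF_greatest) (auto intro: less_imp_le)
  \<comment> \<open>The infimum \<open>j\<close> would satisfy \<open>j \<le> \<delta> + 2 * t * B\<^sup>2\<close> for every slack \<open>\<delta>\<close> of the maximising selection
     and every small step size \<open>t\<close>; these values make the bound \<open>\<epsilon> / 2\<close>.\<close>
  define \<delta> where "\<delta> = \<epsilon> / 4"
  define t where "t = min (1/4) (\<epsilon> / (8 * B\<^sup>2))"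
  have t: "t > 0" "t \<le> 1/4" "2 * t * B\<^sup>2 \<le> \<epsilon> / 4"
  proof -
    have "t * (8 * B\<^sup>2) \<le> \<epsilon> / (8 * B\<^sup>2) * (8 * B\<^sup>2)"
      by (intro mult_right_mono) (auto simp: t_def)
    then show "2 * t * B\<^sup>2 \<le> \<epsilon> / 4"
      using B_pos by simp
  qed (use \<epsilon> B_pos in \<open>auto simp: t_def\<close>)
  have "\<delta> > 0"
    using \<epsilon> by (simp add: \<delta>_def)
  have gM [measurable]: "g \<in> borel_measurable M"
    by (rule measurable_from_subalg[OF subalg g])
  have g_bound: "AE \<omega> in M. norm (g \<omega>) \<le> B"
    using gN AE_space by eventually_elim (rule norm_le_if_mem_Kkc_bdd[OF N_Kkc_bdd])
  have descent: "j \<le> (1 - 2 * t) * J f + 2 * t * \<delta> + 4 * t\<^sup>2 * B\<^sup>2" if f: "f \<in> selections M F" for f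
  proof -
    let ?f = "vec_cond_exp M G f"
    define q where "q \<omega> = g \<omega> - ?f \<omega>" for \<omega>
    have q [measurable]: "q \<in> borel_measurable G" "q \<in> borel_measurable M"
      by (auto simp: q_def[abs_def])
    have q_bound: "AE \<omega> in M. norm (q \<omega>) \<le> 2 * B"
      using g_bound cond_exp_selection_bounded[OF f]
    proof eventually_elim
      case (elim \<omega>)
      then show ?case
        using norm_triangle_ineq4[of "g \<omega>" "?f \<omega>"] by (simp add: q_def)
    qed
    obtain h where h_meas: "h \<in> borel_measurable M"
      and hF: "\<And>\<omega>. \<omega> \<in> space M \<Longrightarrow> h \<omega> \<in> F \<omega>"
      and h_max: "\<And>\<omega>. \<omega> \<in> space M \<Longrightarrow> support_fun (q \<omega>) (F \<omega>) - \<delta> \<le> q \<omega> \<bullet> h \<omega>"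
      by (rule almost_maximal_selection_exists[OF F q(2) \<open>\<delta> > 0\<close>]) blast
    have h: "h \<in> selections M F"
      using h_meas hF by (simp add: selections_iff)
    let ?h = "vec_cond_exp M G h"
    define w where "w \<omega> = ?h \<omega> - ?f \<omega>" for \<omega>
    have w [measurable]: "w \<in> borel_measurable M"
      by (auto simp: w_def[abs_def])
    have w_bound: "AE \<omega> in M. norm (w \<omega>) \<le> 2 * B"
      using cond_exp_selection_bounded[OF h] cond_exp_selection_bounded[OF f]
    proof eventually_elim
      case (elim \<omega>)
      then show ?case
        using norm_triangle_ineq4[of "?h \<omega>" "?f \<omega>"] by (simp add: w_def)
    qed
    have inner_int: "integrable M (\<lambda>\<omega>. q \<omega> \<bullet> v \<omega>)" if [measurable]: "v \<in> borel_measurable M"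
      and v: "AE \<omega> in M. norm (v \<omega>) \<le> C" for v :: "'a \<Rightarrow> 'b" and C
    proof (rule integrable_const_bound)
      show "AE \<omega> in M. norm (q \<omega> \<bullet> v \<omega>) \<le> 2 * B * C"
        using q_bound v
      proof eventually_elim
        case (elim \<omega>)
        have "\<bar>q \<omega> \<bullet> v \<omega>\<bar> \<le> norm (q \<omega>) * norm (v \<omega>)"
          by (rule Cauchy_Schwarz_ineq2)
        also have "\<dots> \<le> 2 * B * C"
          using elim B_pos by (intro mult_mono) auto
        finally show ?case by simp
      qed
    qed measurable
    have int_qq: "integrable M (\<lambda>\<omega>. (norm (q \<omega>))\<^sup>2)"
      unfolding power2_norm_eq_inner by (rule inner_int[OF q(2) q_bound])
    have int_ww: "integrable M (\<lambda>\<omega>. (norm (w \<omega>))\<^sup>2)"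
    proof (rule integrable_const_bound)
      show "AE \<omega> in M. norm ((norm (w \<omega>))\<^sup>2) \<le> (2 * B)\<^sup>2"
        using w_bound by eventually_elim (subst real_norm_def, subst abs_of_nonneg, simp, rule power_mono, auto)
    qed measurable
    have int_qw: "integrable M (\<lambda>\<omega>. q \<omega> \<bullet> w \<omega>)"
      by (rule inner_int[OF w w_bound])
    have ww: "(\<integral>\<omega>. (norm (w \<omega>))\<^sup>2 \<partial>M) \<le> 4 * B\<^sup>2"
    proof -
      have "(\<integral>\<omega>. (norm (w \<omega>))\<^sup>2 \<partial>M) \<le> (\<integral>\<omega>. (2 * B)\<^sup>2 \<partial>M)"
      proof (rule integral_mono_AE[OF int_ww])
        show "AE \<omega> in M. (norm (w \<omega>))\<^sup>2 \<le> (2 * B)\<^sup>2"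
          using w_bound by eventually_elim (rule power_mono, auto)
      qed auto
      then show ?thesis
        by (simp add: prob_space)
    qed
    have Jf: "J f = (\<integral>\<omega>. (norm (q \<omega>))\<^sup>2 \<partial>M)"
      by (simp add: J_def q_def norm_minus_commute)
    have qw: "(\<integral>\<omega>. q \<omega> \<bullet> w \<omega> \<partial>M) \<ge> J f - \<delta>"
    proof -
      have int_qg: "integrable M (\<lambda>\<omega>. q \<omega> \<bullet> g \<omega>)"
        by (rule inner_int[OF gM g_bound])
      have int_qf: "integrable M (\<lambda>\<omega>. q \<omega> \<bullet> ?f \<omega>)"
        by (rule inner_int[OF _ cond_exp_selection_bounded[OF f]]) measurable
      note int_qh = integral_inner_vec_cond_exp[OF selectionsD(1)[OF h] q(1) q_bound]
      have "(\<integral>\<omega>. q \<omega> \<bullet> g \<omega> \<partial>M) \<le> (\<integral>\<omega>. support_fun (q \<omega>) (N \<omega>) \<partial>M)"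
      proof (rule integral_mono_AE[OF int_qg integrable_support_fun[OF N_M q(2) q_bound]])
        show "AE \<omega> in M. q \<omega> \<bullet> g \<omega> \<le> support_fun (q \<omega>) (N \<omega>)"
          using gN AE_space
          by eventually_elim (use N_Kkc_bdd in \<open>auto simp: Kkc_bdd_iff intro: inner_le_support_fun\<close>)
      qed
      also have "\<dots> = (\<integral>\<omega>. support_fun (q \<omega>) (F \<omega>) \<partial>M)"
        by (rule integral_support_fun_eq[OF q(1) q_bound, symmetric])
      also have "\<dots> \<le> (\<integral>\<omega>. q \<omega> \<bullet> h \<omega> + \<delta> \<partial>M)"
        using h_max inner_int[OF h_meas selectionsD(4)[OF h]]
        by (intro integral_mono_AE integrable_support_fun[OF F q(2) q_bound] AE_I2) (auto simp: algebra_simps)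
      also have "\<dots> = (\<integral>\<omega>. q \<omega> \<bullet> h \<omega> \<partial>M) + \<delta>"
        using inner_int[OF h_meas selectionsD(4)[OF h]] by (simp add: prob_space)
      also have "(\<integral>\<omega>. q \<omega> \<bullet> h \<omega> \<partial>M) = (\<integral>\<omega>. q \<omega> \<bullet> ?h \<omega> \<partial>M)"
        by (simp add: int_qh(2))
      finally have "(\<integral>\<omega>. q \<omega> \<bullet> g \<omega> \<partial>M) \<le> (\<integral>\<omega>. q \<omega> \<bullet> ?h \<omega> \<partial>M) + \<delta>" .
      moreover have "(\<integral>\<omega>. q \<omega> \<bullet> w \<omega> \<partial>M) = (\<integral>\<omega>. q \<omega> \<bullet> ?h \<omega> \<partial>M) - (\<integral>\<omega>. q \<omega> \<bullet> ?f \<omega> \<partial>M)"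
        unfolding w_def inner_diff_right by (rule Bochner_Integration.integral_diff[OF int_qh(1) int_qf])
      moreover have "J f = (\<integral>\<omega>. q \<omega> \<bullet> g \<omega> \<partial>M) - (\<integral>\<omega>. q \<omega> \<bullet> ?f \<omega> \<partial>M)"
      proof -
        have "(norm (q \<omega>))\<^sup>2 = q \<omega> \<bullet> g \<omega> - q \<omega> \<bullet> ?f \<omega>" for \<omega>
          using inner_diff_right[of "q \<omega>" "g \<omega>" "?f \<omega>"] by (simp add: power2_norm_eq_inner q_def)
        then show ?thesis
          unfolding Jf by (simp add: Bochner_Integration.integral_diff[OF int_qg int_qf])
      qed
      ultimately show ?thesis
        by simp
    qed
    let ?u = "\<lambda>\<omega>. (1 - t) *\<^sub>R f \<omega> + t *\<^sub>R h \<omega>"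
    have u: "?u \<in> selections M F"
      using t by (intro selections_convex f h) auto
    have "AE \<omega> in M. (norm (vec_cond_exp M G ?u \<omega> - g \<omega>))\<^sup>2 =
        (norm (q \<omega>))\<^sup>2 - 2 * t * (q \<omega> \<bullet> w \<omega>) + t\<^sup>2 * (norm (w \<omega>))\<^sup>2"
      using AE_vec_cond_exp_lincomb[OF selectionsD(1)[OF f] selectionsD(1)[OF h], of "1 - t" t]
    proof eventually_elim
      case (elim \<omega>)
      have u_eq: "vec_cond_exp M G ?u \<omega> - g \<omega> = t *\<^sub>R w \<omega> - q \<omega>"
        unfolding elim by (simp add: q_def w_def algebra_simps)
      show ?case
        unfolding u_eq power2_norm_eq_inner
        by (simp add: inner_diff inner_commute algebra_simps power2_eq_square)
    qed
    then have "J ?u = (\<integral>\<omega>. (norm (q \<omega>))\<^sup>2 - 2 * t * (q \<omega> \<bullet> w \<omega>) + t\<^sup>2 * (norm (w \<omega>))\<^sup>2 \<partial>M)"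
      unfolding J_def by (intro integral_cong_AE) measurable
    also have "\<dots> = J f - 2 * t * (\<integral>\<omega>. q \<omega> \<bullet> w \<omega> \<partial>M) + t\<^sup>2 * (\<integral>\<omega>. (norm (w \<omega>))\<^sup>2 \<partial>M)"
      using int_qq int_qw int_ww by (simp add: Jf)
    also have "\<dots> \<le> J f - 2 * t * (J f - \<delta>) + t\<^sup>2 * (4 * B\<^sup>2)"
      using qw ww t by (intro add_mono diff_mono mult_left_mono) auto
    also have "\<dots> = (1 - 2 * t) * J f + 2 * t * \<delta> + 4 * t\<^sup>2 * B\<^sup>2"
      by (simp add: algebra_simps)
    finally show ?thesis
      using j_le[OF u] by simp
  qed
  have "(j - (2 * t * \<delta> + 4 * t\<^sup>2 * B\<^sup>2)) / (1 - 2 * t) \<le> j"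
  proof (subst (2) j_def, rule cINF_greatest[OF selections_nonempty])
    fix f assume "f \<in> selections M F"
    then show "(j - (2 * t * \<delta> + 4 * t\<^sup>2 * B\<^sup>2)) / (1 - 2 * t) \<le> J f"
      using descent[of f] t by (simp add: divide_le_eq algebra_simps)
  qed
  then have "j - (2 * t * \<delta> + 4 * t\<^sup>2 * B\<^sup>2) \<le> j * (1 - 2 * t)"
    using t by (simp add: divide_le_eq)
  then have "t * (2 * j) \<le> t * (2 * \<delta> + 2 * (2 * t * B\<^sup>2))"
    by (simp add: algebra_simps power2_eq_square)
  then have "2 * j \<le> 2 * \<delta> + 2 * (2 * t * B\<^sup>2)"
    using t by simp
  then show False
    using t(3) \<open>\<epsilon> \<le> j\<close> \<epsilon> by (simp add: \<delta>_def)
qed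

text \<open>
  Selections of \<open>F\<close> whose conditional expectations approximate \<open>g\<close> ever better can be chosen almost
  surely convergent, and the limit is again a selection of \<open>F\<close>. Conditional expectations pass to
  the limit because integrals over events of \<open>G\<close> do.
\<close>

theorem selection_of_mean_is_cond_exp:
  assumes g [measurable]: "g \<in> borel_measurable G" and gN: "AE \<omega> in M. g \<omega> \<in> N \<omega>"
  shows "\<exists>f\<in>selections M F. AE \<omega> in M. g \<omega> = vec_cond_exp M G f \<omega>"
proof -
  have gM [measurable]: "g \<in> borel_measurable M"
    by (rule measurable_from_subalg[OF subalg g])
  have g_bound: "AE \<omega> in M. norm (g \<omega>) \<le> B"
    using gN AE_space by eventually_elim (rule norm_le_if_mem_Kkc_bdd[OF N_Kkc_bdd])
  have g_int: "integrable M g"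
    using g_bound by (rule integrable_const_bound) measurable
  define J where "J f = (\<integral>\<omega>. (norm (vec_cond_exp M G f \<omega> - g \<omega>))\<^sup>2 \<partial>M)" for f
  have J_int: "integrable M (\<lambda>\<omega>. (norm (vec_cond_exp M G f \<omega> - g \<omega>))\<^sup>2)" if f: "f \<in> selections M F" for f
  proof (rule integrable_const_bound)
    show "AE \<omega> in M. norm ((norm (vec_cond_exp M G f \<omega> - g \<omega>))\<^sup>2) \<le> (B + B)\<^sup>2"
      using g_bound cond_exp_selection_bounded[OF f]
    proof eventually_elim
      case (elim \<omega>)
      then have "norm (vec_cond_exp M G f \<omega> - g \<omega>) \<le> B + B"
        by (intro order_trans[OF norm_triangle_ineq4] add_mono)
      from power_mono[OF this, of 2] show ?case
        by simp
    qed
  qed measurable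
  define T where "T n = {f \<in> selections M F. J f \<le> 1 / real (Suc n)}" for n
  have T_mid: "(\<lambda>\<omega>. (1/2) *\<^sub>R f \<omega> + (1/2) *\<^sub>R h \<omega>) \<in> T n" if f: "f \<in> T n" and h: "h \<in> T n" for f h n
  proof -
    let ?u = "\<lambda>\<omega>. (1/2) *\<^sub>R f \<omega> + (1/2) *\<^sub>R h \<omega>"
    have f': "f \<in> selections M F" and h': "h \<in> selections M F"
      using f h by (auto simp: T_def)
    have u: "?u \<in> selections M F"
      by (intro selections_convex f' h') auto
    have "J ?u \<le> (\<integral>\<omega>. (1/2) * (norm (vec_cond_exp M G f \<omega> - g \<omega>))\<^sup>2 + (1/2) * (norm (vec_cond_exp M G h \<omega> - g \<omega>))\<^sup>2 \<partial>M)"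
      unfolding J_def
    proof (rule integral_mono_AE[OF J_int[OF u]])
      show "AE \<omega> in M. (norm (vec_cond_exp M G ?u \<omega> - g \<omega>))\<^sup>2 \<le>
          (1/2) * (norm (vec_cond_exp M G f \<omega> - g \<omega>))\<^sup>2 + (1/2) * (norm (vec_cond_exp M G h \<omega> - g \<omega>))\<^sup>2"
        using AE_vec_cond_exp_lincomb[OF selectionsD(1)[OF f'] selectionsD(1)[OF h'], of "1/2" "1/2"]
      proof eventually_elim
        case (elim \<omega>)
        define a where "a = vec_cond_exp M G f \<omega> - g \<omega>"
        define b where "b = vec_cond_exp M G h \<omega> - g \<omega>"
        have "(1/2) *\<^sub>R (a + b) = (1/2) *\<^sub>R vec_cond_exp M G f \<omega> + (1/2) *\<^sub>R vec_cond_exp M G h \<omega>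
            - ((1/2) *\<^sub>R g \<omega> + (1/2) *\<^sub>R g \<omega>)"
          by (simp add: a_def b_def algebra_simps)
        also have "(1/2) *\<^sub>R g \<omega> + (1/2) *\<^sub>R g \<omega> = g \<omega>"
          by (simp add: scaleR_add_left[symmetric])
        finally have "vec_cond_exp M G ?u \<omega> - g \<omega> = (1/2) *\<^sub>R (a + b)"
          using elim by simp
        moreover have "0 \<le> (norm (a - b))\<^sup>2"
          by simp
        ultimately show ?case
          unfolding a_def[symmetric] b_def[symmetric] power2_norm_eq_inner
          by (simp add: inner_add inner_diff inner_commute algebra_simps)
      qed
    qed (use J_int[OF f'] J_int[OF h'] in auto)
    also have "\<dots> = (1/2) * J f + (1/2) * J h"
      using J_int[OF f'] J_int[OF h'] by (simp add: J_def)
    also have "\<dots> \<le> 1 / real (Suc n)"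
      using f h by (simp add: T_def)
    finally show ?thesis
      using u by (simp add: T_def)
  qed
  have T_dec: "T (Suc n) \<subseteq> T n" for n
  proof -
    have "1 / real (Suc (Suc n)) \<le> 1 / real (Suc n)"
      by (intro divide_left_mono) auto
    then show ?thesis
      by (auto simp: T_def)
  qed
  have T_ne: "T n \<noteq> {}" for n
    using cond_exp_selections_dense[OF g gN, of "1 / real (Suc n)"] by (auto simp: T_def J_def)
  have T_sel: "f \<in> selections M F" if "f \<in> T n" for f n
    using that by (simp add: T_def)
  have "\<exists>f h. (\<forall>n. f n \<in> T n) \<and> h \<in> borel_measurable M \<and> (AE \<omega> in M. (\<lambda>n. f n \<omega>) \<longlonglongrightarrow> h \<omega>)"
  proof (rule nested_convex_AE_limit[of T B])
    show "f \<in> borel_measurable M" "AE \<omega> in M. norm (f \<omega>) \<le> B" if "f \<in> T n" for f n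
      using selectionsD[OF T_sel[OF that]] by auto
    fix f h
    assume "\<And>n. f n \<in> T n" "h \<in> borel_measurable M" "AE \<omega> in M. (\<lambda>n. f n \<omega>) \<longlonglongrightarrow> h \<omega>"
    then show ?thesis
      by (intro exI[of _ f] exI[of _ h]) simp
  qed (fact T_dec T_ne T_mid)+
  then obtain f h where f: "\<forall>n. f n \<in> T n" and h [measurable]: "h \<in> borel_measurable M"
    and lim: "AE \<omega> in M. (\<lambda>n. f n \<omega>) \<longlonglongrightarrow> h \<omega>"
    by (elim exE conjE) (rule that)
  have fS: "f n \<in> selections M F" and fJ: "J (f n) \<le> 1 / real (Suc n)" for n
    using spec[OF f, of n] by (auto simp: T_def)
  have "AE \<omega> in M. \<forall>n. f n \<omega> \<in> F \<omega>"
    using selectionsD(3)[OF fS] by (simp add: AE_all_countable)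
  then have "AE \<omega> in M. h \<omega> \<in> F \<omega>"
    using lim AE_space
  proof eventually_elim
    case (elim \<omega>)
    then have "closed (F \<omega>)"
      using F_Kkc_bdd by (auto simp: Kkc_bdd_iff compact_imp_closed)
    then show ?case
      using elim by (intro closed_sequentially[of "F \<omega>" "\<lambda>n. f n \<omega>" "h \<omega>"]) auto
  qed
  then have hS: "h \<in> selections M F"
    by (simp add: selections_iff)
  have "(\<integral>\<omega>\<in>A. h \<omega> \<partial>M) = (\<integral>\<omega>\<in>A. g \<omega> \<partial>M)" if A: "A \<in> sets G" for A
  proof -
    have A' [measurable]: "A \<in> sets M"
      by (rule sets_G[OF A])
    have [measurable]: "f n \<in> borel_measurable M" for n
      by (rule selectionsD(2)[OF fS])
    have "(\<lambda>n. \<integral>\<omega>\<in>A. f n \<omega> \<partial>M) \<longlonglongrightarrow> (\<integral>\<omega>\<in>A. h \<omega> \<partial>M)"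
      unfolding set_lebesgue_integral_def
    proof (rule integral_dominated_convergence)
      show "AE \<omega> in M. (\<lambda>n. indicator A \<omega> *\<^sub>R f n \<omega>) \<longlonglongrightarrow> indicator A \<omega> *\<^sub>R h \<omega>"
        using lim by eventually_elim (intro tendsto_intros)
      show "AE \<omega> in M. norm (indicator A \<omega> *\<^sub>R f n \<omega>) \<le> B" for n
        using selectionsD(4)[OF fS[of n]] by eventually_elim (use B_pos in \<open>auto simp: indicator_def\<close>)
    qed auto
    moreover have "(\<lambda>n. \<integral>\<omega>\<in>A. f n \<omega> \<partial>M) \<longlonglongrightarrow> (\<integral>\<omega>\<in>A. g \<omega> \<partial>M)"
    proof (rule LIM_zero_cancel, rule Lim_null_comparison)
      have bound: "norm ((\<integral>\<omega>\<in>A. f n \<omega> \<partial>M) - (\<integral>\<omega>\<in>A. g \<omega> \<partial>M)) \<le> sqrt (1 / real (Suc n))" for n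
      proof -
        define c where "c = sqrt (1 / real (Suc n))"
        have c: "c > 0" "c\<^sup>2 = 1 / real (Suc n)"
          by (auto simp: c_def)
        let ?d = "\<lambda>\<omega>. vec_cond_exp M G (f n) \<omega> - g \<omega>"
        have d_int: "integrable M ?d"
          using g_int integrable_vec_cond_exp[OF selectionsD(1)[OF fS]] by auto
        have "(\<integral>\<omega>\<in>A. f n \<omega> \<partial>M) - (\<integral>\<omega>\<in>A. g \<omega> \<partial>M) = (\<integral>\<omega>\<in>A. vec_cond_exp M G (f n) \<omega> \<partial>M) - (\<integral>\<omega>\<in>A. g \<omega> \<partial>M)"
          by (simp add: set_integral_vec_cond_exp[OF selectionsD(1)[OF fS] A])
        also have "\<dots> = (\<integral>\<omega>. indicator A \<omega> *\<^sub>R ?d \<omega> \<partial>M)"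
          unfolding set_lebesgue_integral_def scaleR_diff_right
          by (intro Bochner_Integration.integral_diff[symmetric] integrable_mult_indicator A' g_int
              integrable_vec_cond_exp selectionsD(1)[OF fS])
        also have "norm \<dots> \<le> (\<integral>\<omega>. norm (indicator A \<omega> *\<^sub>R ?d \<omega>) \<partial>M)"
          by (rule integral_norm_bound)
        also have "\<dots> \<le> (\<integral>\<omega>. \<bar>norm (?d \<omega>)\<bar> \<partial>M)"
          using d_int by (intro integral_mono integrable_norm integrable_mult_indicator A')
            (auto simp: indicator_def)
        also have "\<dots> \<le> (J (f n) / c + c * measure M (space M)) / 2"
          unfolding J_def using c J_int[OF fS] by (intro integral_abs_le_integral_square) auto
        also have "\<dots> \<le> (c\<^sup>2 / c + c * 1) / 2"
          using c fJ[of n] by (intro divide_right_mono add_mono) (auto simp: prob_space)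
        also have "\<dots> = c"
          unfolding power2_eq_square using c(1) by simp
        finally show ?thesis
          by (simp add: c_def)
      qed
      show "\<forall>\<^sub>F n in sequentially. norm ((\<integral>\<omega>\<in>A. f n \<omega> \<partial>M) - (\<integral>\<omega>\<in>A. g \<omega> \<partial>M)) \<le> sqrt (1 / real (Suc n))"
        using bound by simp
      have "(\<lambda>n. sqrt (1 / real (Suc n))) \<longlonglongrightarrow> sqrt 0"
        by (intro tendsto_real_sqrt LIMSEQ_inverse_real_of_nat[unfolded inverse_eq_divide])
      then show "(\<lambda>n. sqrt (1 / real (Suc n))) \<longlonglongrightarrow> 0"
        by simp
    qed
    ultimately show ?thesis
      by (rule LIMSEQ_unique)
  qed
  with AE_eq_vec_cond_expI[OF selectionsD(1)[OF hS] g_int g] hS show ?thesis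
    by blast
qed

theorem mean_is_cond_aumann_mean: "is_cond_aumann_mean M G F N"
  unfolding is_cond_aumann_mean_def
proof (intro conjI ballI)
  show "N \<in> G \<rightarrow>\<^sub>M set_space closed_sets"
    by (rule measurable_set_space_mono[OF N_G Kkc_bdd_subset_closed_sets])
  fix g :: "'a \<Rightarrow> 'b" assume g: "g \<in> borel_measurable G"
  show "g \<in> selections M N \<longleftrightarrow> (\<exists>f\<in>selections M F. AE \<omega> in M. g \<omega> = vec_cond_exp M G f \<omega>)"
  proof
    assume "g \<in> selections M N"
    then show "\<exists>f\<in>selections M F. AE \<omega> in M. g \<omega> = vec_cond_exp M G f \<omega>"
      using selection_of_mean_is_cond_exp[OF g] by (simp add: selections_def)
  next
    assume "\<exists>f\<in>selections M F. AE \<omega> in M. g \<omega> = vec_cond_exp M G f \<omega>"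
    then obtain f where f: "f \<in> selections M F" and eq: "AE \<omega> in M. g \<omega> = vec_cond_exp M G f \<omega>"
      by blast
    have "AE \<omega> in M. g \<omega> \<in> N \<omega>"
      using cond_exp_selection_in_mean[OF f] eq by eventually_elim simp
    moreover have "integrable M g"
      using integrable_cong_AE[OF measurable_from_subalg[OF subalg g] borel_measurable_vec_cond_exp(2) eq]
        integrable_vec_cond_exp[OF selectionsD(1)[OF f]] by simp
    ultimately show "g \<in> selections M N"
      by (simp add: selections_def)
  qed
qed

text \<open>
  A random closed set is determined by its integrable selections as soon as it has one: truncating
  the members of a dense sequence of selections to bounded sets, and replacing them elsewhere by
  the integrable one, makes them integrable without losing density.
\<close>

theorem cond_aumann_mean_AE_unique:
  assumes A: "is_cond_aumann_mean M G F A"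
  shows "AE \<omega> in M. N \<omega> = A \<omega>"
proof -
  have A_G: "A \<in> G \<rightarrow>\<^sub>M set_space closed_sets"
    using A by (simp add: is_cond_aumann_mean_def)
  have sel_iff: "g \<in> selections M N \<longleftrightarrow> g \<in> selections M A" if "g \<in> borel_measurable G" for g
    using A mean_is_cond_aumann_mean that by (simp add: is_cond_aumann_mean_def)
  obtain c :: "nat \<Rightarrow> 'a \<Rightarrow> 'b" where c [measurable]: "\<And>k. c k \<in> borel_measurable G"
    and cN: "\<And>k \<omega>. \<omega> \<in> space G \<Longrightarrow> c k \<omega> \<in> N \<omega>"
    and c_dense: "\<And>\<omega> x e. \<omega> \<in> space G \<Longrightarrow> x \<in> N \<omega> \<Longrightarrow> e > 0 \<Longrightarrow> \<exists>k. dist (c k \<omega>) x < e"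
    by (rule dense_selections_exist[OF measurable_set_space_mono[OF N_G Kkc_bdd_subset_closed_sets]]) blast
  obtain a :: "nat \<Rightarrow> 'a \<Rightarrow> 'b" where a [measurable]: "\<And>k. a k \<in> borel_measurable G"
    and aA: "\<And>k \<omega>. \<omega> \<in> space G \<Longrightarrow> a k \<omega> \<in> A \<omega>"
    and a_dense: "\<And>\<omega> x e. \<omega> \<in> space G \<Longrightarrow> x \<in> A \<omega> \<Longrightarrow> e > 0 \<Longrightarrow> \<exists>k. dist (a k \<omega>) x < e"
    by (rule dense_selections_exist[OF A_G]) blast
  have c_norm: "norm (c k \<omega>) \<le> B" if "\<omega> \<in> space M" for k \<omega>
    using cN[of \<omega> k] N_Kkc_bdd[OF that] that by (intro norm_le_if_mem_Kkc_bdd) (auto simp: space_G)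
  have c_in_A: "AE \<omega> in M. c k \<omega> \<in> A \<omega>" for k
  proof -
    have "integrable M (c k)"
      using c_norm by (intro integrable_const_bound[where B = B] AE_I2 measurable_from_subalg[OF subalg c])
    then have "c k \<in> selections M N"
      using cN by (auto simp: selections_def space_G)
    then show ?thesis
      by (simp add: sel_iff) (simp add: selections_def)
  qed
  have a_in_N: "AE \<omega> in M. norm (a k \<omega>) \<le> real m \<longrightarrow> a k \<omega> \<in> N \<omega>" for k m
  proof -
    define b where "b \<omega> = (if norm (a k \<omega>) \<le> real m then a k \<omega> else c 0 \<omega>)" for \<omega>
    have b [measurable]: "b \<in> borel_measurable G"
      unfolding b_def by measurable
    have "integrable M b"
      using c_norm[of _ 0] by (intro integrable_const_bound[where B = "max (real m) B"] AE_I2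
          measurable_from_subalg[OF subalg b]) (auto simp: b_def le_max_iff_disj)
    moreover have "AE \<omega> in M. b \<omega> \<in> A \<omega>"
      using c_in_A[of 0] AE_space by eventually_elim (use aA in \<open>auto simp: b_def space_G\<close>)
    ultimately have "b \<in> selections M N"
      using sel_iff[OF b] by (simp add: selections_def)
    then have "AE \<omega> in M. b \<omega> \<in> N \<omega>"
      by (simp add: selections_def)
    then show ?thesis
      by eventually_elim (auto simp: b_def split: if_splits)
  qed
  have "AE \<omega> in M. \<forall>k. c k \<omega> \<in> A \<omega>"
    using c_in_A by (simp add: AE_all_countable)
  moreover have "AE \<omega> in M. \<forall>k m. norm (a k \<omega>) \<le> real m \<longrightarrow> a k \<omega> \<in> N \<omega>"
    unfolding AE_all_countable using a_in_N by blast
  ultimately show ?thesis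
    using AE_space
  proof eventually_elim
    case (elim \<omega>)
    have closed: "closed (N \<omega>)" "closed (A \<omega>)"
      using N_Kkc_bdd elim A_G by (auto simp: Kkc_bdd_iff compact_imp_closed measurable_set_space_iff closed_sets_def space_G)
    have aN: "a k \<omega> \<in> N \<omega>" for k
      using elim real_arch_simple[of "norm (a k \<omega>)"] by blast
    show ?case
    proof (intro equalityI subsetI)
      fix x assume "x \<in> N \<omega>"
      then have "x \<in> closure (A \<omega>)"
        using c_dense[of \<omega> x] elim unfolding closure_approachable space_G by blast
      then show "x \<in> A \<omega>"
        using closed by simp
    next
      fix x assume "x \<in> A \<omega>"
      then have "x \<in> closure (N \<omega>)"
        using a_dense[of \<omega> x] elim aN unfolding closure_approachable space_G by blast
      then show "x \<in> N \<omega>"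
        using closed by simp
    qed
  qed
qed

end

section \<open>The metric as an integral over the sphere\<close>

lemma sets_surface_measure [measurable_cong]:
  "sets (surface_measure :: 'e::euclidean_space measure) = sets (restrict_space borel (sphere 0 1))"
  by (simp add: surface_measure_def)

lemma space_surface_measure: "space (surface_measure :: 'e::euclidean_space measure) = sphere 0 1"
  by (simp add: surface_measure_def space_scale_measure space_restrict_space)

lemma measurable_sgn_sphere:
  "sgn \<in> restrict_space lborel (cball 0 1 - {0}) \<rightarrow>\<^sub>M restrict_space borel (sphere (0::'e::euclidean_space) 1)"
proof (rule measurable_restrict_space2)
  show "sgn \<in> space (restrict_space lborel (cball 0 1 - {0 :: 'e})) \<rightarrow> sphere 0 1"
    by (auto simp: space_restrict_space norm_sgn)
  have "(sgn :: 'e \<Rightarrow> 'e) \<in> borel_measurable lborel"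
    by simp
  then show "sgn \<in> borel_measurable (restrict_space lborel (cball 0 1 - {0 :: 'e}))"
    by (rule measurable_restrict_space1)
qed

lemma emeasure_surface_measure:
  fixes A :: "'e::euclidean_space set"
  assumes "A \<in> sets (restrict_space borel (sphere 0 1))"
  shows "emeasure surface_measure A = of_nat DIM('e) * emeasure lborel {x \<in> cball 0 1 - {0}. sgn x \<in> A}"
proof -
  have "emeasure (distr (restrict_space lborel (cball 0 1 - {0})) (restrict_space borel (sphere 0 1)) sgn) A =
      emeasure (restrict_space lborel (cball 0 1 - {0})) (sgn -` A \<inter> space (restrict_space lborel (cball 0 1 - {0})))"
    by (rule emeasure_distr[OF measurable_sgn_sphere assms])
  also have "\<dots> = emeasure lborel (sgn -` A \<inter> (cball 0 1 - {0}))"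
    by (subst emeasure_restrict_space) (auto simp: space_restrict_space)
  also have "sgn -` A \<inter> (cball 0 1 - {0}) = {x \<in> cball 0 1 - {0}. sgn x \<in> A}"
    by auto
  finally show ?thesis
    by (simp add: surface_measure_def)
qed

interpretation surface: finite_measure "surface_measure :: 'e::euclidean_space measure"
proof
  have "sphere 0 1 \<in> sets (restrict_space borel (sphere (0::'e) 1))"
    by (metis sets.top space_restrict_space space_borel Int_UNIV_right)
  then have "emeasure surface_measure (sphere (0::'e) 1) \<le> of_nat DIM('e) * emeasure lborel (cball (0::'e) 1)"
    by (subst emeasure_surface_measure) (auto intro!: mult_left_mono emeasure_mono)
  also have "\<dots> < \<infinity>"
    using emeasure_lborel_cball_finite[of "0::'e" 1] by (simp add: ennreal_mult_less_top of_nat_less_top)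
  finally show "emeasure (surface_measure :: 'e measure) (space surface_measure) \<noteq> \<infinity>"
    by (simp add: space_surface_measure)
qed

lemma measurable_ident_surface: "(\<lambda>p. p) \<in> surface_measure \<rightarrow>\<^sub>M (borel :: 'e::euclidean_space measure)"
proof -
  have "(\<lambda>p. p) \<in> restrict_space borel (sphere (0::'e) 1) \<rightarrow>\<^sub>M borel"
    by (rule measurable_restrict_space1) simp
  then show ?thesis
    by (simp cong: measurable_cong_sets add: measurable_cong_sets[OF sets_surface_measure refl])
qed

lemma measurable_support_fun_direction [measurable]:
  assumes "K \<in> Kkc_bdd B"
  shows "(\<lambda>p. support_fun p K) \<in> borel_measurable surface_measure"
proof -
  have "(\<lambda>p. support_fun p K) \<in> borel_measurable borel"
    by (intro borel_measurable_continuous_onI continuous_on_support_fun[OF assms] continuous_intros)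
  from measurable_compose[OF measurable_ident_surface this] show ?thesis .
qed

lemma support_fun_diff_sq_le:
  assumes K: "K \<in> Kkc_bdd B" "L \<in> Kkc_bdd B" and p: "norm p = 1"
  shows "(support_fun p K - support_fun p L)\<^sup>2 \<le> (2 * B)\<^sup>2"
proof -
  have "\<bar>support_fun p K - support_fun p L\<bar> \<le> 2 * B"
    using support_fun_bound[OF K(1), of p] support_fun_bound[OF K(2), of p] p by simp
  from power_mono[OF this, of 2] show ?thesis
    by simp
qed

lemma integrable_support_fun_diff_sq:
  fixes K L :: "'e::euclidean_space set"
  assumes K: "K \<in> Kkc_bdd B" "L \<in> Kkc_bdd B"
  shows "integrable surface_measure (\<lambda>p. (support_fun p K - support_fun p L)\<^sup>2)"
proof (rule surface.integrable_const_bound)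
  show "AE p in surface_measure. norm ((support_fun p K - support_fun p L)\<^sup>2) \<le> (2 * B)\<^sup>2"
    using support_fun_diff_sq_le[OF K] by (intro AE_I2) (simp add: space_surface_measure)
  note [measurable] = measurable_support_fun_direction[OF K(1)] measurable_support_fun_direction[OF K(2)]
  show "(\<lambda>p. (support_fun p K - support_fun p L)\<^sup>2) \<in> borel_measurable surface_measure"
    by measurable
qed

lemma d_kc_sq: "(d_kc K L)\<^sup>2 = (\<integral>p. (support_fun p K - support_fun p L)\<^sup>2 \<partial>surface_measure)"
  by (simp add: d_kc_def)

lemma d_kc_nonneg: "d_kc K L \<ge> 0"
  by (simp add: d_kc_def)

lemma d_kc_self: "d_kc K K = 0"
  by (simp add: d_kc_def)

text \<open>
  The surface measure has full support, because the cone over a relatively open part of the sphere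
  contains a nonempty open set. Hence support functions at distance zero agree everywhere.
\<close>

lemma d_kc_eq_0D:
  fixes K L :: "'e::euclidean_space set"
  assumes K: "K \<in> Kkc_bdd B" "L \<in> Kkc_bdd B" and "d_kc K L = 0"
  shows "K = L"
proof (rule Kkc_bdd_eqI[OF K])
  define U where "U = {x \<in> ball 0 1 - {0}. support_fun (sgn x) K \<noteq> support_fun (sgn x) L}"
  define A where "A = {p \<in> space surface_measure. support_fun p K \<noteq> support_fun p L}"
  note [measurable] = measurable_support_fun_direction[OF K(1)] measurable_support_fun_direction[OF K(2)]
  have A: "A \<in> sets surface_measure"
    unfolding A_def by measurable
  have "(\<integral>p. (support_fun p K - support_fun p L)\<^sup>2 \<partial>surface_measure) = 0"
    using \<open>d_kc K L = 0\<close> d_kc_sq[of K L] by simp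
  then have "AE p in surface_measure. (support_fun p K - support_fun p L)\<^sup>2 = 0"
    using integral_nonneg_eq_0_iff_AE[OF integrable_support_fun_diff_sq[OF K]] by simp
  then have "AE p in surface_measure. p \<notin> A"
    by eventually_elim (simp add: A_def)
  then have "emeasure surface_measure A = 0"
    using AE_iff_null_sets[OF A] by (auto dest: null_setsD1)
  then have "emeasure lborel {x \<in> cball 0 1 - {0}. sgn x \<in> A} = 0"
    using A emeasure_surface_measure[of A] by (simp add: sets_surface_measure)
  moreover have "U \<subseteq> {x \<in> cball 0 1 - {0}. sgn x \<in> A}"
    by (auto simp: U_def A_def space_surface_measure norm_sgn)
  moreover have "{x \<in> cball 0 1 - {0}. sgn x \<in> A} \<in> sets lborel"
  proof -
    have "sgn -` A \<inter> space (restrict_space lborel (cball 0 1 - {0})) \<in> sets (restrict_space lborel (cball 0 1 - {0}))"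
      using A by (intro measurable_sets[OF measurable_sgn_sphere]) (simp add: sets_surface_measure)
    then have "sgn -` A \<inter> (cball 0 1 - {0}) \<in> sets (restrict_space lborel (cball 0 1 - {0}))"
      by (simp add: space_restrict_space)
    then have "sgn -` A \<inter> (cball 0 1 - {0}) \<in> sets lborel"
      by (subst (asm) sets_restrict_space_iff) auto
    also have "sgn -` A \<inter> (cball 0 1 - {0}) = {x \<in> cball 0 1 - {0}. sgn x \<in> A}"
      by auto
    finally show ?thesis .
  qed
  ultimately have "emeasure lborel U = 0"
    by (metis emeasure_mono le_zero_eq)
  moreover have "open U"
  proof -
    have "continuous_on (ball 0 1 - {0}) (\<lambda>x. support_fun (sgn x) K - support_fun (sgn x) L)"
      by (intro continuous_on_diff continuous_on_support_fun[OF K(1)] continuous_on_support_fun[OF K(2)]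
          continuous_on_sgn continuous_on_id) auto
    then have "open ((\<lambda>x. support_fun (sgn x) K - support_fun (sgn x) L) -` (- {0}) \<inter> (ball 0 1 - {0}))"
      by (subst (asm) continuous_on_open_vimage) (auto simp: open_Compl)
    also have "(\<lambda>x. support_fun (sgn x) K - support_fun (sgn x) L) -` (- {0}) \<inter> (ball 0 1 - {0}) = U"
      by (auto simp: U_def)
    finally show ?thesis .
  qed
  ultimately have "U \<in> null_sets lborel"
    by (auto simp: null_sets_def)
  then have "negligible U"
    by (simp add: negligible_iff_null_sets null_sets_completionI)
  with \<open>open U\<close> have "U = {}"
    using open_not_negligible by blast
  fix p :: 'e assume p: "norm p = 1"
  have "(1/2) *\<^sub>R p \<in> ball 0 1 - {0}" "sgn ((1/2) *\<^sub>R p) = p"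
    using p by (auto simp: sgn_scaleR sgn_div_norm)
  moreover have "support_fun (sgn x) K = support_fun (sgn x) L" if "x \<in> ball 0 1 - {0}" for x
    using \<open>U = {}\<close> that unfolding U_def by blast
  ultimately show "support_fun p K = support_fun p L"
    by metis
qed

text \<open>
  A modulus of continuity for the squared distance to a fixed set: factor the difference of
  squares in each direction, bound one factor by \<open>4 * B\<close> and average the other.
\<close>

lemma d_kc_sq_diff_le:
  fixes K L L' :: "'e::euclidean_space set"
  assumes K: "K \<in> Kkc_bdd B" "L \<in> Kkc_bdd B" "L' \<in> Kkc_bdd B" and \<eta>: "\<eta> > 0"
  shows "\<bar>(d_kc L' K)\<^sup>2 - (d_kc L K)\<^sup>2\<bar> \<le>
    2 * B * ((d_kc L' L)\<^sup>2 / \<eta> + \<eta> * measure surface_measure (space (surface_measure :: 'e measure)))"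
proof -
  let ?S = "surface_measure :: 'e measure"
  let ?k = "\<lambda>p. support_fun p K" and ?l = "\<lambda>p. support_fun p L" and ?m = "\<lambda>p. support_fun p L'"
  note [measurable] = measurable_support_fun_direction[OF K(1)] measurable_support_fun_direction[OF K(2)]
    measurable_support_fun_direction[OF K(3)]
  have "K \<noteq> {}" "K \<subseteq> cball 0 B"
    using K(1) by (auto simp: Kkc_bdd_iff)
  then have "B \<ge> 0"
    by (metis cball_empty linorder_not_less subset_empty)
  have bound: "\<bar>?k p\<bar> \<le> B" "\<bar>?l p\<bar> \<le> B" "\<bar>?m p\<bar> \<le> B" if "p \<in> space ?S" for p
    using support_fun_bound[OF K(1), of p] support_fun_bound[OF K(2), of p] support_fun_bound[OF K(3), of p] that
    by (auto simp: space_surface_measure)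
  have int: "integrable ?S (\<lambda>p. \<bar>?m p - ?l p\<bar>)"
  proof (rule surface.integrable_const_bound[where B = "2 * B"])
    show "AE p in ?S. norm \<bar>?m p - ?l p\<bar> \<le> 2 * B"
    proof (rule AE_I2)
      fix p assume "p \<in> space ?S"
      from bound[OF this] show "norm \<bar>?m p - ?l p\<bar> \<le> 2 * B"
        by simp
    qed
  qed measurable
  have "(d_kc L' K)\<^sup>2 - (d_kc L K)\<^sup>2 = (\<integral>p. (?m p - ?k p)\<^sup>2 - (?l p - ?k p)\<^sup>2 \<partial>?S)"
    unfolding d_kc_sq
    by (intro Bochner_Integration.integral_diff[symmetric] integrable_support_fun_diff_sq[OF K(3,1)]
        integrable_support_fun_diff_sq[OF K(2,1)])
  also have "\<bar>\<dots>\<bar> \<le> (\<integral>p. \<bar>(?m p - ?k p)\<^sup>2 - (?l p - ?k p)\<^sup>2\<bar> \<partial>?S)"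
    by (rule integral_abs_bound)
  also have "\<dots> \<le> (\<integral>p. 4 * B * \<bar>?m p - ?l p\<bar> \<partial>?S)"
  proof (rule integral_mono)
    show "integrable ?S (\<lambda>p. \<bar>(?m p - ?k p)\<^sup>2 - (?l p - ?k p)\<^sup>2\<bar>)"
      by (intro integrable_abs Bochner_Integration.integrable_diff integrable_support_fun_diff_sq[OF K(3,1)]
          integrable_support_fun_diff_sq[OF K(2,1)])
    show "integrable ?S (\<lambda>p. 4 * B * \<bar>?m p - ?l p\<bar>)"
      using int by simp
    fix p assume p: "p \<in> space ?S"
    have "(?m p - ?k p)\<^sup>2 - (?l p - ?k p)\<^sup>2 = (?m p + ?l p - 2 * ?k p) * (?m p - ?l p)"
      by (simp add: power2_eq_square algebra_simps)
    moreover have "\<bar>?m p + ?l p - 2 * ?k p\<bar> \<le> 4 * B"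
      using bound[OF p] by simp
    ultimately show "\<bar>(?m p - ?k p)\<^sup>2 - (?l p - ?k p)\<^sup>2\<bar> \<le> 4 * B * \<bar>?m p - ?l p\<bar>"
      by (simp add: abs_mult mult_right_mono)
  qed
  also have "\<dots> = 4 * B * (\<integral>p. \<bar>?m p - ?l p\<bar> \<partial>?S)"
    by simp
  also have "\<dots> \<le> 4 * B * (((d_kc L' L)\<^sup>2 / \<eta> + \<eta> * measure ?S (space ?S)) / 2)"
    unfolding d_kc_sq using \<eta> \<open>B \<ge> 0\<close> integrable_support_fun_diff_sq[OF K(3,2)]
    by (intro mult_left_mono surface.integral_abs_le_integral_square) auto
  finally show ?thesis
    by simp
qed

text \<open>
  Polytopes with vertices in a countable dense subset of the ball approximate every set of the
  family: replace the set by the hull of the centres of a finite cover by small balls.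
\<close>

lemma Kkc_bdd_separable:
  obtains \<C> :: "'e::euclidean_space set set" where "countable \<C>" "\<C> \<subseteq> Kkc_bdd B"
    "\<And>\<nu> \<delta>. \<nu> \<in> Kkc_bdd B \<Longrightarrow> \<delta> > 0 \<Longrightarrow> \<exists>\<nu>'\<in>\<C>. d_kc \<nu>' \<nu> < \<delta>"
proof -
  obtain Q :: "'e set" where Q: "countable Q" "Q \<subseteq> cball 0 B" "cball 0 B \<subseteq> closure Q"
    by (rule separable)
  define \<C> where "\<C> = (hull) convex ` {X. finite X \<and> X \<subseteq> Q} - {{}}"
  have hull_Kkc: "convex hull X \<in> Kkc_bdd B" if "finite X" "X \<subseteq> Q" "X \<noteq> {}" for X
    using that Q(2) hull_minimal[of X "cball 0 B" convex]
    by (auto simp: Kkc_bdd_iff convex_convex_hull finite_imp_compact_convex_hull)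
  have dense: "\<exists>\<nu>'\<in>\<C>. d_kc \<nu>' \<nu> < \<delta>" if \<nu>: "\<nu> \<in> Kkc_bdd B" and \<delta>: "\<delta> > 0" for \<nu> \<delta>
  proof -
    let ?S = "surface_measure :: 'e measure"
    define \<mu> where "\<mu> = measure ?S (space ?S)"
    have \<mu>: "\<mu> \<ge> 0"
      by (simp add: \<mu>_def)
    \<comment> \<open>Support functions within \<open>e\<close> of each other give distance at most \<open>sqrt \<mu> * e < \<delta>\<close>.\<close>
    define e where "e = \<delta> / (\<mu> + 1)"
    have e: "e > 0"
      using \<delta> \<mu> by (simp add: e_def)
    have "compact \<nu>" "\<nu> \<noteq> {}" "\<nu> \<subseteq> cball 0 B"
      using \<nu> by (auto simp: Kkc_bdd_iff)
    have "\<nu> \<subseteq> (\<Union>q\<in>Q. ball q e)"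
    proof
      fix x assume "x \<in> \<nu>"
      then have "x \<in> closure Q"
        using Q(3) \<open>\<nu> \<subseteq> cball 0 B\<close> by blast
      then obtain q where "q \<in> Q" "dist q x < e"
        using e by (auto simp: closure_approachable)
      then show "x \<in> (\<Union>q\<in>Q. ball q e)"
        by auto
    qed
    then obtain Y where Y: "Y \<subseteq> Q" "finite Y" "\<nu> \<subseteq> (\<Union>q\<in>Y. ball q e)"
      using compactE_image[OF \<open>compact \<nu>\<close>, of Q "\<lambda>q. ball q e"] by auto
    define X where "X = {q \<in> Y. ball q e \<inter> \<nu> \<noteq> {}}"
    have X: "finite X" "X \<subseteq> Q" "\<nu> \<subseteq> (\<Union>q\<in>X. ball q e)"
    proof -
      show "\<nu> \<subseteq> (\<Union>q\<in>X. ball q e)"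
      proof
        fix x assume "x \<in> \<nu>"
        moreover then obtain q where q: "q \<in> Y" "x \<in> ball q e"
          using Y(3) by blast
        ultimately have "q \<in> X"
          unfolding X_def by blast
        with q(2) show "x \<in> (\<Union>q\<in>X. ball q e)"
          by blast
      qed
    qed (use Y in \<open>auto simp: X_def\<close>)
    have "X \<noteq> {}"
      using X(3) \<open>\<nu> \<noteq> {}\<close> by auto
    note L = hull_Kkc[OF X(1,2) this]
    have close: "\<bar>support_fun p (convex hull X) - support_fun p \<nu>\<bar> \<le> e" if p: "norm p = 1" for p
    proof -
      have near: "p \<bullet> a \<le> p \<bullet> b + e" if "dist a b < e" for a b
        using norm_cauchy_schwarz[of p "a - b"] that p by (simp add: dist_norm inner_diff_right)
      have "support_fun p \<nu> \<le> support_fun p (convex hull X) + e"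
      proof (rule support_fun_le[OF \<open>\<nu> \<noteq> {}\<close>])
        fix x assume "x \<in> \<nu>"
        then obtain q where q: "q \<in> X" "dist x q < e"
          using X(3) by (auto simp: dist_commute)
        then have "p \<bullet> q \<le> support_fun p (convex hull X)"
          using L hull_subset[of X convex] by (intro inner_le_support_fun) (auto simp: Kkc_bdd_iff)
        with near[OF q(2)] show "p \<bullet> x \<le> support_fun p (convex hull X) + e"
          by simp
      qed
      moreover have "X \<subseteq> {y. p \<bullet> y \<le> support_fun p \<nu> + e}"
      proof
        fix q assume "q \<in> X"
        then obtain x where x: "x \<in> \<nu>" "dist q x < e"
          by (auto simp: X_def)
        then show "q \<in> {y. p \<bullet> y \<le> support_fun p \<nu> + e}"
          using near[OF x(2)] inner_le_support_fun[OF \<open>compact \<nu>\<close> x(1), of p] by simp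
      qed
      then have "convex hull X \<subseteq> {y. p \<bullet> y \<le> support_fun p \<nu> + e}"
        by (intro hull_minimal convex_halfspace_le)
      then have "support_fun p (convex hull X) \<le> support_fun p \<nu> + e"
        using L by (intro support_fun_le) (auto simp: Kkc_bdd_iff)
      ultimately show ?thesis
        by simp
    qed
    have "(d_kc (convex hull X) \<nu>)\<^sup>2 \<le> (\<integral>p. e\<^sup>2 \<partial>?S)"
      unfolding d_kc_sq
    proof (rule integral_mono[OF integrable_support_fun_diff_sq[OF L \<nu>]])
      fix p assume "p \<in> space ?S"
      then have "\<bar>support_fun p (convex hull X) - support_fun p \<nu>\<bar> \<le> e"
        using close by (simp add: space_surface_measure)
      from power_mono[OF this, of 2] show "(support_fun p (convex hull X) - support_fun p \<nu>)\<^sup>2 \<le> e\<^sup>2"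
        by simp
    qed simp
    also have "\<dots> = \<mu> * e\<^sup>2"
      by (simp add: \<mu>_def)
    also have "\<dots> < (\<mu> + 1)\<^sup>2 * e\<^sup>2"
      using e \<mu> by (intro mult_strict_right_mono) (auto simp: power2_eq_square algebra_simps add_nonneg_pos intro: less_le_trans[of _ "\<mu> + 1"])
    also have "\<dots> = \<delta>\<^sup>2"
      using \<mu> by (simp add: e_def power_divide)
    finally have "d_kc (convex hull X) \<nu> < \<delta>"
      using \<delta> by (simp add: power_less_imp_less_base)
    moreover have "convex hull X \<in> \<C>"
      using X \<open>X \<noteq> {}\<close> by (auto simp: \<C>_def)
    ultimately show ?thesis
      by blast
  qed
  have countable: "countable \<C>"
    unfolding \<C>_def using Q(1) by (intro countable_Diff countable_image countable_Collect_finite_subset)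
  have "\<C> \<subseteq> Kkc_bdd B"
  proof
    fix L assume "L \<in> \<C>"
    then obtain X where "finite X" "X \<subseteq> Q" "L = convex hull X" "L \<noteq> {}"
      unfolding \<C>_def by blast
    moreover from this have "X \<noteq> {}"
      by auto
    ultimately show "L \<in> Kkc_bdd B"
      using hull_Kkc by blast
  qed
  from that[OF countable this dense] show thesis .
qed

section \<open>The conditional Frechet mean\<close>

lemma measurable_const_set: "\<nu> \<in> C \<Longrightarrow> (\<lambda>_. \<nu>) \<in> M \<rightarrow>\<^sub>M set_space C"
  by (simp add: measurable_set_space_iff)

lemma measurable_support_fun_pair:
  fixes K :: "'a \<Rightarrow> 'e::euclidean_space set"
  assumes K: "K \<in> M \<rightarrow>\<^sub>M set_space (Kkc_bdd B)"
  shows "(\<lambda>(\<omega>, p). support_fun p (K \<omega>)) \<in> borel_measurable (M \<Otimes>\<^sub>M surface_measure)"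
proof -
  have "(\<lambda>x. support_fun (snd x) (K (fst x))) \<in> borel_measurable (M \<Otimes>\<^sub>M (surface_measure :: 'e measure))"
    by (intro measurable_support_fun[OF measurable_compose[OF measurable_fst K]]
        measurable_compose[OF measurable_snd measurable_ident_surface])
  then show ?thesis
    by (simp add: case_prod_beta')
qed

lemma borel_measurable_d_kc_sq:
  fixes K L :: "'a \<Rightarrow> 'e::euclidean_space set"
  assumes K: "K \<in> M \<rightarrow>\<^sub>M set_space (Kkc_bdd B)" and L: "L \<in> M \<rightarrow>\<^sub>M set_space (Kkc_bdd B)"
  shows "(\<lambda>\<omega>. (d_kc (K \<omega>) (L \<omega>))\<^sup>2) \<in> borel_measurable M"
  unfolding d_kc_sq
proof (rule surface.borel_measurable_lebesgue_integral)
  note [measurable] = measurable_support_fun_pair[OF K] measurable_support_fun_pair[OF L]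
  show "(\<lambda>(\<omega>, p). (support_fun p (K \<omega>) - support_fun p (L \<omega>))\<^sup>2) \<in> borel_measurable (M \<Otimes>\<^sub>M surface_measure)"
    by measurable
qed

context random_convex_set
begin

lemma Fubini_d_kc:
  assumes K: "K \<in> M \<rightarrow>\<^sub>M set_space (Kkc_bdd B)" and L: "L \<in> M \<rightarrow>\<^sub>M set_space (Kkc_bdd B)" and A [measurable]: "A \<in> sets M"
  defines "\<phi> \<equiv> \<lambda>\<omega> p :: 'e. indicator A \<omega> * (support_fun p (K \<omega>) - support_fun p (L \<omega>))\<^sup>2"
  shows "integrable M (\<lambda>\<omega>. (d_kc (K \<omega>) (L \<omega>))\<^sup>2)"
    and "integrable surface_measure (\<lambda>p. \<integral>\<omega>. \<phi> \<omega> p \<partial>M)"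
    and "(\<integral>\<omega>\<in>A. (d_kc (K \<omega>) (L \<omega>))\<^sup>2 \<partial>M) = (\<integral>p. (\<integral>\<omega>. \<phi> \<omega> p \<partial>M) \<partial>surface_measure)"
proof -
  let ?S = "surface_measure :: 'e measure"
  interpret pair: pair_sigma_finite M ?S ..
  have KL: "K \<omega> \<in> Kkc_bdd B" "L \<omega> \<in> Kkc_bdd B" if "\<omega> \<in> space M" for \<omega>
    using K L that by (auto simp: measurable_set_space_iff)
  note [measurable] = measurable_support_fun_pair[OF K] measurable_support_fun_pair[OF L]
  have bound: "(support_fun p (K \<omega>) - support_fun p (L \<omega>))\<^sup>2 \<le> (2 * B)\<^sup>2"
    if "\<omega> \<in> space M" "p \<in> space ?S" for \<omega> p
    using support_fun_diff_sq_le[OF KL[OF that(1)], of p] that(2) by (simp add: space_surface_measure)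
  have fin: "finite_measure (M \<Otimes>\<^sub>M ?S)"
    by (rule finite_measure_pair_measure) unfold_locales
  have int: "integrable (M \<Otimes>\<^sub>M ?S) (\<lambda>(\<omega>, p). indicator A \<omega> * (support_fun p (K \<omega>) - support_fun p (L \<omega>))\<^sup>2)"
    if [measurable]: "A \<in> sets M" for A
  proof (rule finite_measure.integrable_const_bound[OF fin])
    show "AE x in M \<Otimes>\<^sub>M ?S. norm (case x of (\<omega>, p) \<Rightarrow> indicator A \<omega> * (support_fun p (K \<omega>) - support_fun p (L \<omega>))\<^sup>2) \<le> (2 * B)\<^sup>2"
      using bound by (intro AE_I2) (auto simp: space_pair_measure indicator_def)
  qed measurable
  have slice: "(\<integral>p. indicator A \<omega> * (support_fun p (K \<omega>) - support_fun p (L \<omega>))\<^sup>2 \<partial>?S) = indicator A \<omega> * (d_kc (K \<omega>) (L \<omega>))\<^sup>2" for A \<omega>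
    by (simp add: d_kc_sq)
  have "integrable M (\<lambda>\<omega>. indicator (space M) \<omega> * (d_kc (K \<omega>) (L \<omega>))\<^sup>2)"
    using pair.integrable_fst'[OF int[OF sets.top]] by (simp add: d_kc_sq)
  then show "integrable M (\<lambda>\<omega>. (d_kc (K \<omega>) (L \<omega>))\<^sup>2)"
    by (rule Bochner_Integration.integrable_cong[THEN iffD1, rotated -1]) auto
  show "integrable ?S (\<lambda>p. \<integral>\<omega>. \<phi> \<omega> p \<partial>M)"
    unfolding \<phi>_def using pair.integrable_snd[OF int[OF A]] .
  have "(\<integral>\<omega>\<in>A. (d_kc (K \<omega>) (L \<omega>))\<^sup>2 \<partial>M) = (\<integral>\<omega>. (\<integral>p. \<phi> \<omega> p \<partial>?S) \<partial>M)"
    unfolding \<phi>_def slice by (simp add: set_lebesgue_integral_def)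
  also have "\<dots> = (\<integral>p. (\<integral>\<omega>. \<phi> \<omega> p \<partial>M) \<partial>?S)"
    unfolding \<phi>_def by (rule pair.Fubini_integral[OF int[OF A], symmetric])
  finally show "(\<integral>\<omega>\<in>A. (d_kc (K \<omega>) (L \<omega>))\<^sup>2 \<partial>M) = (\<integral>p. (\<integral>\<omega>. \<phi> \<omega> p \<partial>M) \<partial>?S)" .
qed

end

context random_convex_set_mean
begin

text \<open>
  The conditional bias-variance decomposition. For a fixed direction it is the usual orthogonality
  of \<open>support_fun p (F \<omega>) - support_fun p (N \<omega>)\<close> to \<open>G\<close>-measurable functions; integrating over the
  sphere gives it for the metric. Working with integrals over events avoids a simultaneous choice
  of null sets for all directions.
\<close>

lemma set_integral_d_kc_decomposition:
  assumes \<nu>: "\<nu> \<in> Kkc_bdd B" and A: "A \<in> sets G"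
  shows "(\<integral>\<omega>\<in>A. (d_kc \<nu> (F \<omega>))\<^sup>2 \<partial>M) = (\<integral>\<omega>\<in>A. (d_kc \<nu> (N \<omega>))\<^sup>2 \<partial>M) + (\<integral>\<omega>\<in>A. (d_kc (N \<omega>) (F \<omega>))\<^sup>2 \<partial>M)"
proof -
  note A' [measurable] = sets_G[OF A]
  note \<nu>' = measurable_const_set[OF \<nu>, of M]
  let ?s = "\<lambda>p :: 'b. \<lambda>K. support_fun p K"
  have [measurable]: "(\<lambda>\<omega>. ?s p (N \<omega>)) \<in> borel_measurable M" for p
    by (rule measurable_support_fun[OF N_M]) simp
  have int: "integrable M (\<lambda>\<omega>. indicator A \<omega> * (?s p (K \<omega>) - ?s p (L \<omega>))\<^sup>2)"
    if p: "norm p = 1" and K: "K \<in> M \<rightarrow>\<^sub>M set_space (Kkc_bdd B)" and L: "L \<in> M \<rightarrow>\<^sub>M set_space (Kkc_bdd B)" for p K L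
  proof (rule integrable_const_bound)
    have [measurable]: "(\<lambda>\<omega>. ?s p (K \<omega>)) \<in> borel_measurable M" "(\<lambda>\<omega>. ?s p (L \<omega>)) \<in> borel_measurable M"
      using K L by (auto intro: measurable_support_fun)
    show "(\<lambda>\<omega>. indicator A \<omega> * (?s p (K \<omega>) - ?s p (L \<omega>))\<^sup>2) \<in> borel_measurable M"
      by measurable
    show "AE \<omega> in M. norm (indicator A \<omega> * (?s p (K \<omega>) - ?s p (L \<omega>))\<^sup>2) \<le> (2 * B)\<^sup>2"
    proof (rule AE_I2)
      fix \<omega> assume "\<omega> \<in> space M"
      then have "(?s p (K \<omega>) - ?s p (L \<omega>))\<^sup>2 \<le> (2 * B)\<^sup>2"
        using K L p by (intro support_fun_diff_sq_le) (auto simp: measurable_set_space_iff)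
      then show "norm (indicator A \<omega> * (?s p (K \<omega>) - ?s p (L \<omega>))\<^sup>2) \<le> (2 * B)\<^sup>2"
        by (auto simp: indicator_def)
    qed
  qed
  have pointwise: "(\<integral>\<omega>. indicator A \<omega> * (?s p \<nu> - ?s p (F \<omega>))\<^sup>2 \<partial>M) =
      (\<integral>\<omega>. indicator A \<omega> * (?s p \<nu> - ?s p (N \<omega>))\<^sup>2 \<partial>M) + (\<integral>\<omega>. indicator A \<omega> * (?s p (N \<omega>) - ?s p (F \<omega>))\<^sup>2 \<partial>M)"
    if p: "norm p = 1" for p
  proof -
    define h where "h \<omega> = indicator A \<omega> * (?s p \<nu> - ?s p (N \<omega>))" for \<omega>
    have h [measurable]: "h \<in> borel_measurable G"
      unfolding h_def using A by measurable
    have hM [measurable]: "h \<in> borel_measurable M"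
      by (rule measurable_from_subalg[OF subalg h])
    have h_bound: "\<bar>h \<omega>\<bar> \<le> 2 * B" if "\<omega> \<in> space M" for \<omega>
      using support_fun_bound[OF \<nu>, of p] support_fun_bound[OF N_Kkc_bdd[OF that], of p] p B_pos
      by (auto simp: h_def indicator_def)
    have h_int: "integrable M (\<lambda>\<omega>. h \<omega> * ?s p (K \<omega>))" if K: "K \<in> M \<rightarrow>\<^sub>M set_space (Kkc_bdd B)" for K
    proof (rule integrable_const_bound)
      have [measurable]: "(\<lambda>\<omega>. ?s p (K \<omega>)) \<in> borel_measurable M"
        using K by (auto intro: measurable_support_fun)
      show "(\<lambda>\<omega>. h \<omega> * ?s p (K \<omega>)) \<in> borel_measurable M"
        by measurable
      show "AE \<omega> in M. norm (h \<omega> * ?s p (K \<omega>)) \<le> 2 * B * B"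
      proof (rule AE_I2)
        fix \<omega> assume \<omega>: "\<omega> \<in> space M"
        then have "\<bar>?s p (K \<omega>)\<bar> \<le> B"
          using K support_fun_bound[of "K \<omega>" B p] p by (auto simp: measurable_set_space_iff)
        then show "norm (h \<omega> * ?s p (K \<omega>)) \<le> 2 * B * B"
          using h_bound[OF \<omega>] B_pos by (auto simp: abs_mult intro!: mult_mono)
      qed
    qed
    have "(\<integral>\<omega>. h \<omega> * ?s p (F \<omega>) \<partial>M) = (\<integral>\<omega>. h \<omega> * real_cond_exp M G (\<lambda>\<omega>. ?s p (F \<omega>)) \<omega> \<partial>M)"
      by (rule real_cond_exp_intg(2)[symmetric]) (use h_int[OF F] in auto)
    also have "\<dots> = (\<integral>\<omega>. h \<omega> * ?s p (N \<omega>) \<partial>M)"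
      by (rule integral_cong_AE) (use support_N[of p] in \<open>auto elim!: eventually_mono\<close>)
    finally have orthogonal: "(\<integral>\<omega>. h \<omega> * ?s p (F \<omega>) \<partial>M) = (\<integral>\<omega>. h \<omega> * ?s p (N \<omega>) \<partial>M)" .
    have "(\<integral>\<omega>. indicator A \<omega> * (?s p \<nu> - ?s p (F \<omega>))\<^sup>2 \<partial>M) =
        (\<integral>\<omega>. (indicator A \<omega> * (?s p \<nu> - ?s p (N \<omega>))\<^sup>2 + indicator A \<omega> * (?s p (N \<omega>) - ?s p (F \<omega>))\<^sup>2)
            + 2 * (h \<omega> * ?s p (N \<omega>) - h \<omega> * ?s p (F \<omega>)) \<partial>M)"
      by (intro Bochner_Integration.integral_cong refl) (simp add: h_def power2_eq_square algebra_simps)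
    also have "\<dots> = ((\<integral>\<omega>. indicator A \<omega> * (?s p \<nu> - ?s p (N \<omega>))\<^sup>2 \<partial>M) + (\<integral>\<omega>. indicator A \<omega> * (?s p (N \<omega>) - ?s p (F \<omega>))\<^sup>2 \<partial>M))
        + 2 * ((\<integral>\<omega>. h \<omega> * ?s p (N \<omega>) \<partial>M) - (\<integral>\<omega>. h \<omega> * ?s p (F \<omega>) \<partial>M))"
      using int[OF p \<nu>' N_M] int[OF p N_M F] h_int[OF F] h_int[OF N_M] by simp
    finally show ?thesis
      by (simp add: orthogonal)
  qed
  have "(\<integral>\<omega>\<in>A. (d_kc \<nu> (F \<omega>))\<^sup>2 \<partial>M) = (\<integral>p. (\<integral>\<omega>. indicator A \<omega> * (?s p \<nu> - ?s p (F \<omega>))\<^sup>2 \<partial>M) \<partial>surface_measure)"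
    by (rule Fubini_d_kc(3)[OF \<nu>' F A'])
  also have "\<dots> = (\<integral>p. (\<integral>\<omega>. indicator A \<omega> * (?s p \<nu> - ?s p (N \<omega>))\<^sup>2 \<partial>M) +
      (\<integral>\<omega>. indicator A \<omega> * (?s p (N \<omega>) - ?s p (F \<omega>))\<^sup>2 \<partial>M) \<partial>surface_measure)"
    by (intro Bochner_Integration.integral_cong refl pointwise) (simp add: space_surface_measure)
  also have "\<dots> = (\<integral>\<omega>\<in>A. (d_kc \<nu> (N \<omega>))\<^sup>2 \<partial>M) + (\<integral>\<omega>\<in>A. (d_kc (N \<omega>) (F \<omega>))\<^sup>2 \<partial>M)"
    unfolding Fubini_d_kc(3)[OF \<nu>' N_M A'] Fubini_d_kc(3)[OF N_M F A']
    by (rule Bochner_Integration.integral_add[OF Fubini_d_kc(2)[OF \<nu>' N_M A'] Fubini_d_kc(2)[OF N_M F A']])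
  finally show ?thesis .
qed

definition cond_variance :: "'a \<Rightarrow> real" where
  "cond_variance = real_cond_exp M G (\<lambda>\<omega>. (d_kc (N \<omega>) (F \<omega>))\<^sup>2)"

definition cond_objective :: "'b set \<Rightarrow> 'a \<Rightarrow> real" where
  "cond_objective \<nu> \<omega> = (d_kc \<nu> (N \<omega>))\<^sup>2 + cond_variance \<omega>"

lemma cond_frechet_objective: "is_cond_frechet_objective M G B F cond_objective"
  unfolding is_cond_frechet_objective_def
proof (intro conjI ballI allI impI)
  fix \<nu> :: "'b set" assume \<nu>: "\<nu> \<in> Kkc_bdd B"
  note \<nu>' = measurable_const_set[OF \<nu>, of M]
  have dN_meas [measurable]: "(\<lambda>\<omega>. (d_kc \<nu> (N \<omega>))\<^sup>2) \<in> borel_measurable G"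
    by (rule borel_measurable_d_kc_sq[OF measurable_const_set[OF \<nu>] N_G])
  have dN_int: "integrable M (\<lambda>\<omega>. (d_kc \<nu> (N \<omega>))\<^sup>2)" and dF_int: "integrable M (\<lambda>\<omega>. (d_kc \<nu> (F \<omega>))\<^sup>2)"
    and dNF_int: "integrable M (\<lambda>\<omega>. (d_kc (N \<omega>) (F \<omega>))\<^sup>2)"
    using Fubini_d_kc(1)[OF \<nu>' N_M sets.top] Fubini_d_kc(1)[OF \<nu>' F sets.top] Fubini_d_kc(1)[OF N_M F sets.top] by auto
  have V_int: "integrable M cond_variance"
    unfolding cond_variance_def by (rule real_cond_exp_int(1)[OF dNF_int])
  show meas: "cond_objective \<nu> \<in> borel_measurable G"
    unfolding cond_objective_def[abs_def] cond_variance_def by measurable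
  have "AE \<omega> in M. real_cond_exp M G (\<lambda>\<omega>. (d_kc \<nu> (F \<omega>))\<^sup>2) \<omega> = cond_objective \<nu> \<omega>"
  proof (rule real_cond_exp_charact[OF _ dF_int _ meas])
    show "integrable M (cond_objective \<nu>)"
      unfolding cond_objective_def[abs_def] using dN_int V_int by simp
    fix A assume A: "A \<in> sets G"
    have int: "set_integrable M A (\<lambda>\<omega>. (d_kc \<nu> (N \<omega>))\<^sup>2)" "set_integrable M A cond_variance"
      unfolding set_integrable_def by (intro integrable_mult_indicator sets_G[OF A] dN_int V_int)+
    have "(\<integral>\<omega>\<in>A. (d_kc (N \<omega>) (F \<omega>))\<^sup>2 \<partial>M) = (\<integral>\<omega>\<in>A. cond_variance \<omega> \<partial>M)"
      unfolding cond_variance_def by (rule real_cond_exp_intA[OF dNF_int A])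
    then show "(\<integral>\<omega>\<in>A. (d_kc \<nu> (F \<omega>))\<^sup>2 \<partial>M) = (\<integral>\<omega>\<in>A. cond_objective \<nu> \<omega> \<partial>M)"
      unfolding set_integral_d_kc_decomposition[OF \<nu> A] cond_objective_def set_integral_add(2)[OF int] by simp
  qed
  then show "AE \<omega> in M. cond_objective \<nu> \<omega> = real_cond_exp M G (\<lambda>\<omega>. (d_kc \<nu> (F \<omega>))\<^sup>2) \<omega>"
    by eventually_elim simp
next
  fix \<omega> and \<nu> :: "'b set" and \<epsilon> :: real
  assume \<omega>: "\<omega> \<in> space M" and \<nu>: "\<nu> \<in> Kkc_bdd B" and \<epsilon>: "\<epsilon> > 0"
  define \<mu> where "\<mu> = measure surface_measure (space (surface_measure :: 'b measure))"
  have \<mu>: "\<mu> \<ge> 0"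
    by (simp add: \<mu>_def)
  \<comment> \<open>Balances the two terms of the modulus of continuity: \<open>\<epsilon> / 4\<close> from \<open>\<eta> * \<mu>\<close>, and \<open>\<epsilon> / 2\<close> from the
     distance once it is below \<open>\<delta>\<close>.\<close>
  define \<eta> where "\<eta> = \<epsilon> / (8 * B * (\<mu> + 1))"
  have \<eta>: "\<eta> > 0"
    using \<epsilon> \<mu> B_pos by (simp add: \<eta>_def)
  have \<eta>\<mu>: "2 * B * (\<eta> * \<mu>) \<le> \<epsilon> / 4"
  proof -
    have "2 * B * (\<eta> * \<mu>) \<le> 2 * B * (\<eta> * (\<mu> + 1))"
      using B_pos \<eta> by (intro mult_left_mono) auto
    also have "\<dots> = \<epsilon> / 4"
      using B_pos \<mu> by (simp add: \<eta>_def)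
    finally show ?thesis .
  qed
  define \<delta> where "\<delta> = sqrt (\<eta> * \<epsilon> / (4 * B))"
  have \<delta>: "\<delta> > 0" "\<delta>\<^sup>2 = \<eta> * \<epsilon> / (4 * B)"
    using \<eta> \<epsilon> B_pos by (auto simp: \<delta>_def)
  show "\<exists>\<delta>>0. \<forall>\<nu>'\<in>Kkc_bdd B. d_kc \<nu>' \<nu> < \<delta> \<longrightarrow> \<bar>cond_objective \<nu>' \<omega> - cond_objective \<nu> \<omega>\<bar> < \<epsilon>"
  proof (intro exI[of _ \<delta>] conjI ballI impI \<delta>(1))
    fix \<nu>' :: "'b set" assume \<nu>': "\<nu>' \<in> Kkc_bdd B" and close: "d_kc \<nu>' \<nu> < \<delta>"
    have "(d_kc \<nu>' \<nu>)\<^sup>2 \<le> \<eta> * \<epsilon> / (4 * B)"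
      using power_mono[OF less_imp_le[OF close] d_kc_nonneg, of 2] \<delta>(2) by simp
    then have "2 * B * ((d_kc \<nu>' \<nu>)\<^sup>2 / \<eta>) \<le> 2 * B * ((\<eta> * \<epsilon> / (4 * B)) / \<eta>)"
      using B_pos \<eta> by (intro mult_left_mono divide_right_mono) auto
    also have "\<dots> = \<epsilon> / 2"
      using B_pos \<eta> by simp
    finally have "2 * B * ((d_kc \<nu>' \<nu>)\<^sup>2 / \<eta>) \<le> \<epsilon> / 2" .
    moreover have "\<bar>cond_objective \<nu>' \<omega> - cond_objective \<nu> \<omega>\<bar> \<le> 2 * B * ((d_kc \<nu>' \<nu>)\<^sup>2 / \<eta> + \<eta> * \<mu>)"
      using d_kc_sq_diff_le[OF N_Kkc_bdd[OF \<omega>] \<nu> \<nu>' \<eta>] by (simp add: cond_objective_def \<mu>_def)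
    ultimately show "\<bar>cond_objective \<nu>' \<omega> - cond_objective \<nu> \<omega>\<bar> < \<epsilon>"
      using \<eta>\<mu> \<epsilon> by (simp add: distrib_left)
  qed
qed

lemma cond_objective_arg_min:
  assumes "\<omega> \<in> space M"
  shows "is_arg_min (\<lambda>\<nu>. cond_objective \<nu> \<omega>) (\<lambda>\<nu>. \<nu> \<in> Kkc_bdd B) \<nu> \<longleftrightarrow> \<nu> = N \<omega>"
proof
  assume "is_arg_min (\<lambda>\<nu>. cond_objective \<nu> \<omega>) (\<lambda>\<nu>. \<nu> \<in> Kkc_bdd B) \<nu>"
  then have \<nu>: "\<nu> \<in> Kkc_bdd B" "cond_objective \<nu> \<omega> \<le> cond_objective (N \<omega>) \<omega>"
    using N_Kkc_bdd[OF assms] by (auto simp: is_arg_min_linorder)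
  then have "(d_kc \<nu> (N \<omega>))\<^sup>2 \<le> 0"
    by (simp add: cond_objective_def d_kc_self)
  then show "\<nu> = N \<omega>"
    by (intro d_kc_eq_0D[OF \<nu>(1) N_Kkc_bdd[OF assms]]) simp
qed (use N_Kkc_bdd[OF assms] in \<open>auto simp: is_arg_min_linorder cond_objective_def d_kc_self\<close>)

text \<open>
  Two continuous versions of the conditional objective agree off a single null set, by
  separability.
\<close>

lemma cond_frechet_objective_AE_unique:
  assumes D: "is_cond_frechet_objective M G B F D"
  shows "AE \<omega> in M. \<forall>\<nu>\<in>Kkc_bdd B. D \<nu> \<omega> = cond_objective \<nu> \<omega>"
proof -
  obtain \<C> :: "'b set set" where \<C>: "countable \<C>" "\<C> \<subseteq> Kkc_bdd B"
    and dense: "\<And>\<nu> \<delta>. \<nu> \<in> Kkc_bdd B \<Longrightarrow> \<delta> > 0 \<Longrightarrow> \<exists>\<nu>'\<in>\<C>. d_kc \<nu>' \<nu> < \<delta>"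
    by (rule Kkc_bdd_separable[of B]) blast
  note D' = cond_frechet_objective
  have "AE \<omega> in M. D \<nu> \<omega> = cond_objective \<nu> \<omega>" if "\<nu> \<in> \<C>" for \<nu>
  proof -
    have \<nu>: "\<nu> \<in> Kkc_bdd B"
      using that \<C>(2) by blast
    have "AE \<omega> in M. D \<nu> \<omega> = real_cond_exp M G (\<lambda>\<omega>. (d_kc \<nu> (F \<omega>))\<^sup>2) \<omega>"
      "AE \<omega> in M. cond_objective \<nu> \<omega> = real_cond_exp M G (\<lambda>\<omega>. (d_kc \<nu> (F \<omega>))\<^sup>2) \<omega>"
      using D D' \<nu> unfolding is_cond_frechet_objective_def by blast+
    then show ?thesis
      by eventually_elim simp
  qed
  then have "AE \<omega> in M. \<forall>\<nu>\<in>\<C>. D \<nu> \<omega> = cond_objective \<nu> \<omega>"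
    using \<C>(1) by (subst AE_ball_countable) auto
  then show ?thesis
    using AE_space
  proof eventually_elim
    case (elim \<omega>)
    show ?case
    proof
      fix \<nu> :: "'b set" assume \<nu>: "\<nu> \<in> Kkc_bdd B"
      have "\<bar>D \<nu> \<omega> - cond_objective \<nu> \<omega>\<bar> \<le> 0"
      proof (rule field_le_epsilon)
        fix e :: real assume e: "e > 0"
        obtain \<delta>1 where \<delta>1: "\<delta>1 > 0" "\<And>\<nu>'. \<nu>' \<in> Kkc_bdd B \<Longrightarrow> d_kc \<nu>' \<nu> < \<delta>1 \<Longrightarrow> \<bar>D \<nu>' \<omega> - D \<nu> \<omega>\<bar> < e / 2"
          using D \<nu> elim(2) half_gt_zero[OF e] unfolding is_cond_frechet_objective_def by meson
        obtain \<delta>2 where \<delta>2: "\<delta>2 > 0"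
          "\<And>\<nu>'. \<nu>' \<in> Kkc_bdd B \<Longrightarrow> d_kc \<nu>' \<nu> < \<delta>2 \<Longrightarrow> \<bar>cond_objective \<nu>' \<omega> - cond_objective \<nu> \<omega>\<bar> < e / 2"
          using D' \<nu> elim(2) half_gt_zero[OF e] unfolding is_cond_frechet_objective_def by meson
        obtain \<nu>' where \<nu>': "\<nu>' \<in> \<C>" "d_kc \<nu>' \<nu> < min \<delta>1 \<delta>2"
          using dense[OF \<nu>, of "min \<delta>1 \<delta>2"] \<delta>1 \<delta>2 by auto
        then have eq: "D \<nu>' \<omega> = cond_objective \<nu>' \<omega>" and "\<nu>' \<in> Kkc_bdd B"
          using elim \<C>(2) by auto
        then have "\<bar>D \<nu>' \<omega> - D \<nu> \<omega>\<bar> < e / 2" "\<bar>cond_objective \<nu>' \<omega> - cond_objective \<nu> \<omega>\<bar> < e / 2"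
          using \<delta>1(2)[of \<nu>'] \<delta>2(2)[of \<nu>'] \<nu>'(2) by auto
        then show "\<bar>D \<nu> \<omega> - cond_objective \<nu> \<omega>\<bar> \<le> 0 + e"
          unfolding eq by linarith
      qed
      then show "D \<nu> \<omega> = cond_objective \<nu> \<omega>"
        by simp
    qed
  qed
qed

theorem mean_is_cond_frechet_mean: "is_cond_frechet_mean M G B F N"
  unfolding is_cond_frechet_mean_def
proof (intro conjI exI[of _ cond_objective])
  show "AE \<omega> in M. is_arg_min (\<lambda>\<nu>. cond_objective \<nu> \<omega>) (\<lambda>\<nu>. \<nu> \<in> Kkc_bdd B) (N \<omega>)"
    by (intro AE_I2) (simp add: cond_objective_arg_min)
qed (rule N_G cond_frechet_objective)+

theorem cond_frechet_mean_AE_unique: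
  assumes "is_cond_frechet_mean M G B F N'"
  shows "AE \<omega> in M. N' \<omega> = N \<omega>"
proof -
  obtain D where D: "is_cond_frechet_objective M G B F D"
    and min: "AE \<omega> in M. is_arg_min (\<lambda>\<nu>. D \<nu> \<omega>) (\<lambda>\<nu>. \<nu> \<in> Kkc_bdd B) (N' \<omega>)"
    using assms by (auto simp: is_cond_frechet_mean_def)
  show ?thesis
    using min cond_frechet_objective_AE_unique[OF D] AE_space
  proof eventually_elim
    case (elim \<omega>)
    then have "is_arg_min (\<lambda>\<nu>. cond_objective \<nu> \<omega>) (\<lambda>\<nu>. \<nu> \<in> Kkc_bdd B) (N' \<omega>)"
      by (auto simp: is_arg_min_def)
    then show ?case
      using cond_objective_arg_min[OF elim(3)] by simp
  qed
qed

end

section \<open>The trivial sigma-algebra\<close>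

lemma measurable_trivial_const:
  fixes h :: "'a \<Rightarrow> 'b::t1_space"
  assumes h: "h \<in> borel_measurable G" and G: "sets G = {{}, space G}" and "\<omega> \<in> space G" "\<omega>' \<in> space G"
  shows "h \<omega> = h \<omega>'"
proof -
  have "h -` {h \<omega>'} \<inter> space G \<in> sets G"
    by (intro measurable_sets[OF h] borel_closed closed_singleton)
  then show ?thesis
    using assms by auto
qed

locale trivial_random_convex_set_mean = random_convex_set_mean +
  assumes trivial: "sets G = {{}, space M}"
begin

text \<open>
  \<open>N\<close> is constant because functions measurable for the trivial sigma-algebra are; any point of the
  space yields its value.
\<close>

definition expected_set :: "'b set" where
  "expected_set = N (SOME \<omega>. \<omega> \<in> space M)"

lemma some_space: "(SOME \<omega>. \<omega> \<in> space M) \<in> space M"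
  using not_empty by (simp add: some_in_eq)

lemma expected_set_Kkc_bdd: "expected_set \<in> Kkc_bdd B"
  unfolding expected_set_def by (rule N_Kkc_bdd[OF some_space])

lemma N_eq_expected_set:
  assumes \<omega>: "\<omega> \<in> space M"
  shows "N \<omega> = expected_set"
  unfolding expected_set_def
proof (rule Kkc_bdd_eqI[OF N_Kkc_bdd[OF \<omega>] N_Kkc_bdd[OF some_space]])
  fix p :: 'b
  show "support_fun p (N \<omega>) = support_fun p (N (SOME \<omega>. \<omega> \<in> space M))"
    by (rule measurable_trivial_const[OF measurable_N_support]) (use \<omega> some_space trivial in \<open>auto simp: space_G\<close>)
qed

lemma is_frechet_mean_iff: "is_frechet_mean M B F \<nu> \<longleftrightarrow> \<nu> = expected_set"
proof -
  define V where "V = (\<integral>\<omega>. (d_kc (N \<omega>) (F \<omega>))\<^sup>2 \<partial>M)"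
  have objective: "(\<integral>\<omega>. (d_kc \<nu> (F \<omega>))\<^sup>2 \<partial>M) = (d_kc \<nu> expected_set)\<^sup>2 + V" if \<nu>: "\<nu> \<in> Kkc_bdd B" for \<nu>
  proof -
    have whole: "(\<integral>\<omega>\<in>space M. f \<omega> \<partial>M) = (\<integral>\<omega>. f \<omega> \<partial>M)" for f :: "'a \<Rightarrow> real"
      unfolding set_lebesgue_integral_def by (intro Bochner_Integration.integral_cong) auto
    have "(\<integral>\<omega>. (d_kc \<nu> (F \<omega>))\<^sup>2 \<partial>M) = (\<integral>\<omega>. (d_kc \<nu> (N \<omega>))\<^sup>2 \<partial>M) + V"
      using set_integral_d_kc_decomposition[OF \<nu>, of "space M"] trivial by (simp add: whole V_def)
    also have "(\<integral>\<omega>. (d_kc \<nu> (N \<omega>))\<^sup>2 \<partial>M) = (\<integral>\<omega>. (d_kc \<nu> expected_set)\<^sup>2 \<partial>M)"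
      by (intro Bochner_Integration.integral_cong) (simp_all add: N_eq_expected_set)
    finally show ?thesis
      by (simp add: prob_space)
  qed
  show ?thesis
  proof
    assume "is_frechet_mean M B F \<nu>"
    then have \<nu>: "\<nu> \<in> Kkc_bdd B"
      and "(\<integral>\<omega>. (d_kc \<nu> (F \<omega>))\<^sup>2 \<partial>M) \<le> (\<integral>\<omega>. (d_kc expected_set (F \<omega>))\<^sup>2 \<partial>M)"
      using expected_set_Kkc_bdd by (auto simp: is_frechet_mean_def is_arg_min_linorder)
    then have "(d_kc \<nu> expected_set)\<^sup>2 \<le> 0"
      using objective[OF \<nu>] objective[OF expected_set_Kkc_bdd] by (simp add: d_kc_self)
    then show "\<nu> = expected_set"
      by (intro d_kc_eq_0D[OF \<nu> expected_set_Kkc_bdd]) simp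
  next
    assume "\<nu> = expected_set"
    then show "is_frechet_mean M B F \<nu>"
      using expected_set_Kkc_bdd objective
      by (auto simp: is_frechet_mean_def is_arg_min_linorder d_kc_self)
  qed
qed

lemma integral_eq_if_vec_cond_exp_eq:
  assumes f: "f \<in> selections M F" and eq: "AE \<omega> in M. x = vec_cond_exp M G f \<omega>"
  shows "(\<integral>\<omega>. f \<omega> \<partial>M) = x"
proof -
  have whole: "(\<integral>\<omega>\<in>space M. h \<omega> \<partial>M) = (\<integral>\<omega>. h \<omega> \<partial>M)" for h :: "'a \<Rightarrow> 'b"
    unfolding set_lebesgue_integral_def by (intro Bochner_Integration.integral_cong) auto
  have "(\<integral>\<omega>. f \<omega> \<partial>M) = (\<integral>\<omega>. vec_cond_exp M G f \<omega> \<partial>M)"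
    using set_integral_vec_cond_exp[OF selectionsD(1)[OF f], of "space M"] trivial by (simp add: whole)
  also have "\<dots> = (\<integral>\<omega>. x \<partial>M)"
    using eq by (intro integral_cong_AE) (auto elim: eventually_mono)
  finally show ?thesis
    by (simp add: prob_space)
qed

text \<open>
  A point of the constant set \<open>N\<close> is a constant selection of it, so representing selections of \<open>N\<close>
  as conditional expectations also gives the closedness of the unconditional Aumann mean.
\<close>

lemma aumann_mean_eq: "aumann_mean M F = expected_set"
proof (intro equalityI subsetI)
  fix x assume "x \<in> aumann_mean M F"
  then obtain f where f: "f \<in> selections M F" and x: "x = (\<integral>\<omega>. f \<omega> \<partial>M)"
    by (auto simp: aumann_mean_def)
  define y where "y = vec_cond_exp M G f (SOME \<omega>. \<omega> \<in> space M)"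
  have y: "vec_cond_exp M G f \<omega> = y" if "\<omega> \<in> space M" for \<omega>
    unfolding y_def
    by (rule measurable_trivial_const[OF borel_measurable_vec_cond_exp(1)]) (use that some_space trivial in \<open>auto simp: space_G\<close>)
  have "x = y"
    unfolding x by (rule integral_eq_if_vec_cond_exp_eq[OF f]) (auto simp: y)
  moreover have "AE \<omega> in M. y \<in> expected_set"
    using cond_exp_selection_in_mean[OF f] AE_space by eventually_elim (simp add: y N_eq_expected_set)
  ultimately show "x \<in> expected_set"
    by simp
next
  fix x assume x: "x \<in> expected_set"
  have "\<exists>f\<in>selections M F. AE \<omega> in M. x = vec_cond_exp M G f \<omega>"
    using x by (intro selection_of_mean_is_cond_exp AE_I2) (auto simp: N_eq_expected_set)
  then obtain f where "f \<in> selections M F" "AE \<omega> in M. x = vec_cond_exp M G f \<omega>"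
    by blast
  with integral_eq_if_vec_cond_exp_eq[OF this] show "x \<in> aumann_mean M F"
    by (auto simp: aumann_mean_def)
qed

end

text \<open>
  The tower property of conditional expectations, read on support functions: a mean of \<open>F\<close> over a
  coarser sigma-algebra is also a mean of the conditional mean of \<open>F\<close>.
\<close>

lemma (in random_convex_set_mean) cond_support_mean_tower:
  assumes H: "subalgebra G H" and K: "is_cond_support_mean M H B F K"
  shows "is_cond_support_mean M H B N K"
  unfolding is_cond_support_mean_def
proof (intro conjI allI)
  show "K \<in> H \<rightarrow>\<^sub>M set_space (Kkc_bdd B)"
    using K by (simp add: is_cond_support_mean_def)
  fix p :: 'b
  have sub: "subalgebra M H"
    using subalg H by (auto simp: subalgebra_def)
  interpret H: finite_measure_subalgebra M H
    by unfold_locales (rule sub)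
  have [measurable]: "(\<lambda>\<omega>. support_fun p (N \<omega>)) \<in> borel_measurable M"
    by (rule measurable_support_fun[OF N_M]) simp
  have "AE \<omega> in M. support_fun p (K \<omega>) = real_cond_exp M H (\<lambda>\<omega>. support_fun p (F \<omega>)) \<omega>"
    using K by (simp add: is_cond_support_mean_def)
  moreover have "AE \<omega> in M. real_cond_exp M H (real_cond_exp M G (\<lambda>\<omega>. support_fun p (F \<omega>))) \<omega> =
      real_cond_exp M H (\<lambda>\<omega>. support_fun p (F \<omega>)) \<omega>"
    by (rule H.real_cond_exp_nested_subalg[OF subalg H integrable_F_support])
  moreover have "AE \<omega> in M. real_cond_exp M H (\<lambda>\<omega>. support_fun p (N \<omega>)) \<omega> =
      real_cond_exp M H (real_cond_exp M G (\<lambda>\<omega>. support_fun p (F \<omega>))) \<omega>"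
    by (rule H.real_cond_exp_cong[OF support_N]) measurable
  ultimately show "AE \<omega> in M. support_fun p (K \<omega>) = real_cond_exp M H (\<lambda>\<omega>. support_fun p (N \<omega>)) \<omega>"
    by eventually_elim simp
qed

lemma is_cond_support_mean_cong_AE:
  assumes N: "is_cond_support_mean M G B F N" and eq: "AE \<omega> in M. N' \<omega> = N \<omega>"
    and N': "N' \<in> G \<rightarrow>\<^sub>M set_space (Kkc_bdd B)"
  shows "is_cond_support_mean M G B F N'"
  unfolding is_cond_support_mean_def
proof (intro conjI allI N')
  fix p
  have "AE \<omega> in M. support_fun p (N \<omega>) = real_cond_exp M G (\<lambda>\<omega>. support_fun p (F \<omega>)) \<omega>"
    using N by (simp add: is_cond_support_mean_def)
  with eq show "AE \<omega> in M. support_fun p (N' \<omega>) = real_cond_exp M G (\<lambda>\<omega>. support_fun p (F \<omega>)) \<omega>"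
    by eventually_elim simp
qed

section \<open>Frechet means and Aumann means\<close>

theorem proposition2p2:
  fixes M :: "'a measure" and B :: real
    and F :: "'a \<Rightarrow> (real ^ 'd) set"
    and X :: "'a \<Rightarrow> real ^ 'p" and \<X> :: "(real ^ 'p) set"
    and \<sigma>X :: "'a measure"
  assumes "prob_space M"
    and "B > 0"
    and "F \<in> M \<rightarrow>\<^sub>M set_space (Kkc_bdd B)"
    and "X \<in> M \<rightarrow>\<^sub>M restrict_space borel \<X>"
  defines "\<sigma>X \<equiv> vimage_algebra (space M) X (restrict_space borel \<X>)"
  shows
    "\<comment> \<open>(i)\<close>
     (\<exists>!\<nu>. is_frechet_mean M B F \<nu>) \<and>
     (\<exists>N. is_cond_frechet_mean M \<sigma>X B F N \<and>
        (\<forall>N'. is_cond_frechet_mean M \<sigma>X B F N' \<longrightarrow> (AE \<omega> in M. N' \<omega> = N \<omega>))) \<and>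
     \<comment> \<open>(ii)\<close>
     (\<forall>\<nu>. is_frechet_mean M B F \<nu> \<longrightarrow> \<nu> = aumann_mean M F) \<and>
     \<comment> \<open>(iii)\<close>
     (\<forall>N. is_cond_frechet_mean M \<sigma>X B F N \<longrightarrow>
        is_cond_aumann_mean M \<sigma>X F N \<and>
        (\<forall>A. is_cond_aumann_mean M \<sigma>X F A \<longrightarrow> (AE \<omega> in M. N \<omega> = A \<omega>)) \<and>
        (\<forall>\<nu>. is_frechet_mean M B F \<nu> \<longleftrightarrow> is_frechet_mean M B N \<nu>))"
proof -
  interpret prob_space M
    by fact
  have sub: "subalgebra M \<sigma>X"
    using \<open>X \<in> M \<rightarrow>\<^sub>M restrict_space borel \<X>\<close> unfolding subalgebra_def \<sigma>X_def
    by (auto simp: sets_vimage_algebra2 measurable_space intro: measurable_sets)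
  interpret X: random_convex_set M \<sigma>X F B
    by unfold_locales (use sub assms in auto)
  define H where "H = sigma (space M) {}"
  have H: "space H = space M" "sets H = {{}, space M}"
    by (auto simp: H_def sigma_sets_empty_eq)
  have sub_H: "subalgebra M H" "subalgebra \<sigma>X H"
    using H X.space_G sets.top[of \<sigma>X] by (auto simp: subalgebra_def)
  interpret H: random_convex_set M H F B
    by unfold_locales (use sub_H assms in auto)
  obtain K where K: "is_cond_support_mean M H B F K"
    using H.cond_support_mean_exists by blast
  interpret K: trivial_random_convex_set_mean M H F B K
    by unfold_locales (rule K H(2))+
  obtain N0 where N0: "is_cond_support_mean M \<sigma>X B F N0"
    using X.cond_support_mean_exists by blast
  interpret N0: random_convex_set_mean M \<sigma>X F B N0
    by unfold_locales (rule N0)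
  have frechet: "is_frechet_mean M B F \<nu> \<longleftrightarrow> \<nu> = K.expected_set" for \<nu>
    by (rule K.is_frechet_mean_iff)
  have part_iii: "is_cond_aumann_mean M \<sigma>X F N \<and>
        (\<forall>A. is_cond_aumann_mean M \<sigma>X F A \<longrightarrow> (AE \<omega> in M. N \<omega> = A \<omega>)) \<and>
        (\<forall>\<nu>. is_frechet_mean M B F \<nu> \<longleftrightarrow> is_frechet_mean M B N \<nu>)"
    if N: "is_cond_frechet_mean M \<sigma>X B F N" for N
  proof -
    have "is_cond_support_mean M \<sigma>X B F N"
      using N by (intro is_cond_support_mean_cong_AE[OF N0 N0.cond_frechet_mean_AE_unique])
        (auto simp: is_cond_frechet_mean_def)
    then interpret N: random_convex_set_mean M \<sigma>X F B N
      by unfold_locales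
    interpret KN: trivial_random_convex_set_mean M H N B K
      by unfold_locales (rule X.B_pos N.N_M N.cond_support_mean_tower[OF sub_H(2) K] K.trivial)+
    have "KN.expected_set = K.expected_set"
      by (simp only: K.expected_set_def KN.expected_set_def)
    with N.mean_is_cond_aumann_mean N.cond_aumann_mean_AE_unique show ?thesis
      unfolding frechet KN.is_frechet_mean_iff by blast
  qed
  show ?thesis
  proof (intro conjI)
    show "\<exists>!\<nu>. is_frechet_mean M B F \<nu>"
      unfolding frechet by blast
    show "\<exists>N. is_cond_frechet_mean M \<sigma>X B F N \<and>
        (\<forall>N'. is_cond_frechet_mean M \<sigma>X B F N' \<longrightarrow> (AE \<omega> in M. N' \<omega> = N \<omega>))"
      using N0.mean_is_cond_frechet_mean N0.cond_frechet_mean_AE_unique by blast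
    show "\<forall>\<nu>. is_frechet_mean M B F \<nu> \<longrightarrow> \<nu> = aumann_mean M F"
      unfolding frechet K.aumann_mean_eq by blast
  qed (use part_iii in blast)
qed

end
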